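(* For any integer $k\geq 2$, let $M$ be a $2k$-dimensional Einstein totally real submanifold of an $m$-dimensional complex space form $N^{m}(4c)$ of constant holomorphic sectional curvature $4c$. Then $$\delta_k^{\mathrm{Ric}}\leq 2(k-1)(c+H^2)$$ on $M$. The equality case of this inequality holds (that is, equality holds at every point of $M$) if and only if one of the following two cases occurs: (i) $M$ is a minimal and Einstein totally real submanifold such that, with respect to suitable orthonormal frames $\{e_1,\ldots,e_{2k},e_{2k+1},\ldots,e_{2m}\}$, the shape operators $A_r=A_{e_r}$ of $M$ take the block-diagonal form $$A_{r}=\begin{pmatrix} A_{1}^r&\cdots&0\\ \vdots&\ddots&\vdots\\ 0&\cdots&A_{k}^r\end{pmatrix},\qquad r=2k+1,\ldots,2m,$$ where $A_i^r$, $i=1,\ldots,k$, are symmetric $2\times 2$ submatrices satisfying $\operatorname{trace}(A_1^r)=\cdots=\operatorname{trace}(A_k^r)=0$. (ii) $M$ is a pseudo-umbilical and Einstein totally real submanifold such that, with respect to suitable orthonormal frames $\{e_1,\ldots,e_{2k},e_{2k+1},\ldots,e_{2m}\}$, the shape operators $A_r=A_{e_r}$ of $M$ take the block-diagonal form $$A_{r}=\begin{pmatrix} A_{1}^r&\cdots&0\\ \vdots&\ddots&\vdots\\ 0&\cdots&A_{k}^r\end{pmatrix},\qquad r=2k+2,\ldots,2m,$$ where $A_i^r$, $i=1,\ldots,k$, are symmetric $2\times 2$ submatrices satisfying $\operatorname{trace}(A_1^r)=\cdots=\operatorname{trace}(A_k^r)=0$.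
   Context: Intrinsic notions. Let $M$ be a Riemannian $n$-manifold. $K(\pi)$ denotes the sectional curvature of a plane section $\pi\subset T_pM$. For a unit vector $X\in T_pM$, $\mathrm{Ric}(X)=\sum_{j=2}^n K(X\wedge e_j)$, where $\{e_1=X,e_2,\ldots,e_n\}$ is an orthonormal basis of $T_pM$. $M$ is Einstein if $\mathrm{Ric}(X)$ is independent of the choice of the unit vector $X$; then $\mathrm{Ric}(X)=\frac{2}{n}\tau(p)$ for every unit $X\in T_pM$, where $\tau(p)=\sum_{1\le i<j\le n}K(e_i\wedge e_j)$. For a positive integer $q\le n/2$ define $$K_q^{\inf}(p)=\inf_{\pi_1\perp\cdots\perp\pi_q}\frac{K(\pi_1)+\cdots+K(\pi_q)}{q},$$ where $\pi_1,\ldots,\pi_q$ run over all $q$ mutually orthogonal plane sections in $T_pM$, and define the function $\delta_q^{\mathrm{Ric}}$ on $M$ by $$\delta_q^{\mathrm{Ric}}(p)=\sup_{X\in T_p^1M}\mathrm{Ric}(X)-\frac{2q}{n}K_q^{\inf}(p),\qquad T_p^1M=\{X\in T_pM:\|X\|=1\}.$$ Extrinsic notions. A complex space form $N^m(4c)$ is a Kähler manifold of complex dimension $m$, with complex structure $J$, of constant holomorphic sectional curvature $4c$, $c\in\mathbb{R}$. A submanifold $M$ of $N^m(4c)$, with the induced metric, is totally real if $J(T_pM)\subset T_p^\perp M$ for every $p\in M$, where $T_p^\perp M$ is the normal space. $h$ denotes the second fundamental form of $M$ in $N^m(4c)$, and for a normal vector $\xi$ the shape operator $A_\xi$ is given by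 $\langle A_\xi X,Y\rangle=\langle h(X,Y),\xi\rangle$. The mean curvature vector is $\overrightarrow{H}=\frac1n\operatorname{trace}h$ with $n=\dim M$, and $H=\|\overrightarrow{H}\|$. $M$ is minimal if $\overrightarrow{H}=0$; $M$ is pseudo-umbilical if $\overrightarrow{H}$ is nonzero and $A_{\overrightarrow{H}}$ is proportional to the identity map. The orthonormal frames $\{e_1,\ldots,e_{2k},e_{2k+1},\ldots,e_{2m}\}$ are frames of $N^m(4c)$ along $M$ with $e_1,\ldots,e_{2k}$ tangent to $M$ and $e_{2k+1},\ldots,e_{2m}$ normal to $M$; matrices of shape operators are taken with respect to $e_1,\ldots,e_{2k}$.
   Formalization: M is assumed connected; without this the equality case fails: the disjoint union of a totally geodesic R^4 and a round S^4 in R^5 inside C^5 has equality at every point but is neither minimal nor pseudo-umbilical. *)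

theory Defs
  imports "HOL-Analysis.Analysis"
begin

text \<open>
  Riemannian manifolds, Kaehler manifolds and second fundamental forms, done in charts.
  A manifold is a Hausdorff second countable space (a type) with an atlas modelled on a
  Euclidean space \<open>'a\<close>; the tangent space at \<open>p\<close> is \<open>'a\<close>, identified with
  $T_pM$ by one fixed chart \<open>chart_at M p\<close> around \<open>p\<close>.
\<close>

subsection \<open>Smooth maps and atlases\<close>

abbreviation Dv :: "('a::real_normed_vector \<Rightarrow> 'b::real_normed_vector) \<Rightarrow> 'a \<Rightarrow> 'a \<Rightarrow> 'b"
  where "Dv F x \<equiv> frechet_derivative F (at x)"

primrec Ck_on :: "nat \<Rightarrow> 'a::real_normed_vector set \<Rightarrow> ('a \<Rightarrow> 'b::real_normed_vector) \<Rightarrow> bool"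
where
  "Ck_on 0 S F \<longleftrightarrow> continuous_on S F"
| "Ck_on (Suc r) S F \<longleftrightarrow> (\<forall>x\<in>S. F differentiable at x) \<and> (\<forall>v. Ck_on r S (\<lambda>x. Dv F x v))"

definition smooth_on :: "'a::real_normed_vector set \<Rightarrow> ('a \<Rightarrow> 'b::real_normed_vector) \<Rightarrow> bool"
  where "smooth_on S F \<longleftrightarrow> (\<forall>r. Ck_on r S F)"

text \<open>A chart is a pair of its domain and its coordinate map.\<close>

type_synonym ('p, 'a) chart = "'p set \<times> ('p \<Rightarrow> 'a)"

abbreviation cdom :: "('p, 'a) chart \<Rightarrow> 'p set" where "cdom C \<equiv> fst C"
abbreviation cmap :: "('p, 'a) chart \<Rightarrow> 'p \<Rightarrow> 'a" where "cmap C \<equiv> snd C"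
abbreviation cran :: "('p, 'a) chart \<Rightarrow> 'a set" where "cran C \<equiv> cmap C ` cdom C"
abbreviation cinv :: "('p, 'a) chart \<Rightarrow> 'a \<Rightarrow> 'p" where "cinv C \<equiv> inv_into (cdom C) (cmap C)"

definition is_chart :: "('p::topological_space, 'a::euclidean_space) chart \<Rightarrow> bool"
  where "is_chart C \<longleftrightarrow>
    open (cdom C) \<and> open (cran C) \<and> homeomorphism (cdom C) (cran C) (cmap C) (cinv C)"

definition transition :: "('p, 'a) chart \<Rightarrow> ('p, 'a) chart \<Rightarrow> 'a \<Rightarrow> 'a"
  where "transition C C' = cmap C' \<circ> cinv C"

definition smooth_atlas :: "('p::topological_space, 'a::euclidean_space) chart set \<Rightarrow> bool"
  where "smooth_atlas A \<longleftrightarrow>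
    (\<forall>C\<in>A. is_chart C) \<and> (\<Union>C\<in>A. cdom C) = UNIV \<and>
    (\<forall>C\<in>A. \<forall>C'\<in>A. smooth_on (cmap C ` (cdom C \<inter> cdom C')) (transition C C'))"


subsection \<open>Riemannian manifolds\<close>

text \<open>\<open>metric M C x u v\<close> is the coordinate expression of the metric in the chart \<open>C\<close>,
  at the point with coordinates \<open>x\<close>.\<close>

record ('p, 'a) mfd =
  atlas :: "('p, 'a) chart set"
  metric :: "('p, 'a) chart \<Rightarrow> 'a \<Rightarrow> 'a \<Rightarrow> 'a \<Rightarrow> real"

definition riemannian_manifold ::
    "('p::{t2_space,second_countable_topology}, 'a::euclidean_space) mfd \<Rightarrow> bool"
  where "riemannian_manifold M \<longleftrightarrow>
    smooth_atlas (atlas M) \<and>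
    (\<forall>C\<in>atlas M.
      (\<forall>x\<in>cran C. bilinear (metric M C x) \<and>
        (\<forall>u v. metric M C x u v = metric M C x v u) \<and>
        (\<forall>u. u \<noteq> 0 \<longrightarrow> metric M C x u u > 0)) \<and>
      (\<forall>u v. smooth_on (cran C) (\<lambda>x. metric M C x u v))) \<and>
    (\<forall>C\<in>atlas M. \<forall>C'\<in>atlas M. \<forall>p\<in>cdom C \<inter> cdom C'. \<forall>u v.
      metric M C (cmap C p) u v =
      metric M C' (cmap C' p) (Dv (transition C C') (cmap C p) u) (Dv (transition C C') (cmap C p) v))"

text \<open>For constant vector fields \<open>u\<close>, \<open>v\<close> in the chart \<open>C\<close>, \<open>christoffel M C x u v\<close> is the
  Levi-Civita derivative $\nabla_u v$ (Koszul formula), so that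
  $\nabla_u V = D_uV + \Gamma(u,V)$ for every vector field $V$, and \<open>curv_loc\<close> is
  $R(u,v)w = \nabla_u\nabla_v w - \nabla_v\nabla_u w$.\<close>

definition christoffel :: "('p, 'a::euclidean_space) mfd \<Rightarrow> ('p, 'a) chart \<Rightarrow> 'a \<Rightarrow> 'a \<Rightarrow> 'a \<Rightarrow> 'a"
  where "christoffel M C x u v = (THE w. \<forall>z. metric M C x w z =
    (Dv (\<lambda>y. metric M C y v z) x u + Dv (\<lambda>y. metric M C y u z) x v
      - Dv (\<lambda>y. metric M C y u v) x z) / 2)"

definition curv_loc ::
    "('p, 'a::euclidean_space) mfd \<Rightarrow> ('p, 'a) chart \<Rightarrow> 'a \<Rightarrow> 'a \<Rightarrow> 'a \<Rightarrow> 'a \<Rightarrow> 'a"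
  where "curv_loc M C x u v w =
    Dv (\<lambda>y. christoffel M C y v w) x u + christoffel M C x u (christoffel M C x v w)
    - Dv (\<lambda>y. christoffel M C y u w) x v - christoffel M C x v (christoffel M C x u w)"

definition chart_at :: "('p, 'a) mfd \<Rightarrow> 'p \<Rightarrow> ('p, 'a) chart"
  where "chart_at M p = (SOME C. C \<in> atlas M \<and> p \<in> cdom C)"

abbreviation coord :: "('p, 'a) mfd \<Rightarrow> 'p \<Rightarrow> 'a"
  where "coord M p \<equiv> cmap (chart_at M p) p"

definition ip :: "('p, 'a) mfd \<Rightarrow> 'p \<Rightarrow> 'a \<Rightarrow> 'a \<Rightarrow> real"
  where "ip M p = metric M (chart_at M p) (coord M p)"

definition curv :: "('p, 'a::euclidean_space) mfd \<Rightarrow> 'p \<Rightarrow> 'a \<Rightarrow> 'a \<Rightarrow> 'a \<Rightarrow> 'a"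
  where "curv M p = curv_loc M (chart_at M p) (coord M p)"

definition orthonormal_on :: "('p, 'a) mfd \<Rightarrow> 'p \<Rightarrow> nat set \<Rightarrow> (nat \<Rightarrow> 'a) \<Rightarrow> bool"
  where "orthonormal_on M p I e \<longleftrightarrow>
    (\<forall>i\<in>I. \<forall>j\<in>I. ip M p (e i) (e j) = (if i = j then 1 else 0))"

text \<open>The values chosen by \<open>SOME\<close> below do not depend on the orthonormal basis.\<close>

definition sectional_curvature :: "('p, 'a::euclidean_space) mfd \<Rightarrow> 'p \<Rightarrow> 'a set \<Rightarrow> real"
  where "sectional_curvature M p \<pi> = (SOME \<kappa>. \<exists>u v.
    ip M p u u = 1 \<and> ip M p v v = 1 \<and> ip M p u v = 0 \<and> span {u, v} = \<pi> \<and>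
    \<kappa> = ip M p (curv M p u v v) u)"

definition Ric :: "('p, 'a::euclidean_space) mfd \<Rightarrow> 'p \<Rightarrow> 'a \<Rightarrow> real"
  where "Ric M p X = (SOME \<rho>. \<exists>e. orthonormal_on M p {1..DIM('a)} e \<and> e 1 = X \<and>
    \<rho> = (\<Sum>j=2..DIM('a). sectional_curvature M p (span {X, e j})))"

definition einstein :: "('p, 'a::euclidean_space) mfd \<Rightarrow> bool"
  where "einstein M \<longleftrightarrow> (\<forall>p. \<exists>\<rho>. \<forall>X. ip M p X X = 1 \<longrightarrow> Ric M p X = \<rho>)"

definition orthogonal_planes ::
    "('p, 'a::euclidean_space) mfd \<Rightarrow> 'p \<Rightarrow> nat \<Rightarrow> (nat \<Rightarrow> 'a set) \<Rightarrow> bool"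
  where "orthogonal_planes M p q \<pi> \<longleftrightarrow>
    (\<forall>i\<in>{1..q}. subspace (\<pi> i) \<and> dim (\<pi> i) = 2) \<and>
    (\<forall>i\<in>{1..q}. \<forall>j\<in>{1..q}. i \<noteq> j \<longrightarrow> (\<forall>u\<in>\<pi> i. \<forall>v\<in>\<pi> j. ip M p u v = 0))"

definition K_inf :: "('p, 'a::euclidean_space) mfd \<Rightarrow> nat \<Rightarrow> 'p \<Rightarrow> real"
  where "K_inf M q p =
    (INF \<pi>\<in>{\<pi>. orthogonal_planes M p q \<pi>}. (\<Sum>i=1..q. sectional_curvature M p (\<pi> i)) / real q)"

definition delta_Ric :: "('p, 'a::euclidean_space) mfd \<Rightarrow> nat \<Rightarrow> 'p \<Rightarrow> real"
  where "delta_Ric M q p =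
    (SUP X\<in>{X. ip M p X X = 1}. Ric M p X) - 2 * real q / real DIM('a) * K_inf M q p"


subsection \<open>Complex space forms\<close>

text \<open>The complex structure is multiplication by \<open>\<i>\<close> in holomorphic charts. As its coordinate
  expression is constant, $(\nabla_u J)v = \Gamma(u,Jv) - J\Gamma(u,v)$.\<close>

definition Jc :: "complex^'m \<Rightarrow> complex^'m"
  where "Jc v = \<i> *s v"

definition kaehler_manifold ::
    "('q::{t2_space,second_countable_topology}, complex^'m) mfd \<Rightarrow> bool"
  where "kaehler_manifold N \<longleftrightarrow>
    riemannian_manifold N \<and>
    (\<forall>C\<in>atlas N. \<forall>C'\<in>atlas N. \<forall>p\<in>cdom C \<inter> cdom C'. \<forall>v.
      Dv (transition C C') (cmap C p) (Jc v) = Jc (Dv (transition C C') (cmap C p) v)) \<and>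
    (\<forall>C\<in>atlas N. \<forall>x\<in>cran C. \<forall>u v.
      metric N C x (Jc u) (Jc v) = metric N C x u v \<and>
      christoffel N C x u (Jc v) = Jc (christoffel N C x u v))"

text \<open>\<open>complex_space_form N c\<close> describes $N^m(4c)$, $m$ being \<open>CARD('m)\<close>.\<close>

definition complex_space_form ::
    "('q::{t2_space,second_countable_topology}, complex^'m) mfd \<Rightarrow> real \<Rightarrow> bool"
  where "complex_space_form N c \<longleftrightarrow>
    kaehler_manifold N \<and>
    (\<forall>q X. X \<noteq> 0 \<longrightarrow> sectional_curvature N q (span {X, Jc X}) = 4 * c)"


subsection \<open>Submanifolds\<close>

definition local_rep ::
    "('p, 'a) chart \<Rightarrow> ('q, 'b) chart \<Rightarrow> ('p \<Rightarrow> 'q) \<Rightarrow> 'a \<Rightarrow> 'b"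
  where "local_rep C C' f = cmap C' \<circ> f \<circ> cinv C"

text \<open>A submanifold is given by an immersion \<open>f\<close> (the inclusion, for a subset), and the metric
  of \<open>M\<close> is the one induced by \<open>f\<close>.\<close>

definition submanifold ::
    "('p::{t2_space,second_countable_topology}, 'a::euclidean_space) mfd \<Rightarrow>
     ('q::{t2_space,second_countable_topology}, 'b::euclidean_space) mfd \<Rightarrow> ('p \<Rightarrow> 'q) \<Rightarrow> bool"
  where "submanifold M N f \<longleftrightarrow>
    riemannian_manifold M \<and> riemannian_manifold N \<and> continuous_on UNIV f \<and>
    (\<forall>C\<in>atlas M. \<forall>C'\<in>atlas N.
      smooth_on (cmap C ` (cdom C \<inter> f -` cdom C')) (local_rep C C' f) \<and>
      (\<forall>p\<in>cdom C \<inter> f -` cdom C'.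
        inj (Dv (local_rep C C' f) (cmap C p)) \<and>
        (\<forall>u v. metric M C (cmap C p) u v =
          metric N C' (cmap C' (f p))
            (Dv (local_rep C C' f) (cmap C p) u) (Dv (local_rep C C' f) (cmap C p) v))))"

abbreviation map_at :: "('p, 'a) mfd \<Rightarrow> ('q, 'b) mfd \<Rightarrow> ('p \<Rightarrow> 'q) \<Rightarrow> 'p \<Rightarrow> 'a \<Rightarrow> 'b"
  where "map_at M N f p \<equiv> local_rep (chart_at M p) (chart_at N (f p)) f"

definition differential ::
    "('p, 'a::euclidean_space) mfd \<Rightarrow> ('q, 'b::euclidean_space) mfd \<Rightarrow> ('p \<Rightarrow> 'q) \<Rightarrow> 'p \<Rightarrow> 'a \<Rightarrow> 'b"
  where "differential M N f p = Dv (map_at M N f p) (coord M p)"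

definition normal_space ::
    "('p, 'a::euclidean_space) mfd \<Rightarrow> ('q, 'b::euclidean_space) mfd \<Rightarrow> ('p \<Rightarrow> 'q) \<Rightarrow> 'p \<Rightarrow> 'b set"
  where "normal_space M N f p = {\<xi>. \<forall>u. ip N (f p) \<xi> (differential M N f p u) = 0}"

definition totally_real ::
    "('p, 'a::euclidean_space) mfd \<Rightarrow> ('q, complex^'m) mfd \<Rightarrow> ('p \<Rightarrow> 'q) \<Rightarrow> bool"
  where "totally_real M N f \<longleftrightarrow>
    (\<forall>p. Jc ` range (differential M N f p) \<subseteq> normal_space M N f p)"

text \<open>Gauss formula $h(u,v) = \overline\nabla_u f_*v - f_*\nabla_u v$, for constant fields in the
  chart around \<open>p\<close>.\<close>

definition sff ::
    "('p, 'a::euclidean_space) mfd \<Rightarrow> ('q, 'b::euclidean_space) mfd \<Rightarrow> ('p \<Rightarrow> 'q) \<Rightarrow> 'p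
      \<Rightarrow> 'a \<Rightarrow> 'a \<Rightarrow> 'b"
  where "sff M N f p u v =
    Dv (\<lambda>x. Dv (map_at M N f p) x v) (coord M p) u
    + christoffel N (chart_at N (f p)) (coord N (f p)) (differential M N f p u) (differential M N f p v)
    - differential M N f p (christoffel M (chart_at M p) (coord M p) u v)"

definition shape_operator ::
    "('p, 'a::euclidean_space) mfd \<Rightarrow> ('q, 'b::euclidean_space) mfd \<Rightarrow> ('p \<Rightarrow> 'q) \<Rightarrow> 'p
      \<Rightarrow> 'b \<Rightarrow> 'a \<Rightarrow> 'a"
  where "shape_operator M N f p \<xi> X =
    (THE Z. \<forall>Y. ip M p Z Y = ip N (f p) (sff M N f p X Y) \<xi>)"

definition mean_curvature_vector ::
    "('p, 'a::euclidean_space) mfd \<Rightarrow> ('q, 'b::euclidean_space) mfd \<Rightarrow> ('p \<Rightarrow> 'q) \<Rightarrow> 'p \<Rightarrow> 'b"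
  where "mean_curvature_vector M N f p = (SOME \<eta>. \<exists>e. orthonormal_on M p {1..DIM('a)} e \<and>
    \<eta> = (1 / real DIM('a)) *\<^sub>R (\<Sum>i=1..DIM('a). sff M N f p (e i) (e i)))"

definition mean_curvature ::
    "('p, 'a::euclidean_space) mfd \<Rightarrow> ('q, 'b::euclidean_space) mfd \<Rightarrow> ('p \<Rightarrow> 'q) \<Rightarrow> 'p \<Rightarrow> real"
  where "mean_curvature M N f p =
    sqrt (ip N (f p) (mean_curvature_vector M N f p) (mean_curvature_vector M N f p))"

definition minimal ::
    "('p, 'a::euclidean_space) mfd \<Rightarrow> ('q, 'b::euclidean_space) mfd \<Rightarrow> ('p \<Rightarrow> 'q) \<Rightarrow> bool"
  where "minimal M N f \<longleftrightarrow> (\<forall>p. mean_curvature_vector M N f p = 0)"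

definition pseudo_umbilical ::
    "('p, 'a::euclidean_space) mfd \<Rightarrow> ('q, 'b::euclidean_space) mfd \<Rightarrow> ('p \<Rightarrow> 'q) \<Rightarrow> bool"
  where "pseudo_umbilical M N f \<longleftrightarrow> (\<forall>p. mean_curvature_vector M N f p \<noteq> 0 \<and>
    (\<exists>\<mu>. \<forall>X. shape_operator M N f p (mean_curvature_vector M N f p) X = \<mu> *\<^sub>R X))"


subsection \<open>Adapted frames and block-diagonal shape operators\<close>

text \<open>An orthonormal frame $e_1,\dots,e_n,\xi_{n+1},\dots,\xi_{n'}$ of the ambient tangent space:
  the first $n$ vectors are given as elements of $T_pM$, the others are normal.\<close>

definition adapted_frame ::
    "('p, 'a::euclidean_space) mfd \<Rightarrow> ('q, 'b::euclidean_space) mfd \<Rightarrow> ('p \<Rightarrow> 'q) \<Rightarrow> 'p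
      \<Rightarrow> (nat \<Rightarrow> 'a) \<Rightarrow> (nat \<Rightarrow> 'b) \<Rightarrow> bool"
  where "adapted_frame M N f p e \<xi> \<longleftrightarrow>
    orthonormal_on M p {1..DIM('a)} e \<and>
    orthonormal_on N (f p) {DIM('a)+1..DIM('b)} \<xi> \<and>
    (\<forall>r\<in>{DIM('a)+1..DIM('b)}. \<xi> r \<in> normal_space M N f p)"

text \<open>Entry \<open>(a, b)\<close>, with indices starting at 1, of the matrix with diagonal \<open>2 \<times> 2\<close> blocks
  \<open>B 1\<close>, \<open>B 2\<close>, \<open>\<dots>\<close>: the indices \<open>2 * i - 1\<close> and \<open>2 * i\<close> belong to the block \<open>B i\<close>.\<close>

definition block_diag :: "(nat \<Rightarrow> real^2^2) \<Rightarrow> nat \<Rightarrow> nat \<Rightarrow> real"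
  where "block_diag B a b =
    (if (a + 1) div 2 = (b + 1) div 2
     then B ((a + 1) div 2) $ (if odd a then 1 else 2) $ (if odd b then 1 else 2) else 0)"

definition traceless_blocks :: "nat \<Rightarrow> (nat \<Rightarrow> 'a::real_vector) \<Rightarrow> ('a \<Rightarrow> 'a) \<Rightarrow> bool"
  where "traceless_blocks k e A \<longleftrightarrow> (\<exists>B :: nat \<Rightarrow> real^2^2.
    (\<forall>i\<in>{1..k}. transpose (B i) = B i \<and> trace (B i) = 0) \<and>
    (\<forall>b\<in>{1..2*k}. A (e b) = (\<Sum>a=1..2*k. block_diag B a b *\<^sub>R e a)))"

end

theory Submission
  imports Defs
begin

text \<open>
  Let \<open>e\<^sub>1, \<dots>, e\<^bsub>2k\<^esub>\<close> be an orthonormal frame adapted to orthogonal planes \<open>\<pi>\<^sub>1, \<dots>, \<pi>\<^sub>k\<close>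
  and let \<open>t\<^sub>i\<close> be the trace of \<open>h\<close> on \<open>\<pi>\<^sub>i\<close>. Summing the Gauss equation over pairs in different
  planes and using \<open>\<Sum>t\<^sub>i = 2kH\<close> gives
  \<open>2k Ric - 2 \<Sum>K(\<pi>\<^sub>i) = 4k(k-1)(c + \<bar>H\<bar>\<^sup>2) - \<Sum>\<bar>t\<^sub>i - 2H\<bar>\<^sup>2 - \<Sum>\<bar>h(e\<^sub>a,e\<^sub>b)\<bar>\<^sup>2\<close>, the last sum
  running over pairs in different planes. The infimum is attained by compactness, so equality at a point
  means that some frame makes both error sums vanish. On a block with trace \<open>2H\<close>, Cayley--Hamilton
  turns the Einstein condition into \<open>A\<^sub>H = \<bar>H\<bar>\<^sup>2 id\<close>.

  That \<open>H\<close> vanishes either everywhere or nowhere is a global matter: if equality holds everywhere, the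
  Codazzi equation along \<open>H\<close> together with the block structure forces \<open>d\<bar>H\<bar>\<^sup>2 = 0\<close>, and \<open>M\<close> is connected.
\<close>

subsection \<open>Calculus\<close>

text \<open>The totally real hypothesis acts only through <J du, dv> = 0. It deletes every J-term of
  the ambient curvature on tangent vectors, leaving c times the constant curvature tensor, and also
  the J-terms of R(du,dv)dw paired with H, so that the Codazzi equation along H is homogeneous. The
  Einstein condition makes the supremum of Ric its common value \<rho>, and 2q/n = 1 for q = k, n =
  2k; summing Ric over a frame gives 2k \<rho>, whence a division by 2k. The obstacle is that
  everything is defined pointwise by choices: charts at each point, frames for Ric and H, frames of
  equality without any continuity. So the algebra is done at one point on bare bilinear forms, the
  calculus in one pair of charts on bare metrics, and naturality of the second fundamental form
  under local isometries joins the two. H becomes visibly differentiable when its trace is written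
  with a dual basis instead of a frame, and of the equality condition only the frame-free identity
  A_H = |H|^2 id is differentiated.\<close>

lemma smooth_onD:
  assumes "smooth_on S F"
  shows "x \<in> S \<Longrightarrow> F differentiable at x" and "smooth_on S (\<lambda>x. Dv F x v)" and "continuous_on S F"
proof -
  show "x \<in> S \<Longrightarrow> F differentiable at x"
    using assms Ck_on.simps(2)[of 0 S F] unfolding smooth_on_def by blast
  show "smooth_on S (\<lambda>x. Dv F x v)"
    using assms Ck_on.simps(2)[of _ S F] unfolding smooth_on_def by blast
  show "continuous_on S F"
    using assms Ck_on.simps(1)[of S F] unfolding smooth_on_def by blast
qed

lemma Dv_has: "F differentiable at x \<Longrightarrow> (F has_derivative Dv F x) (at x)"
  by (simp add: frechet_derivative_works[symmetric])

lemma Dv_eq: "(F has_derivative F') (at x) \<Longrightarrow> Dv F x = F'"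
  by (metis frechet_derivative_at)

lemma linear_Dv: "F differentiable at x \<Longrightarrow> linear (Dv F x)"
  using Dv_has has_derivative_linear by blast

text \<open>\<open>frechet_derivative\<close> is a choice among all derivatives. Since F and G have
  the same ones at x, the choices agree, also where neither function is differentiable.\<close>

lemma Dv_cong_open:
  assumes "open S" "x \<in> S" "\<And>y. y \<in> S \<Longrightarrow> F y = G y"
  shows "Dv F x = Dv G x"
proof -
  have "(F has_derivative D) (at x) \<longleftrightarrow> (G has_derivative D) (at x)" for D
    using assms has_derivative_transform_within_open[of F D x UNIV S G]
      has_derivative_transform_within_open[of G D x UNIV S F] by auto
  then show ?thesis unfolding frechet_derivative_def by simp
qed

lemma differentiable_cong_open:
  assumes "F differentiable at x" "open S" "x \<in> S" "\<And>y. y \<in> S \<Longrightarrow> F y = G y"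
  shows "G differentiable at x"
  using assms has_derivative_transform_within_open[of F _ x UNIV S G]
  unfolding differentiable_def by blast

text \<open>Schwarz's theorem: the second difference of G over a small parallelogram is symmetric in
  the two directions, and the mean value theorem turns it into either mixed derivative at a nearby
  point.\<close>

lemma second_derivative_symmetric_real:
  fixes G :: "'a::real_normed_vector \<Rightarrow> real"
  assumes S: "open S" "x \<in> S"
    and G: "\<And>y. y \<in> S \<Longrightarrow> (G has_derivative G' y) (at y)"
    and Gu: "\<And>y. y \<in> S \<Longrightarrow> ((\<lambda>y. G' y u) has_derivative Gu y) (at y)"
    and Gv: "\<And>y. y \<in> S \<Longrightarrow> ((\<lambda>y. G' y v) has_derivative Gv y) (at y)"
    and cont: "continuous_on S (\<lambda>y. Gu y v)" "continuous_on S (\<lambda>y. Gv y u)"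
  shows "Gu x v = Gv x u"
proof -
  have key: "\<exists>s\<in>{0<..<t}. \<exists>r\<in>{0<..<t}.
      G (x + t *\<^sub>R a + t *\<^sub>R b) - G (x + t *\<^sub>R a) - G (x + t *\<^sub>R b) + G x
        = t * (t * Ga (x + s *\<^sub>R a + r *\<^sub>R b) b)"
    if t: "t > 0" and sub: "\<And>s r. \<lbrakk>0 \<le> s; s \<le> t; 0 \<le> r; r \<le> t\<rbrakk> \<Longrightarrow> x + s *\<^sub>R a + r *\<^sub>R b \<in> S"
      and Ga: "\<And>y. y \<in> S \<Longrightarrow> ((\<lambda>y. G' y a) has_derivative Ga y) (at y)"
    for a b t Ga
  proof -
    \<comment> \<open>p is the difference across the edge t b, so one mean value step along a leaves
      a difference of \<open>G' _ a\<close>, and a second one along b leaves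
      \<open>Ga\<close>.\<close>
    define p where "p s = G (x + s *\<^sub>R a + t *\<^sub>R b) - G (x + s *\<^sub>R a)" for s
    have dp: "DERIV p s :> G' (x + s *\<^sub>R a + t *\<^sub>R b) a - G' (x + s *\<^sub>R a) a" if "0 \<le> s" "s \<le> t" for s
    proof -
      have i: "x + s *\<^sub>R a + t *\<^sub>R b \<in> S" "x + s *\<^sub>R a \<in> S"
        using sub[OF that, of t] sub[OF that, of 0] t by auto
      have 1: "((\<lambda>s. G (x + s *\<^sub>R a + t *\<^sub>R b)) has_derivative (\<lambda>h. G' (x + s *\<^sub>R a + t *\<^sub>R b) (h *\<^sub>R a))) (at s)"
        by (rule has_derivative_compose[of "\<lambda>s. x + s *\<^sub>R a + t *\<^sub>R b", OF _ G[OF i(1)]]) (auto intro!: derivative_eq_intros)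
      have 2: "((\<lambda>s. G (x + s *\<^sub>R a)) has_derivative (\<lambda>h. G' (x + s *\<^sub>R a) (h *\<^sub>R a))) (at s)"
        by (rule has_derivative_compose[of "\<lambda>s. x + s *\<^sub>R a", OF _ G[OF i(2)]]) (auto intro!: derivative_eq_intros)
      have l: "linear (G' (x + s *\<^sub>R a + t *\<^sub>R b))" "linear (G' (x + s *\<^sub>R a))"
        using G i has_derivative_linear by blast+
      have e: "(\<lambda>h. G' (x + s *\<^sub>R a + t *\<^sub>R b) (h *\<^sub>R a) - G' (x + s *\<^sub>R a) (h *\<^sub>R a))
          = (*) (G' (x + s *\<^sub>R a + t *\<^sub>R b) a - G' (x + s *\<^sub>R a) a)"
        by (rule ext) (simp add: linear_scale[OF l(1)] linear_scale[OF l(2)] left_diff_distrib)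
      show ?thesis
        unfolding p_def has_field_derivative_def using has_derivative_diff[OF 1 2] unfolding e .
    qed
    obtain s where s: "0 < s" "s < t"
      and ps: "p t - p 0 = (t - 0) * (G' (x + s *\<^sub>R a + t *\<^sub>R b) a - G' (x + s *\<^sub>R a) a)"
      using MVT2[OF t dp] by blast
    define q where "q r = G' (x + s *\<^sub>R a + r *\<^sub>R b) a" for r
    have dq: "DERIV q r :> Ga (x + s *\<^sub>R a + r *\<^sub>R b) b" if "0 \<le> r" "r \<le> t" for r
    proof -
      have i: "x + s *\<^sub>R a + r *\<^sub>R b \<in> S" using sub that s by auto
      have 1: "((\<lambda>r. G' (x + s *\<^sub>R a + r *\<^sub>R b) a) has_derivative (\<lambda>h. Ga (x + s *\<^sub>R a + r *\<^sub>R b) (h *\<^sub>R b))) (at r)"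
        by (rule has_derivative_compose[of "\<lambda>r. x + s *\<^sub>R a + r *\<^sub>R b", OF _ Ga[OF i]]) (auto intro!: derivative_eq_intros)
      have l: "linear (Ga (x + s *\<^sub>R a + r *\<^sub>R b))"
        using Ga i has_derivative_linear by blast
      have e: "(\<lambda>h. Ga (x + s *\<^sub>R a + r *\<^sub>R b) (h *\<^sub>R b)) = (*) (Ga (x + s *\<^sub>R a + r *\<^sub>R b) b)"
        by (rule ext) (simp add: linear_scale[OF l])
      show ?thesis
        unfolding q_def has_field_derivative_def using 1 unfolding e .
    qed
    obtain r where r: "0 < r" "r < t" and qr: "q t - q 0 = (t - 0) * Ga (x + s *\<^sub>R a + r *\<^sub>R b) b"
      using MVT2[OF t dq] by blast
    have "p t - p 0 = t * (t * Ga (x + s *\<^sub>R a + r *\<^sub>R b) b)"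
      using ps qr by (simp add: q_def)
    then show ?thesis using s r unfolding p_def by (force simp: algebra_simps)
  qed
  show ?thesis
  proof (rule ccontr)
    assume ne: "Gu x v \<noteq> Gv x u"
    define \<epsilon> where "\<epsilon> = \<bar>Gu x v - Gv x u\<bar> / 2"
    have \<epsilon>: "\<epsilon> > 0" using ne by (simp add: \<epsilon>_def)
    have c: "isCont (\<lambda>y. Gu y v) x" "isCont (\<lambda>y. Gv y u) x"
      using cont S continuous_on_eq_continuous_at by blast+
    obtain d1 where d1: "d1 > 0" "\<And>y. dist y x < d1 \<Longrightarrow> \<bar>Gu y v - Gu x v\<bar> < \<epsilon>"
      using c(1)[unfolded continuous_at_eps_delta] \<epsilon> by (metis dist_real_def)
    obtain d2 where d2: "d2 > 0" "\<And>y. dist y x < d2 \<Longrightarrow> \<bar>Gv y u - Gv x u\<bar> < \<epsilon>"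
      using c(2)[unfolded continuous_at_eps_delta] \<epsilon> by (metis dist_real_def)
    obtain d3 where d3: "d3 > 0" "ball x d3 \<subseteq> S" using S open_contains_ball by blast
    define d where "d = min d1 (min d2 d3)"
    have d: "d > 0" using d1 d2 d3 by (simp add: d_def)
    \<comment> \<open>Small enough for the parallelogram with sides t u and t v at x to lie in the
      ball of radius d; the summand 1 keeps the denominator positive when u = v = 0.\<close>
    define t where "t = d / (2 * (norm u + norm v + 1))"
    have np: "norm u + norm v + 1 > 0" by (smt (verit) norm_ge_zero)
    have t: "t > 0" using d np by (simp add: t_def)
    have near: "dist (x + s *\<^sub>R u + r *\<^sub>R v) x < d" if "0 \<le> s" "s \<le> t" "0 \<le> r" "r \<le> t" for s r
    proof -
      have "dist (x + s *\<^sub>R u + r *\<^sub>R v) x \<le> s * norm u + r * norm v"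
        using that norm_triangle_ineq[of "s *\<^sub>R u" "r *\<^sub>R v"] by (simp add: dist_norm add.assoc)
      also have "\<dots> \<le> t * norm u + t * norm v"
        using that by (intro add_mono mult_right_mono) auto
      also have "\<dots> < t * (2 * (norm u + norm v + 1))"
        using t by (simp add: algebra_simps) (smt (verit) mult_nonneg_nonneg norm_ge_zero)
      also have "\<dots> = d" using np by (simp add: t_def)
      finally show ?thesis .
    qed
    have near': "x + s *\<^sub>R u + r *\<^sub>R v \<in> S" if "0 \<le> s" "s \<le> t" "0 \<le> r" "r \<le> t" for s r
      using near[OF that] d3 by (auto simp: d_def dist_commute)
    obtain s r where sr: "s \<in> {0<..<t}" "r \<in> {0<..<t}"
      "G (x + t *\<^sub>R u + t *\<^sub>R v) - G (x + t *\<^sub>R u) - G (x + t *\<^sub>R v) + G x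
        = t * (t * Gu (x + s *\<^sub>R u + r *\<^sub>R v) v)"
      using key[OF t near' Gu] by blast
    have near'': "x + s *\<^sub>R v + r *\<^sub>R u \<in> S" if "0 \<le> s" "s \<le> t" "0 \<le> r" "r \<le> t" for s r
      using near'[of r s] that by (simp add: add.commute add.left_commute)
    obtain s' r' where sr': "s' \<in> {0<..<t}" "r' \<in> {0<..<t}"
      "G (x + t *\<^sub>R v + t *\<^sub>R u) - G (x + t *\<^sub>R v) - G (x + t *\<^sub>R u) + G x
        = t * (t * Gv (x + s' *\<^sub>R v + r' *\<^sub>R u) u)"
      using key[OF t near'' Gv] by blast
    have ac: "x + t *\<^sub>R v + t *\<^sub>R u = x + t *\<^sub>R u + t *\<^sub>R v"
      "x + s' *\<^sub>R v + r' *\<^sub>R u = x + r' *\<^sub>R u + s' *\<^sub>R v"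
      by (simp_all add: ac_simps)
    have "t * (t * Gu (x + s *\<^sub>R u + r *\<^sub>R v) v) = t * (t * Gv (x + r' *\<^sub>R u + s' *\<^sub>R v) u)"
      using sr(3) sr'(3) ac by (simp only:)
    then have "Gu (x + s *\<^sub>R u + r *\<^sub>R v) v = Gv (x + r' *\<^sub>R u + s' *\<^sub>R v) u" using t by simp
    moreover have "\<bar>Gu (x + s *\<^sub>R u + r *\<^sub>R v) v - Gu x v\<bar> < \<epsilon>"
      using near[of s r] sr by (intro d1(2)) (auto simp: d_def)
    moreover have "\<bar>Gv (x + r' *\<^sub>R u + s' *\<^sub>R v) u - Gv x u\<bar> < \<epsilon>"
      using near[of r' s'] sr' by (intro d2(2)) (auto simp: d_def)
    ultimately show False unfolding \<epsilon>_def by (simp add: abs_if split: if_splits)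
  qed
qed

lemma second_derivative_symmetric:
  fixes F :: "'a::real_normed_vector \<Rightarrow> 'b::euclidean_space"
  assumes S: "open S" "x \<in> S" and F: "smooth_on S F"
  shows "Dv (\<lambda>y. Dv F y v) x u = Dv (\<lambda>y. Dv F y u) x v"
proof (rule euclidean_eqI)
  fix b :: 'b
  let ?G = "\<lambda>u y w. Dv (\<lambda>y. Dv F y u) y w \<bullet> b"
  have d2: "((\<lambda>y. Dv F y u \<bullet> b) has_derivative ?G u y) (at y)" if "y \<in> S" for u y
    by (rule has_derivative_inner_left, rule Dv_has, rule smooth_onD(1)[OF smooth_onD(2)[OF F] that])
  have c: "continuous_on S (\<lambda>y. ?G u y w)" for u w
    by (intro continuous_intros smooth_onD(3)[OF smooth_onD(2)[OF smooth_onD(2)[OF F]]])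
  have "?G v x u = ?G u x v"
  proof (rule second_derivative_symmetric_real[OF S])
    show "((\<lambda>y. F y \<bullet> b) has_derivative (\<lambda>w. Dv F y w \<bullet> b)) (at y)" if "y \<in> S" for y
      by (rule has_derivative_inner_left, rule Dv_has, rule smooth_onD(1)[OF F that])
  qed (use d2 c in auto)
  then show "Dv (\<lambda>y. Dv F y v) x u \<bullet> b = Dv (\<lambda>y. Dv F y u) x v \<bullet> b" .
qed

lemma linear_Dv_param:
  assumes S: "open S" "x \<in> S" and lin: "\<And>y. y \<in> S \<Longrightarrow> linear (L y)"
    and d: "\<And>v. (\<lambda>y. L y v) differentiable at x"
  shows "linear (\<lambda>v. Dv (\<lambda>y. L y v) x u)"
proof
  fix v w
  have "Dv (\<lambda>y. L y (v + w)) x = Dv (\<lambda>y. L y v + L y w) x"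
    using S lin by (intro Dv_cong_open[OF S]) (simp add: linear_add)
  also have "\<dots> = (\<lambda>h. Dv (\<lambda>y. L y v) x h + Dv (\<lambda>y. L y w) x h)"
    by (intro Dv_eq has_derivative_add Dv_has d)
  finally show "Dv (\<lambda>y. L y (v + w)) x u = Dv (\<lambda>y. L y v) x u + Dv (\<lambda>y. L y w) x u" by simp
next
  fix c v
  have "Dv (\<lambda>y. L y (c *\<^sub>R v)) x = Dv (\<lambda>y. c *\<^sub>R L y v) x"
    using S lin by (intro Dv_cong_open[OF S]) (simp add: linear_scale)
  also have "\<dots> = (\<lambda>h. c *\<^sub>R Dv (\<lambda>y. L y v) x h)"
    by (intro Dv_eq has_derivative_scaleR_right Dv_has d)
  finally show "Dv (\<lambda>y. L y (c *\<^sub>R v)) x u = c *\<^sub>R Dv (\<lambda>y. L y v) x u" by simp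
qed

text \<open>Differentiability is given for each y \<mapsto> L y v with v fixed, so a is expanded in
  a basis and the product rule is applied to finitely many summands.\<close>

lemma has_derivative_linear_field:
  fixes L :: "'c::real_normed_vector \<Rightarrow> 'a::euclidean_space \<Rightarrow> 'd::real_normed_vector"
  assumes S: "open S" "x \<in> S" and lin: "\<And>y. y \<in> S \<Longrightarrow> linear (L y)"
    and d: "\<And>v. (\<lambda>y. L y v) differentiable at x"
    and a: "(a has_derivative a') (at x)"
  shows "((\<lambda>y. L y (a y)) has_derivative (\<lambda>u. Dv (\<lambda>y. L y (a x)) x u + L x (a' u))) (at x)"
proof -
  have ex: "l v = (\<Sum>b\<in>Basis. (v \<bullet> b) *\<^sub>R l b)" if "linear l" for l :: "'a \<Rightarrow> 'e::real_vector" and v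
    using linear_sum[OF that] linear_scale[OF that] by (metis (no_types, lifting) euclidean_representation sum.cong)
  have "((\<lambda>y. \<Sum>b\<in>Basis. (a y \<bullet> b) *\<^sub>R L y b) has_derivative
     (\<lambda>u. \<Sum>b\<in>Basis. (a x \<bullet> b) *\<^sub>R Dv (\<lambda>y. L y b) x u + (a' u \<bullet> b) *\<^sub>R L x b)) (at x)"
    by (intro has_derivative_sum has_derivative_scaleR has_derivative_inner_left a Dv_has d)
  moreover have "(\<Sum>b\<in>Basis. (a x \<bullet> b) *\<^sub>R Dv (\<lambda>y. L y b) x u + (a' u \<bullet> b) *\<^sub>R L x b)
      = Dv (\<lambda>y. L y (a x)) x u + L x (a' u)" for u
    by (simp add: sum.distrib ex[OF lin[OF S(2)], symmetric]
        ex[OF linear_Dv_param[of S, OF S lin d], of "a x" u])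
  ultimately have "((\<lambda>y. \<Sum>b\<in>Basis. (a y \<bullet> b) *\<^sub>R L y b) has_derivative
      (\<lambda>u. Dv (\<lambda>y. L y (a x)) x u + L x (a' u))) (at x)" by simp
  then show ?thesis
    by (rule has_derivative_transform_within_open[OF _ S]) (use lin ex in metis)
qed

text \<open>The base point moves along \<phi> as well: the identity serves for a metric on its own
  domain, and F for objects of the target along a map.\<close>

lemma has_derivative_bilinear_field:
  fixes B :: "'e::real_normed_vector \<Rightarrow> 'a::euclidean_space \<Rightarrow> 'b::euclidean_space \<Rightarrow> 'd::real_normed_vector"
  assumes S: "open S" "\<phi> x \<in> S" and bil: "\<And>y. y \<in> S \<Longrightarrow> bilinear (B y)"
    and d: "\<And>v w. (\<lambda>y. B y v w) differentiable at (\<phi> x)"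
    and \<phi>: "(\<phi> has_derivative \<phi>') (at x)" and U: "open U" "x \<in> U" "\<phi> ` U \<subseteq> S"
    and a: "(a has_derivative a') (at x)" and b: "(b has_derivative b') (at x)"
  shows "((\<lambda>y. B (\<phi> y) (a y) (b y)) has_derivative
    (\<lambda>u. Dv (\<lambda>z. B z (a x) (b x)) (\<phi> x) (\<phi>' u) + B (\<phi> x) (a' u) (b x) + B (\<phi> x) (a x) (b' u))) (at x)"
proof -
  have dc: "((\<lambda>y. B (\<phi> y) v w) has_derivative (\<lambda>u. Dv (\<lambda>z. B z v w) (\<phi> x) (\<phi>' u))) (at x)" for v w
    using has_derivative_compose[OF \<phi> Dv_has[OF d]] .
  have 1: "((\<lambda>y. B (\<phi> y) v (b y)) has_derivative
      (\<lambda>u. Dv (\<lambda>z. B z v (b x)) (\<phi> x) (\<phi>' u) + B (\<phi> x) v (b' u))) (at x)" for v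
    using has_derivative_linear_field[OF U(1,2), of "\<lambda>y. B (\<phi> y) v", OF _ _ b] dc bil U(3)
    unfolding bilinear_def Dv_eq[OF dc] by (auto simp: differentiable_def image_subset_iff)
  have "((\<lambda>y. B (\<phi> y) (a y) (b y)) has_derivative
      (\<lambda>u. Dv (\<lambda>y. B (\<phi> y) (a x) (b y)) x u + B (\<phi> x) (a' u) (b x))) (at x)"
    using bil U(3) differentiableI[OF 1] unfolding bilinear_def
    by (intro has_derivative_linear_field[OF U(1,2), of "\<lambda>y v. B (\<phi> y) v (b y)", OF _ _ a])
      (auto simp: image_subset_iff)
  then show ?thesis
    unfolding Dv_eq[OF 1] by (simp add: algebra_simps)
qed


subsection \<open>Inner products and curvature-like tensors on a Euclidean space\<close>

locale inner_form =
  fixes G :: "'a::euclidean_space \<Rightarrow> 'a \<Rightarrow> real"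
  assumes bilinear_form: "bilinear G"
    and form_sym: "G u v = G v u"
    and form_pos: "u \<noteq> 0 \<Longrightarrow> G u u > 0"
begin

lemma form_linear: "linear (G u)" "linear (\<lambda>u. G u v)"
  using bilinear_form unfolding bilinear_def by auto

lemma form_simps:
  "G (u + v) w = G u w + G v w" "G u (v + w) = G u v + G u w"
  "G (u - v) w = G u w - G v w" "G u (v - w) = G u v - G u w"
  "G (- u) w = - G u w" "G u (- w) = - G u w"
  "G (c *\<^sub>R u) w = c * G u w" "G u (c *\<^sub>R w) = c * G u w"
  "G 0 w = 0" "G u 0 = 0"
  using bilinear_form
  by (simp_all add: bilinear_ladd bilinear_radd bilinear_lsub bilinear_rsub bilinear_lneg
      bilinear_rneg bilinear_lmul bilinear_rmul bilinear_lzero bilinear_rzero)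

lemma form_sum:
  "G (sum u I) w = (\<Sum>i\<in>I. G (u i) w)" "G w (sum u I) = (\<Sum>i\<in>I. G w (u i))"
  using linear_sum[OF form_linear(2)] linear_sum[OF form_linear(1)] by auto

lemma form_nonneg: "G u u \<ge> 0"
  using form_pos[of u] form_simps(9)[of 0] by (cases "u = 0") auto

lemma form_zero_iff: "G u u = 0 \<longleftrightarrow> u = 0"
  using form_pos[of u] form_simps(9)[of 0] by (cases "u = 0") auto

lemma form_ext:
  assumes "\<And>z. G u z = G v z" shows "u = v"
  using assms[of "u - v"] form_zero_iff[of "u - v"] by (simp add: form_simps)

lemma form_coords_inj: "inj (\<lambda>w. \<Sum>b\<in>Basis. G w b *\<^sub>R b)"
proof (rule injI)
  fix u v assume "(\<Sum>b\<in>Basis. G u b *\<^sub>R b) = (\<Sum>b\<in>Basis. G v b *\<^sub>R b)"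
  then have "G u b = G v b" if "b \<in> Basis" for b using that by (metis inner_sum_left_Basis)
  then have "G u z = G v z" for z
    using linear_eq_stdbasis[OF form_linear(1) form_linear(1)] by metis
  then show "u = v" by (rule form_ext)
qed

lemma form_coords_linear: "linear (\<lambda>w. \<Sum>b\<in>Basis. G w b *\<^sub>R b)"
  by (rule linearI) (simp_all add: form_simps scaleR_left_distrib sum.distrib scaleR_sum_right)

text \<open>Riesz representation: the Gram map is linear and injective, hence onto. It justifies the
  \<open>THE\<close> in the Christoffel symbols, the shape operator and the dual vectors.\<close>

lemma form_represents:
  assumes "linear k" shows "\<exists>!w. \<forall>z. G w z = k z"
proof -
  have "surj (\<lambda>w. \<Sum>b\<in>Basis. G w b *\<^sub>R b)"
    using linear_injective_imp_surjective[OF form_coords_linear form_coords_inj] by simp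
  from surjD[OF this, of "\<Sum>b\<in>Basis. k b *\<^sub>R b"]
  obtain w where w: "(\<Sum>b\<in>Basis. k b *\<^sub>R b) = (\<Sum>b\<in>Basis. G w b *\<^sub>R b)"
    by blast
  have "G w b = k b" if "b \<in> Basis" for b using that arg_cong[OF w, of "\<lambda>v. v \<bullet> b"] by simp
  then have "G w z = k z" for z using linear_eq_stdbasis[OF form_linear(1) assms] by metis
  then show ?thesis using form_ext by metis
qed

end

text \<open>Algebraic curvature tensors. Linearity is asked for in the last slot alone; pair
  symmetry and the skew symmetries carry it to the others.\<close>

locale curvature_like =
  fixes R :: "'a::real_vector \<Rightarrow> 'a \<Rightarrow> 'a \<Rightarrow> 'a \<Rightarrow> real"
  assumes skew12: "R u v w z = - R v u w z"
    and skew34: "R u v w z = - R u v z w"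
    and bianchi: "R u v w z + R v w u z + R w u v z = 0"
    and linear4: "linear (R u v w)"
begin

text \<open>The octahedron argument: four instances of the Bianchi identity, one for each vector in
  the last slot, combined with both skew symmetries.\<close>

lemma pair_sym: "R u v w z = R w z u v"
  using bianchi[of u v w z] bianchi[of v w z u] bianchi[of w z u v] bianchi[of z u v w]
    skew12[of u v] skew12[of v w] skew12[of w u] skew12[of z u] skew12[of w z] skew12[of v z]
    skew34[of _ _ w z] skew34[of _ _ u z] skew34[of _ _ v z] skew34[of _ _ u v] skew34[of _ _ u w] skew34[of _ _ v w]
  by (smt (verit))

lemma R_linear:
  "R u v w (z + z') = R u v w z + R u v w z'" "R u v w (c *\<^sub>R z) = c * R u v w z"
  "R u v (w + w') z = R u v w z + R u v w' z" "R u v (c *\<^sub>R w) z = c * R u v w z"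
  "R u (v + v') w z = R u v w z + R u v' w z" "R u (c *\<^sub>R v) w z = c * R u v w z"
  "R (u + u') v w z = R u v w z + R u' v w z" "R (c *\<^sub>R u) v w z = c * R u v w z"
proof -
  have a: "R u v w (z + z') = R u v w z + R u v w z'" "R u v w (c *\<^sub>R z) = c * R u v w z" for u v w z z' c
    using linear_add[OF linear4] linear_scale[OF linear4] by auto
  have b: "R u v (w + w') z = R u v w z + R u v w' z" "R u v (c *\<^sub>R w) z = c * R u v w z" for u v w w' z c
    using a skew34 by (metis minus_add_distrib, metis mult_minus_right)
  show "R u v w (z + z') = R u v w z + R u v w z'" "R u v w (c *\<^sub>R z) = c * R u v w z"
    "R u v (w + w') z = R u v w z + R u v w' z" "R u v (c *\<^sub>R w) z = c * R u v w z"
    "R u (v + v') w z = R u v w z + R u v' w z" "R u (c *\<^sub>R v) w z = c * R u v w z"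
    "R (u + u') v w z = R u v w z + R u' v w z" "R (c *\<^sub>R u) v w z = c * R u v w z"
    using a b pair_sym by metis+
qed

lemma R_zero: "R u u w z = 0" "R u v w w = 0"
  using skew12[of u u] skew34[of u v w w] by auto

end


subsection \<open>The Levi-Civita connection in a chart\<close>

text \<open>The Christoffel symbols with the metric as a bare function, so that the calculus in one
  chart does not mention a manifold.\<close>

definition levi :: "('a \<Rightarrow> 'a \<Rightarrow> 'a::euclidean_space \<Rightarrow> real) \<Rightarrow> 'a \<Rightarrow> 'a \<Rightarrow> 'a \<Rightarrow> 'a"
  where "levi g x u v = (THE w. \<forall>z. g x w z =
    (Dv (\<lambda>y. g y v z) x u + Dv (\<lambda>y. g y u z) x v - Dv (\<lambda>y. g y u v) x z) / 2)"

definition rcurv :: "('a \<Rightarrow> 'a \<Rightarrow> 'a::euclidean_space \<Rightarrow> real) \<Rightarrow> 'a \<Rightarrow> 'a \<Rightarrow> 'a \<Rightarrow> 'a \<Rightarrow> 'a"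
  where "rcurv g x u v w =
    Dv (\<lambda>y. levi g y v w) x u + levi g x u (levi g x v w)
    - Dv (\<lambda>y. levi g y u w) x v - levi g x v (levi g x u w)"

lemma christoffel_levi: "christoffel M C = levi (metric M C)"
  by (intro ext) (simp add: christoffel_def levi_def)

lemma curv_loc_rcurv: "curv_loc M C = rcurv (metric M C)"
  by (intro ext) (simp add: curv_loc_def rcurv_def christoffel_levi)

locale riem =
  fixes S :: "'a::euclidean_space set" and g :: "'a \<Rightarrow> 'a \<Rightarrow> 'a \<Rightarrow> real"
  assumes open_S: "open S"
    and bilinear_g: "x \<in> S \<Longrightarrow> bilinear (g x)"
    and g_sym: "x \<in> S \<Longrightarrow> g x u v = g x v u"
    and g_pos: "\<lbrakk>x \<in> S; u \<noteq> 0\<rbrakk> \<Longrightarrow> g x u u > 0"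
    and smooth_g: "smooth_on S (\<lambda>x. g x u v)"
begin

lemma inner_form_g: "x \<in> S \<Longrightarrow> inner_form (g x)"
  by (simp add: inner_form_def bilinear_g g_sym g_pos)

lemma differentiable_g: "x \<in> S \<Longrightarrow> (\<lambda>y. g y u v) differentiable at x"
  using smooth_onD(1)[OF smooth_g] .

lemma differentiable_dg: "x \<in> S \<Longrightarrow> (\<lambda>y. Dv (\<lambda>y. g y u v) y w) differentiable at x"
  using smooth_onD(1)[OF smooth_onD(2)[OF smooth_g]] .

lemma Dg_sym: "x \<in> S \<Longrightarrow> Dv (\<lambda>y. g y u v) x = Dv (\<lambda>y. g y v u) x"
  by (rule Dv_cong_open[OF open_S]) (auto simp: g_sym)

lemma DDg_sym: "x \<in> S \<Longrightarrow>
  Dv (\<lambda>y. Dv (\<lambda>y. g y u v) y w) x z = Dv (\<lambda>y. Dv (\<lambda>y. g y v u) y w) x z"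
  by (rule fun_cong[of _ _ z], rule Dv_cong_open[OF open_S]) (auto simp: Dg_sym)

lemma linear_Dg:
  assumes "x \<in> S" shows "linear (\<lambda>v. Dv (\<lambda>y. g y u v) x w)" "linear (\<lambda>v. Dv (\<lambda>y. g y v u) x w)"
    "linear (Dv (\<lambda>y. g y u v) x)"
  using assms bilinear_g differentiable_g unfolding bilinear_def
  by (auto intro!: linear_Dv_param[OF open_S] linear_Dv)

text \<open>The Koszul expression is linear in z, so exactly one vector represents it.\<close>

lemma levi_eq:
  assumes x: "x \<in> S"
  shows "g x (levi g x u v) z =
    (Dv (\<lambda>y. g y v z) x u + Dv (\<lambda>y. g y u z) x v - Dv (\<lambda>y. g y u v) x z) / 2"
proof -
  interpret inner_form "g x" by (rule inner_form_g[OF x])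
  have "linear (\<lambda>z. (Dv (\<lambda>y. g y v z) x u + Dv (\<lambda>y. g y u z) x v - Dv (\<lambda>y. g y u v) x z) / 2)"
    by (rule linearI)
      (simp_all add: linear_add[OF linear_Dg(1)[OF x]] linear_add[OF linear_Dg(3)[OF x]]
        linear_scale[OF linear_Dg(1)[OF x]] linear_scale[OF linear_Dg(3)[OF x]] field_simps)
  from theI'[OF form_represents[OF this]] show ?thesis unfolding levi_def by blast
qed

lemma levi_unique:
  assumes x: "x \<in> S" and "\<And>z. g x w z = g x (levi g x u v) z"
  shows "w = levi g x u v"
  using inner_form.form_ext[OF inner_form_g[OF x]] assms(2) by blast

lemma levi_sym: "x \<in> S \<Longrightarrow> levi g x u v = levi g x v u"
  by (rule levi_unique) (auto simp: levi_eq Dg_sym[of x u v])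

lemma bilinear_levi:
  assumes x: "x \<in> S" shows "bilinear (levi g x)"
proof -
  interpret inner_form "g x" by (rule inner_form_g[OF x])
  have "linear (levi g x u)" for u
  proof
    fix v w show "levi g x u (v + w) = levi g x u v + levi g x u w"
      using linear_add[OF linear_Dg(1)[OF x]] linear_add[OF linear_Dg(2)[OF x]] linear_add[OF linear_Dg(3)[OF x]]
      by (intro form_ext) (simp add: form_simps levi_eq[OF x] field_simps)
  next
    fix c v show "levi g x u (c *\<^sub>R v) = c *\<^sub>R levi g x u v"
      using linear_scale[OF linear_Dg(1)[OF x]] linear_scale[OF linear_Dg(2)[OF x]] linear_scale[OF linear_Dg(3)[OF x]]
      by (intro form_ext) (simp add: form_simps levi_eq[OF x] field_simps)
  qed
  moreover have "(\<lambda>u. levi g x u v) = levi g x v" for v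
    by (rule ext) (rule levi_sym[OF x])
  ultimately show ?thesis unfolding bilinear_def by simp
qed

text \<open>In the sum of the two Koszul expressions the derivatives along v and w cancel.\<close>

lemma levi_compat:
  assumes x: "x \<in> S"
  shows "Dv (\<lambda>y. g y v w) x u = g x (levi g x u v) w + g x v (levi g x u w)"
  using Dg_sym[OF x, of v w] Dg_sym[OF x, of u w] Dg_sym[OF x, of u v]
  by (simp add: g_sym[OF x, of v "levi g x u w"] levi_eq[OF x] field_simps)

text \<open>Solving the linear system \<open>g y (w y) z = k y z\<close> is inverting the map
  \<open>(y, w) \<mapsto> (y, g y w)\<close>, to which the inverse function theorem applies.\<close>

lemma differentiable_represented:
  assumes x: "x \<in> S" and w: "\<And>y z. y \<in> S \<Longrightarrow> g y (w y) z = k y z"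
    and k: "\<And>z. (\<lambda>y. k y z) differentiable at x"
  shows "w differentiable at x"
proof -
  define A where "A y v = (\<Sum>b\<in>Basis. g y v b *\<^sub>R b)" for y v
  have A_lin: "linear (A y)" and A_inj: "inj (A y)" if "y \<in> S" for y
    using inner_form.form_coords_linear[OF inner_form_g[OF that]]
      inner_form.form_coords_inj[OF inner_form_g[OF that]] unfolding A_def[abs_def] by auto
  have A_diff: "(\<lambda>y. A y v) differentiable at y" if "y \<in> S" for y v
    unfolding A_def by (intro differentiable_sum ballI differentiable_scaleR differentiable_g that) auto
  have A_diff': "((\<lambda>q. A (fst q) v) has_derivative (\<lambda>h. Dv (\<lambda>y. A y v) (fst p) (fst h))) (at p)"
    if "fst p \<in> S" for p :: "'a \<times> 'a" and v
    by (rule has_derivative_compose[of fst, OF has_derivative_fst[OF has_derivative_ident] Dv_has[OF A_diff[OF that]]])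
  have op: "open (S \<times> UNIV)" by (simp add: open_S open_Times)
  define \<Phi> where "\<Phi> p = (fst p, A (fst p) (snd p))" for p :: "'a \<times> 'a"
  define \<Psi> where "\<Psi> p = (fst p, inv (A (fst p)) (snd p))" for p :: "'a \<times> 'a"
  define E where "E p = Dv (\<lambda>y. A y (snd p)) (fst p)" for p :: "'a \<times> 'a"
  have d\<Phi>: "(\<Phi> has_derivative (\<lambda>h. (fst h, E p (fst h) + A (fst p) (snd h)))) (at p)"
    if p: "p \<in> S \<times> UNIV" for p
  proof -
    have "((\<lambda>q. A (fst q) (snd q)) has_derivative
        (\<lambda>h. Dv (\<lambda>q. A (fst q) (snd p)) p h + A (fst p) (snd h))) (at p)"
    proof (rule has_derivative_linear_field[OF op p, of "\<lambda>q. A (fst q)"])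
      show "(\<lambda>q. A (fst q) v) differentiable at p" for v
        using p by (intro differentiableI[OF A_diff']) auto
    qed (auto intro: A_lin intro!: derivative_intros)
    moreover have "fst p \<in> S" using p by auto
    ultimately show ?thesis
      unfolding \<Phi>_def E_def Dv_eq[OF A_diff'[OF \<open>fst p \<in> S\<close>]]
      by (intro has_derivative_Pair has_derivative_fst has_derivative_ident)
  qed
  have "continuous_on (S \<times> UNIV) \<Phi>"
    unfolding continuous_on_eq_continuous_at[OF op]
    using has_derivative_continuous[OF d\<Phi>] by blast
  moreover have "\<Psi> (\<Phi> p) = p" if "p \<in> S \<times> UNIV" for p
    using that A_inj[of "fst p"] by (auto simp: \<Phi>_def \<Psi>_def)
  moreover have p: "(x, w x) \<in> S \<times> UNIV" using x by auto
  moreover have "(\<lambda>h. (fst h, E (x, w x) (fst h) + A x (snd h))) \<circ>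
      (\<lambda>h. (fst h, inv (A x) (snd h - E (x, w x) (fst h)))) = id"
    using linear_injective_imp_surjective[OF A_lin[OF x] A_inj[OF x]]
    by (auto simp: fun_eq_iff surj_f_inv_f)
  ultimately have "(\<Psi> has_derivative (\<lambda>h. (fst h, inv (A x) (snd h - E (x, w x) (fst h))))) (at (\<Phi> (x, w x)))"
    using has_derivative_inverse_strong[OF op p, of \<Phi> \<Psi>] d\<Phi>[OF p] by simp
  \<comment> \<open>In coordinates k y is \<open>A y (w y)\<close>, so w y is the second component
    of \<open>\<Psi>\<close> at this point.\<close>
  moreover have K: "(\<lambda>y. (y, \<Sum>b\<in>Basis. k y b *\<^sub>R b)) differentiable at x"
    using k by (intro differentiable_Pair differentiable_sum ballI differentiable_scaleR) auto
  moreover have "\<Phi> (x, w x) = (x, \<Sum>b\<in>Basis. k x b *\<^sub>R b)"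
    using w x by (simp add: \<Phi>_def A_def)
  ultimately have "((\<lambda>y. \<Psi> (y, \<Sum>b\<in>Basis. k y b *\<^sub>R b)) has_derivative
      (\<lambda>u. (\<lambda>h. (fst h, inv (A x) (snd h - E (x, w x) (fst h)))) (Dv (\<lambda>y. (y, \<Sum>b\<in>Basis. k y b *\<^sub>R b)) x u))) (at x)"
    by (intro has_derivative_compose[of "\<lambda>y. (y, \<Sum>b\<in>Basis. k y b *\<^sub>R b)" _ x UNIV \<Psi>] Dv_has) auto
  from differentiableI[OF has_derivative_snd[OF this]]
  have "(\<lambda>y. snd (\<Psi> (y, \<Sum>b\<in>Basis. k y b *\<^sub>R b))) differentiable at x" .
  then show ?thesis
  proof (rule differentiable_cong_open[OF _ open_S x])
    fix y assume y: "y \<in> S"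
    then have "(\<Sum>b\<in>Basis. k y b *\<^sub>R b) = A y (w y)" using w by (simp add: A_def)
    then show "snd (\<Psi> (y, \<Sum>b\<in>Basis. k y b *\<^sub>R b)) = w y"
      using A_inj[OF y] by (simp add: \<Psi>_def)
  qed
qed

lemma has_derivative_koszul:
  assumes "x \<in> S"
  shows "((\<lambda>y. (Dv (\<lambda>y. g y v z) y u + Dv (\<lambda>y. g y u z) y v - Dv (\<lambda>y. g y u v) y z) / 2)
    has_derivative (\<lambda>w. (Dv (\<lambda>y. Dv (\<lambda>y. g y v z) y u) x w + Dv (\<lambda>y. Dv (\<lambda>y. g y u z) y v) x w
      - Dv (\<lambda>y. Dv (\<lambda>y. g y u v) y z) x w) / 2)) (at x)"
  by (intro bounded_linear.has_derivative[OF bounded_linear_divide] has_derivative_diff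
      has_derivative_add Dv_has differentiable_dg assms)

lemma differentiable_levi: "x \<in> S \<Longrightarrow> (\<lambda>y. levi g y u v) differentiable at x"
  by (rule differentiable_represented[OF _ levi_eq differentiableI[OF has_derivative_koszul]])

lemma has_derivative_metric:
  assumes x: "x \<in> S" and a: "(a has_derivative a') (at x)" and b: "(b has_derivative b') (at x)"
  shows "((\<lambda>y. g y (a y) (b y)) has_derivative (\<lambda>u. g x (a' u + levi g x u (a x)) (b x)
    + g x (a x) (b' u + levi g x u (b x)))) (at x)"
proof -
  interpret inner_form "g x" by (rule inner_form_g[OF x])
  have "((\<lambda>y. g y (a y) (b y)) has_derivative
    (\<lambda>u. Dv (\<lambda>z. g z (a x) (b x)) x u + g x (a' u) (b x) + g x (a x) (b' u))) (at x)"
    by (rule has_derivative_bilinear_field[OF open_S _ bilinear_g _ has_derivative_ident open_S])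
      (use x a b differentiable_g in auto)
  then show ?thesis by (simp add: levi_compat[OF x] form_simps algebra_simps)
qed

text \<open>With the index lowered, the curvature consists of second derivatives of the metric and
  products of Christoffel vectors, from which its symmetries can be read off.\<close>

lemma rcurv_eq:
  assumes x: "x \<in> S"
  shows "g x (rcurv g x u v w) z =
    (Dv (\<lambda>y. Dv (\<lambda>y. g y v z) y w) x u - Dv (\<lambda>y. Dv (\<lambda>y. g y v w) y z) x u
     - Dv (\<lambda>y. Dv (\<lambda>y. g y u z) y w) x v + Dv (\<lambda>y. Dv (\<lambda>y. g y u w) y z) x v) / 2
    - g x (levi g x v w) (levi g x u z) + g x (levi g x u w) (levi g x v z)"
proof -
  interpret inner_form "g x" by (rule inner_form_g[OF x])
  \<comment> \<open>Both sides are the derivative along u of \<open>g y (levi g y v w) z\<close>, by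
    metric compatibility and by the Koszul formula. Antisymmetrising in u and v cancels the
    derivatives of \<open>g y w z\<close> by Schwarz.\<close>
  have 1: "g x (Dv (\<lambda>y. levi g y v w) x u + levi g x u (levi g x v w)) z + g x (levi g x v w) (levi g x u z) =
     (Dv (\<lambda>y. Dv (\<lambda>y. g y w z) y v) x u + Dv (\<lambda>y. Dv (\<lambda>y. g y v z) y w) x u
      - Dv (\<lambda>y. Dv (\<lambda>y. g y v w) y z) x u) / 2" for u v
  proof -
    have "((\<lambda>y. g y (levi g y v w) z) has_derivative
       (\<lambda>u. g x (Dv (\<lambda>y. levi g y v w) x u + levi g x u (levi g x v w)) z
         + g x (levi g x v w) (0 + levi g x u z))) (at x)"
      by (rule has_derivative_metric[OF x Dv_has[OF differentiable_levi[OF x]]]) simp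
    moreover note has_derivative_koszul[OF x, of w z v]
    moreover have "Dv (\<lambda>y. (Dv (\<lambda>y. g y w z) y v + Dv (\<lambda>y. g y v z) y w - Dv (\<lambda>y. g y v w) y z) / 2) x
        = Dv (\<lambda>y. g y (levi g y v w) z) x"
      by (rule Dv_cong_open[OF open_S x]) (simp add: levi_eq)
    ultimately show ?thesis by (simp add: Dv_eq fun_eq_iff)
  qed
  have "Dv (\<lambda>y. Dv (\<lambda>y. g y w z) y v) x u = Dv (\<lambda>y. Dv (\<lambda>y. g y w z) y u) x v"
    by (rule second_derivative_symmetric[OF open_S x smooth_g])
  then show ?thesis
    using 1[of u v] 1[of v u] unfolding rcurv_def by (simp add: form_simps field_simps)
qed

lemma curvature_like_rcurv:
  assumes x: "x \<in> S"
  shows "curvature_like (\<lambda>u v w z. g x (rcurv g x u v w) z)"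
proof -
  interpret inner_form "g x" by (rule inner_form_g[OF x])
  note cl = second_derivative_symmetric[OF open_S x smooth_g]
  show ?thesis
  proof
    fix u v w z
    show "g x (rcurv g x u v w) z = - g x (rcurv g x v u w) z"
      unfolding rcurv_eq[OF x] by (simp add: field_simps)
    show "g x (rcurv g x u v w) z = - g x (rcurv g x u v z) w"
      unfolding rcurv_eq[OF x] form_sym[of "levi g x v z"] form_sym[of "levi g x u z"]
      by (simp add: field_simps)
    show "g x (rcurv g x u v w) z + g x (rcurv g x v w u) z + g x (rcurv g x w u v) z = 0"
      using cl[of v z w u] cl[of v w z u] cl[of u z w v] cl[of w z u v]
        DDg_sym[OF x, of u v z w] DDg_sym[OF x, of u w z v] DDg_sym[OF x, of v w z u]
      unfolding rcurv_eq[OF x] levi_sym[OF x, of v u] levi_sym[OF x, of w u] levi_sym[OF x, of w v]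
      by (simp add: field_simps)
    show "g x (rcurv g x u v w) (y + z) = g x (rcurv g x u v w) y + g x (rcurv g x u v w) z" for y
      by (simp add: form_simps)
    show "g x (rcurv g x u v w) (c *\<^sub>R z) = c *\<^sub>R g x (rcurv g x u v w) z" for c
      by (simp add: form_simps)
  qed
qed

end


subsection \<open>Isometric maps: the equations of Gauss and Codazzi\<close>

text \<open>The formula of \<open>sff\<close> for an arbitrary pair of charts: \<open>sff\<close>
  itself is tied to the charts chosen at each point and cannot be differentiated directly.\<close>

definition sform ::
  "('a \<Rightarrow> 'a \<Rightarrow> 'a::euclidean_space \<Rightarrow> real) \<Rightarrow> ('b \<Rightarrow> 'b \<Rightarrow> 'b::euclidean_space \<Rightarrow> real) \<Rightarrow> ('a \<Rightarrow> 'b)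
    \<Rightarrow> 'a \<Rightarrow> 'a \<Rightarrow> 'a \<Rightarrow> 'b"
  where "sform g g' F x u v =
    Dv (\<lambda>y. Dv F y v) x u + levi g' (F x) (Dv F x u) (Dv F x v) - Dv F x (levi g x u v)"

text \<open>The Levi-Civita connection of the target pulled back along F; V is any field along F,
  tangent or not.\<close>

definition covd ::
  "('b \<Rightarrow> 'b \<Rightarrow> 'b::euclidean_space \<Rightarrow> real) \<Rightarrow> ('a::euclidean_space \<Rightarrow> 'b) \<Rightarrow> 'a \<Rightarrow> 'a \<Rightarrow> ('a \<Rightarrow> 'b) \<Rightarrow> 'b"
  where "covd g' F x u V = Dv V x u + levi g' (F x) (Dv F x u) (V x)"

locale isometric_map = src: riem S g + tgt: riem T g'
  for S :: "'a::euclidean_space set" and g and T :: "'b::euclidean_space set" and g' +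
  fixes U and F :: "'a \<Rightarrow> 'b"
  assumes open_U: "open U" and U_sub: "U \<subseteq> S" and F_into: "F ` U \<subseteq> T"
    and smooth_F: "smooth_on U F"
    and isometric: "x \<in> U \<Longrightarrow> g x u v = g' (F x) (Dv F x u) (Dv F x v)"
begin

lemma in_S [intro]: "x \<in> U \<Longrightarrow> x \<in> S" and in_T [intro]: "x \<in> U \<Longrightarrow> F x \<in> T"
  using U_sub F_into by auto

lemma F_differentiable: "x \<in> U \<Longrightarrow> F differentiable at x"
  using smooth_onD(1)[OF smooth_F] .

lemma DF_differentiable: "x \<in> U \<Longrightarrow> (\<lambda>y. Dv F y v) differentiable at x"
  using smooth_onD(1)[OF smooth_onD(2)[OF smooth_F]] .

lemma DF_linear: "x \<in> U \<Longrightarrow> linear (Dv F x)"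
  by (rule linear_Dv[OF F_differentiable])

lemma DF_simps:
  assumes "x \<in> U"
  shows "Dv F x (u + v) = Dv F x u + Dv F x v" "Dv F x (u - v) = Dv F x u - Dv F x v"
    "Dv F x (c *\<^sub>R v) = c *\<^sub>R Dv F x v" "Dv F x 0 = 0"
  using DF_linear[OF assms] by (simp_all add: linear_add linear_diff linear_scale linear_0)

lemma D2F_sym: "x \<in> U \<Longrightarrow> Dv (\<lambda>y. Dv F y v) x u = Dv (\<lambda>y. Dv F y u) x v"
  by (rule second_derivative_symmetric[OF open_U _ smooth_F])

lemma has_derivative_along:
  assumes x: "x \<in> U" and a: "V differentiable at x" and b: "W differentiable at x"
  shows "((\<lambda>y. g' (F y) (V y) (W y)) has_derivative
    (\<lambda>u. g' (F x) (covd g' F x u V) (W x) + g' (F x) (V x) (covd g' F x u W))) (at x)"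
proof -
  interpret inner_form "g' (F x)" using x by (intro tgt.inner_form_g) auto
  have "((\<lambda>y. g' (F y) (V y) (W y)) has_derivative
    (\<lambda>u. Dv (\<lambda>z. g' z (V x) (W x)) (F x) (Dv F x u) + g' (F x) (Dv V x u) (W x)
      + g' (F x) (V x) (Dv W x u))) (at x)"
    by (rule has_derivative_bilinear_field[OF tgt.open_S _ tgt.bilinear_g _ Dv_has open_U x F_into])
      (use x a b in \<open>auto intro: Dv_has tgt.differentiable_g F_differentiable\<close>)
  moreover have "F x \<in> T" using x by auto
  ultimately show ?thesis
    by (simp add: tgt.levi_compat covd_def form_simps algebra_simps)
qed

text \<open>The uniqueness argument for the Levi-Civita connection: P is symmetric in u and v
  because second derivatives of F and Christoffel symbols are, and differentiating the isometry
  condition makes it metric, so the Koszul formula determines it.\<close>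

lemma tangential_part:
  assumes x: "x \<in> U"
  shows "g' (F x) (covd g' F x u (\<lambda>y. Dv F y v)) (Dv F x w) = g x (levi g x u v) w"
proof -
  interpret inner_form "g' (F x)" using x by (intro tgt.inner_form_g) auto
  define P where "P u v w = g' (F x) (covd g' F x u (\<lambda>y. Dv F y v)) (Dv F x w)" for u v w
  have P_sym: "P u v w = P v u w" for u v w
    using D2F_sym[OF x, of v u] tgt.levi_sym[OF in_T[OF x]] unfolding P_def covd_def by metis
  have "Dv (\<lambda>y. g y v w) x u = P u v w + P u w v" for u v w
  proof -
    have "Dv (\<lambda>y. g y v w) x u = Dv (\<lambda>y. g' (F y) (Dv F y v) (Dv F y w)) x u"
      by (rule fun_cong[of _ _ u], rule Dv_cong_open[OF open_U x isometric])
    also have "\<dots> = P u v w + P u w v"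
      unfolding P_def using Dv_eq[OF has_derivative_along[OF x DF_differentiable[OF x] DF_differentiable[OF x]]]
      by (simp add: form_sym)
    finally show ?thesis .
  qed
  then show ?thesis
    unfolding src.levi_eq[OF in_S[OF x]] P_def[symmetric]
    using P_sym[of u v w] P_sym[of u w v] P_sym[of v w u] by simp
qed

lemma covd_tangent:
  "covd g' F x u (\<lambda>y. Dv F y v) = Dv F x (levi g x u v) + sform g g' F x u v"
  by (simp add: covd_def sform_def)

lemma sform_normal:
  assumes x: "x \<in> U" shows "g' (F x) (sform g g' F x u v) (Dv F x w) = 0"
proof -
  interpret inner_form "g' (F x)" using x by (intro tgt.inner_form_g) auto
  show ?thesis using tangential_part[OF x, of u v w] isometric[OF x]
    unfolding covd_tangent form_simps by simp
qed

lemma sform_sym: "x \<in> U \<Longrightarrow> sform g g' F x u v = sform g g' F x v u"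
  using D2F_sym[of x v u] tgt.levi_sym[OF in_T] src.levi_sym[OF in_S] unfolding sform_def by metis

lemma sform_bilinear:
  assumes x: "x \<in> U" shows "bilinear (sform g g' F x)"
proof -
  have r: "linear (\<lambda>v. Dv (\<lambda>y. Dv F y v) x u)" for u
    by (rule linear_Dv_param[OF open_U x DF_linear DF_differentiable[OF x]])
  have "linear (sform g g' F x u)" for u
    using src.bilinear_levi[OF in_S[OF x]] tgt.bilinear_levi[OF in_T[OF x]]
    by (intro linearI) (simp_all add: sform_def linear_add[OF r] linear_scale[OF r] DF_simps[OF x]
        bilinear_radd bilinear_rmul scaleR_add_right scaleR_diff_right)
  moreover have "(\<lambda>u. sform g g' F x u v) = sform g g' F x v" for v
    by (rule ext) (rule sform_sym[OF x])
  ultimately show ?thesis unfolding bilinear_def by simp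
qed

lemma levi_along:
  assumes x: "x \<in> U" and V: "V differentiable at x" and W: "W differentiable at x"
  shows "((\<lambda>y. levi g' (F y) (V y) (W y)) has_derivative
    (\<lambda>u. Dv (\<lambda>z. levi g' z (V x) (W x)) (F x) (Dv F x u) + levi g' (F x) (Dv V x u) (W x)
      + levi g' (F x) (V x) (Dv W x u))) (at x)"
  by (rule has_derivative_bilinear_field[OF tgt.open_S _ tgt.bilinear_levi _ Dv_has open_U x F_into])
    (use x V W in \<open>auto intro: Dv_has tgt.differentiable_levi F_differentiable\<close>)

lemma field_differentiable:
  assumes x: "x \<in> U" and X: "X differentiable at x"
  shows "((\<lambda>y. Dv F y (X y)) has_derivative (\<lambda>u. Dv (\<lambda>y. Dv F y (X x)) x u + Dv F x (Dv X x u))) (at x)"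
  by (rule has_derivative_linear_field[OF open_U x DF_linear DF_differentiable[OF x] Dv_has[OF X]])

lemma covd_pushforward:
  assumes x: "x \<in> U" and X: "X differentiable at x"
  shows "covd g' F x u (\<lambda>y. Dv F y (X y))
    = Dv F x (Dv X x u + levi g x u (X x)) + sform g g' F x u (X x)"
  unfolding covd_def sform_def Dv_eq[OF field_differentiable[OF x X]] by (simp add: DF_simps[OF x])

lemma sform_differentiable:
  assumes x: "x \<in> U" shows "(\<lambda>y. sform g g' F y u v) differentiable at x"
proof -
  have 1: "(\<lambda>y. Dv (\<lambda>y. Dv F y v) y u) differentiable at x"
    using smooth_onD(1)[OF smooth_onD(2)[OF smooth_onD(2)[OF smooth_F]] x] .
  show ?thesis unfolding sform_def
    by (intro differentiable_add differentiable_diff 1 differentiableI[OF levi_along[OF x]]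
        differentiableI[OF field_differentiable[OF x]] DF_differentiable src.differentiable_levi)
      (use x in auto)
qed

lemma sform_field_differentiable:
  assumes x: "x \<in> U" and X: "X differentiable at x"
  shows "(\<lambda>y. sform g g' F y u (X y)) differentiable at x"
  using sform_bilinear unfolding bilinear_def
  by (intro differentiableI[OF has_derivative_linear_field[OF open_U x _ sform_differentiable[OF x] Dv_has[OF X]]]) auto

lemma covd_add:
  assumes x: "x \<in> U" and V: "V differentiable at x" and W: "W differentiable at x"
  shows "covd g' F x u (\<lambda>y. V y + W y) = covd g' F x u V + covd g' F x u W"
  unfolding covd_def Dv_eq[OF has_derivative_add[OF Dv_has[OF V] Dv_has[OF W]]]
  using tgt.bilinear_levi[OF in_T[OF x]] by (simp add: bilinear_radd)

text \<open>The second derivatives of V and of F commute, so only the curvature of the target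
  survives.\<close>

lemma covd_commutator:
  assumes x: "x \<in> U" and V: "smooth_on U V"
  shows "covd g' F x u (\<lambda>y. covd g' F y v V) - covd g' F x v (\<lambda>y. covd g' F y u V)
    = rcurv g' (F x) (Dv F x u) (Dv F x v) (V x)"
proof -
  have Vd: "V differentiable at x" and DVd: "(\<lambda>y. Dv V y v) differentiable at x" for v
    using smooth_onD(1)[OF V x] smooth_onD(1)[OF smooth_onD(2)[OF V] x] .
  have 1: "Dv (\<lambda>y. covd g' F y v V) x u = Dv (\<lambda>y. Dv V y v) x u
    + (Dv (\<lambda>z. levi g' z (Dv F x v) (V x)) (F x) (Dv F x u) + levi g' (F x) (Dv (\<lambda>y. Dv F y v) x u) (V x)
      + levi g' (F x) (Dv F x v) (Dv V x u))" for u v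
    unfolding covd_def
    by (rule fun_cong[OF Dv_eq[OF has_derivative_add[OF Dv_has[OF DVd] levi_along[OF x DF_differentiable[OF x] Vd]]]])
  have "Dv (\<lambda>y. Dv V y v) x u = Dv (\<lambda>y. Dv V y u) x v"
    by (rule second_derivative_symmetric[OF open_U x V])
  then show ?thesis
    using D2F_sym[OF x, of v u] tgt.bilinear_levi[OF in_T[OF x]]
    by (simp add: covd_def[of _ _ _ _ "\<lambda>y. covd g' F y a b" for a b] 1 rcurv_def)
      (simp add: covd_def bilinear_radd)
qed

text \<open>The Gauss formula inserted twice into the commutator on the field
  \<open>Dv F y w\<close>. Tangential and normal parts stay together; pairing with a tangent or a
  normal vector yields the equation of Gauss or of Codazzi.\<close>

lemma gauss_codazzi:
  assumes x: "x \<in> U"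
  shows "rcurv g' (F x) (Dv F x u) (Dv F x v) (Dv F x w) =
    Dv F x (rcurv g x u v w) + sform g g' F x u (levi g x v w) - sform g g' F x v (levi g x u w)
    + covd g' F x u (\<lambda>y. sform g g' F y v w) - covd g' F x v (\<lambda>y. sform g g' F y u w)"
proof -
  have "covd g' F x u (\<lambda>y. covd g' F y v (\<lambda>y. Dv F y w))
    = Dv F x (Dv (\<lambda>y. levi g y v w) x u + levi g x u (levi g x v w)) + sform g g' F x u (levi g x v w)
      + covd g' F x u (\<lambda>y. sform g g' F y v w)" for u v
    unfolding covd_tangent covd_add[OF x differentiableI[OF field_differentiable[OF x src.differentiable_levi[OF in_S[OF x]]]] sform_differentiable[OF x]]
      covd_pushforward[OF x src.differentiable_levi[OF in_S[OF x]]] ..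
  then show ?thesis
    using covd_commutator[OF x smooth_onD(2)[OF smooth_F], of u v w]
    by (simp add: rcurv_def DF_simps[OF x] algebra_simps)
qed

lemma gauss_equation:
  assumes x: "x \<in> U"
  shows "g' (F x) (rcurv g' (F x) (Dv F x u) (Dv F x v) (Dv F x w)) (Dv F x z) =
    g x (rcurv g x u v w) z - g' (F x) (sform g g' F x v w) (sform g g' F x u z)
    + g' (F x) (sform g g' F x u w) (sform g g' F x v z)"
proof -
  interpret inner_form "g' (F x)" using x by (intro tgt.inner_form_g) auto
  \<comment> \<open>h is normal along all of U; differentiating <h(v,w), dF z> = 0 moves the
    derivative onto dF z, whose normal part is h(u,z).\<close>
  have n: "g' (F x) (covd g' F x u (\<lambda>y. sform g g' F y v w)) (Dv F x z)
      = - g' (F x) (sform g g' F x v w) (sform g g' F x u z)" for u v w z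
  proof -
    have "Dv (\<lambda>y. g' (F y) (sform g g' F y v w) (Dv F y z)) x = Dv (\<lambda>y. 0) x"
      by (rule Dv_cong_open[OF open_U x sform_normal])
    then have "g' (F x) (covd g' F x u (\<lambda>y. sform g g' F y v w)) (Dv F x z)
      + g' (F x) (sform g g' F x v w) (covd g' F x u (\<lambda>y. Dv F y z)) = 0"
      unfolding Dv_eq[OF has_derivative_along[OF x sform_differentiable[OF x] DF_differentiable[OF x]]]
      by (simp add: fun_eq_iff)
    then show ?thesis unfolding covd_tangent form_simps sform_normal[OF x] by simp
  qed
  show ?thesis
    unfolding gauss_codazzi[OF x] form_simps n sform_normal[OF x] isometric[OF x, symmetric] by simp
qed

text \<open>The scalar Codazzi equation along a field \<open>\<eta>\<close> with \<open>A\<^sub>\<eta> = \<mu> id\<close> near \<open>x\<close>; the terms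
  containing \<open>\<mu> x\<close> cancel because \<open>\<nabla>g = 0\<close>.\<close>

lemma codazzi_umbilical:
  assumes x: "x \<in> U" and \<eta>: "\<eta> differentiable at x" and \<mu>: "\<mu> differentiable at x"
    and W: "open W" "x \<in> W" "W \<subseteq> U"
    and umb: "\<And>y v w. y \<in> W \<Longrightarrow> g' (F y) (sform g g' F y v w) (\<eta> y) = \<mu> y * g y v w"
    and normal: "\<And>z. g' (F x) (Dv F x z) (\<eta> x) = 0"
    and curv: "g' (F x) (rcurv g' (F x) (Dv F x u) (Dv F x v) (Dv F x w)) (\<eta> x) = 0"
  shows "g x v w * Dv \<mu> x u - g x u w * Dv \<mu> x v =
    g' (F x) (sform g g' F x v w) (covd g' F x u \<eta>) - g' (F x) (sform g g' F x u w) (covd g' F x v \<eta>)"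
proof -
  interpret inner_form "g' (F x)" using x by (intro tgt.inner_form_g) auto
  \<comment> \<open>The derivative of \<open>umb\<close> along u, solved for the term with the
    derivative of h.\<close>
  have d: "g' (F x) (covd g' F x u (\<lambda>y. sform g g' F y v w)) (\<eta> x)
      = \<mu> x * (g x (levi g x u v) w + g x v (levi g x u w)) + Dv \<mu> x u * g x v w
        - g' (F x) (sform g g' F x v w) (covd g' F x u \<eta>)" for u v w
  proof -
    have "Dv (\<lambda>y. g' (F y) (sform g g' F y v w) (\<eta> y)) x = Dv (\<lambda>y. \<mu> y * g y v w) x"
      by (rule Dv_cong_open[OF W(1,2) umb])
    then have "g' (F x) (covd g' F x u (\<lambda>y. sform g g' F y v w)) (\<eta> x)
      + g' (F x) (sform g g' F x v w) (covd g' F x u \<eta>)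
      = \<mu> x * Dv (\<lambda>y. g y v w) x u + Dv \<mu> x u * g x v w"
      unfolding Dv_eq[OF has_derivative_along[OF x sform_differentiable[OF x] \<eta>]]
        Dv_eq[OF has_derivative_mult[OF Dv_has[OF \<mu>] Dv_has[OF src.differentiable_g[OF in_S[OF x]]]]]
      by (simp add: fun_eq_iff)
    then show ?thesis unfolding src.levi_compat[OF in_S[OF x]] by simp
  qed
  have xW: "x \<in> W" by fact
  show ?thesis
    using curv unfolding gauss_codazzi[OF x] form_simps d normal umb[OF xW]
      src.levi_sym[OF in_S[OF x], of v u] src.g_sym[OF in_S[OF x], of "levi g x u w"]
      src.g_sym[OF in_S[OF x], of "levi g x v w"] by (simp add: algebra_simps)
qed

end

section \<open>Second fundamental forms under composition and change of charts\<close>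

lemma sform_compose:
  assumes U: "open U" "x \<in> U" and V: "open V" "F ` U \<subseteq> V"
    and F: "smooth_on U F" and G: "smooth_on V G"
    and lin: "\<And>u. linear (levi g3 (G (F x)) u)"
  shows "sform g1 g3 (\<lambda>y. G (F y)) x u v
    = sform g2 g3 G (F x) (Dv F x u) (Dv F x v) + Dv G (F x) (sform g1 g2 F x u v)"
proof -
  have Fx: "F x \<in> V" using U V by auto
  have DGF: "Dv (\<lambda>y. G (F y)) y = (\<lambda>u. Dv G (F y) (Dv F y u))" if "y \<in> U" for y
    using that V(2) by (intro Dv_eq has_derivative_compose[OF Dv_has Dv_has] smooth_onD(1)[OF F] smooth_onD(1)[OF G]) auto
  have DDGF: "((\<lambda>y. Dv G (F y) w) has_derivative (\<lambda>u. Dv (\<lambda>z. Dv G z w) (F x) (Dv F x u))) (at x)" for w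
    by (intro has_derivative_compose[OF Dv_has Dv_has] smooth_onD(1)[OF F U(2)] smooth_onD(1)[OF smooth_onD(2)[OF G] Fx])
  have "Dv (\<lambda>y. Dv (\<lambda>y. G (F y)) y v) x u = Dv (\<lambda>y. Dv G (F y) (Dv F y v)) x u"
    by (rule fun_cong[of _ _ u], rule Dv_cong_open[OF U]) (simp add: DGF)
  also have "\<dots> = Dv (\<lambda>z. Dv G z (Dv F x v)) (F x) (Dv F x u) + Dv G (F x) (Dv (\<lambda>y. Dv F y v) x u)"
  proof -
    have "((\<lambda>y. Dv G (F y) (Dv F y v)) has_derivative (\<lambda>u. Dv (\<lambda>y. Dv G (F y) (Dv F x v)) x u
        + Dv G (F x) (Dv (\<lambda>y. Dv F y v) x u))) (at x)"
    proof (rule has_derivative_linear_field[OF U])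
      show "linear (Dv G (F y))" if "y \<in> U" for y
        using that V(2) by (intro linear_Dv smooth_onD(1)[OF G]) auto
      show "((\<lambda>y. Dv F y v) has_derivative Dv (\<lambda>y. Dv F y v) x) (at x)"
        by (intro Dv_has smooth_onD(1)[OF smooth_onD(2)[OF F] U(2)])
    qed (rule differentiableI[OF DDGF])
    then show ?thesis unfolding Dv_eq[OF DDGF] by (simp add: Dv_eq)
  qed
  \<comment> \<open>The terms with \<open>levi g2\<close> in the two summands cancel.\<close>
  finally show ?thesis
    using linear_Dv[OF smooth_onD(1)[OF G Fx]]
    by (simp add: sform_def DGF[OF U(2)] linear_add linear_diff)
qed

locale local_isometry = isometric_map S g T g' U F
  for S :: "'a::euclidean_space set" and g and T :: "'a set" and g' U F
begin

lemma DF_surj: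
  assumes x: "x \<in> U" shows "surj (Dv F x)"
proof -
  have "inj (Dv F x)"
    using isometric[OF x] src.g_pos[OF in_S[OF x]] DF_simps(4)[OF x]
      inner_form.form_simps(9)[OF tgt.inner_form_g[OF in_T[OF x]]]
    unfolding linear_injective_0[OF DF_linear[OF x]] by (metis less_irrefl)
  then show ?thesis by (rule linear_injective_imp_surjective[OF DF_linear[OF x]]) simp
qed

text \<open>Between equal dimensions the normal space is zero. For a transition map this is the
  transformation law of the Christoffel symbols.\<close>

lemma sform_zero:
  assumes x: "x \<in> U" shows "sform g g' F x u v = 0"
proof -
  interpret inner_form "g' (F x)" using x by (intro tgt.inner_form_g) auto
  obtain w where "Dv F x w = sform g g' F x u v" using surjD[OF DF_surj[OF x]] by metis
  then show ?thesis using sform_normal[OF x, of u v w] form_zero_iff by metis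
qed

end

text \<open>The composite of \<phi> and F2 equals that of F1 and \<psi>; its second fundamental form
  is computed both ways, and the local isometries \<phi> and \<psi> contribute nothing.\<close>

lemma sform_transition:
  assumes src: "local_isometry S1 g1 S2 g2 U \<phi>" and tgt: "local_isometry T1 h1 T2 h2 V \<psi>"
    and F1: "isometric_map S1 g1 T1 h1 U F1" and F2: "isometric_map S2 g2 T2 h2 U' F2"
    and x: "x \<in> U" and im: "F1 ` U \<subseteq> V" "\<phi> ` U \<subseteq> U'"
    and comm: "\<And>y. y \<in> U \<Longrightarrow> F2 (\<phi> y) = \<psi> (F1 y)"
  shows "sform g2 h2 F2 (\<phi> x) (Dv \<phi> x u) (Dv \<phi> x v) = Dv \<psi> (F1 x) (sform g1 h1 F1 x u v)"
proof -
  interpret \<phi>: local_isometry S1 g1 S2 g2 U \<phi> by fact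
  interpret \<psi>: local_isometry T1 h1 T2 h2 V \<psi> by fact
  interpret F1: isometric_map S1 g1 T1 h1 U F1 by fact
  interpret F2: isometric_map S2 g2 T2 h2 U' F2 by fact
  have eq: "Dv (\<lambda>y. F2 (\<phi> y)) y = Dv (\<lambda>y. \<psi> (F1 y)) y" if "y \<in> U" for y
    by (rule Dv_cong_open[OF \<phi>.open_U that comm])
  have eq2: "Dv (\<lambda>y. Dv (\<lambda>y. F2 (\<phi> y)) y v) x = Dv (\<lambda>y. Dv (\<lambda>y. \<psi> (F1 y)) y v) x" for v
    by (rule Dv_cong_open[OF \<phi>.open_U x]) (simp add: eq)
  have FV: "F1 x \<in> V" and FU: "\<phi> x \<in> U'" using x im by auto
  have lin: "linear (levi h2 (F2 (\<phi> x)) u)" for u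
    using \<psi>.tgt.bilinear_levi[OF F2.in_T[OF FU]] unfolding bilinear_def by auto
  have "sform g1 h2 (\<lambda>y. F2 (\<phi> y)) x u v = sform g1 h2 (\<lambda>y. \<psi> (F1 y)) x u v"
    unfolding sform_def by (simp add: eq[OF x] eq2 comm[OF x])
  moreover have "sform g1 h2 (\<lambda>y. F2 (\<phi> y)) x u v = sform g2 h2 F2 (\<phi> x) (Dv \<phi> x u) (Dv \<phi> x v)"
    using sform_compose[OF \<phi>.open_U x F2.open_U im(2) \<phi>.smooth_F F2.smooth_F lin, of g1 u v g2]
      \<phi>.sform_zero[OF x] F2.DF_simps(4)[OF FU] by simp
  moreover have "sform g1 h2 (\<lambda>y. \<psi> (F1 y)) x u v = Dv \<psi> (F1 x) (sform g1 h1 F1 x u v)"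
    using sform_compose[OF \<phi>.open_U x \<psi>.open_U im(1) F1.smooth_F \<psi>.smooth_F, of h2 g1 u v h1]
      lin \<psi>.sform_zero[OF FV] comm[OF x] by simp
  ultimately show ?thesis by simp
qed


subsection \<open>Orthonormal frames\<close>

definition orthonormal_wrt :: "('a \<Rightarrow> 'a \<Rightarrow> real) \<Rightarrow> nat set \<Rightarrow> (nat \<Rightarrow> 'a) \<Rightarrow> bool"
  where "orthonormal_wrt G I e \<longleftrightarrow> (\<forall>i\<in>I. \<forall>j\<in>I. G (e i) (e j) = (if i = j then 1 else 0))"

lemma orthonormal_wrtD:
  assumes "orthonormal_wrt G I e" "i \<in> I" "j \<in> I"
  shows "G (e i) (e j) = (if i = j then 1 else 0)"
  using assms unfolding orthonormal_wrt_def by blast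

lemma bilinear_sum_left:
  assumes "bilinear B"
  shows "B (\<Sum>i\<in>I. c i *\<^sub>R x i) v = (\<Sum>i\<in>I. c i *\<^sub>R B (x i) v)"
  using linear_sum[of "\<lambda>u. B u v" "\<lambda>i. c i *\<^sub>R x i" I] assms
  by (simp add: bilinear_def bilinear_lmul[OF assms])

context inner_form
begin

lemma orthonormal_coeff:
  assumes e: "orthonormal_wrt G I e" "finite I" "i \<in> I"
  shows "G (\<Sum>j\<in>I. c j *\<^sub>R e j) (e i) = c i"
proof -
  have "G (\<Sum>j\<in>I. c j *\<^sub>R e j) (e i) = (\<Sum>j\<in>I. if j = i then c j else 0)"
    unfolding form_sum by (intro sum.cong) (use orthonormal_wrtD[OF e(1) _ e(3)] in \<open>auto simp: form_simps\<close>)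
  then show ?thesis using e by simp
qed

lemma orthonormal_independent:
  assumes e: "orthonormal_wrt G I e" "finite I"
  shows "inj_on e I" "independent (e ` I)"
proof -
  show inj: "inj_on e I"
  proof (rule inj_onI)
    fix i j assume "i \<in> I" "j \<in> I" "e i = e j"
    then show "i = j" using orthonormal_wrtD[OF e(1), of i j] orthonormal_wrtD[OF e(1), of i i] by (auto split: if_splits)
  qed
  show "independent (e ` I)"
  proof (rule independent_if_scalars_zero)
    fix f x assume s: "(\<Sum>x\<in>e ` I. f x *\<^sub>R x) = 0" and "x \<in> e ` I"
    then obtain i where i: "i \<in> I" "x = e i" by blast
    have "(\<Sum>j\<in>I. f (e j) *\<^sub>R e j) = 0" using s by (simp add: sum.reindex[OF inj])
    then show "f x = 0" using orthonormal_coeff[OF e i(1), of "\<lambda>j. f (e j)"] i by (simp add: form_simps)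
  qed (use e in auto)
qed

lemma orthonormal_span:
  assumes e: "orthonormal_wrt G I e" "finite I" and v: "v \<in> span (e ` I)"
  shows "v = (\<Sum>i\<in>I. G v (e i) *\<^sub>R e i)"
proof -
  obtain c where c: "v = (\<Sum>x\<in>e ` I. c x *\<^sub>R x)"
    using v e(2) by (auto simp: span_finite)
  then have "v = (\<Sum>i\<in>I. c (e i) *\<^sub>R e i)"
    by (simp add: sum.reindex[OF orthonormal_independent(1)[OF e]])
  moreover from this have "G v (e i) = c (e i)" if "i \<in> I" for i
    using orthonormal_coeff[OF e that, of "\<lambda>i. c (e i)"] by simp
  ultimately show ?thesis by simp
qed

lemma orthonormal_expand:
  assumes e: "orthonormal_wrt G I e" "finite I" "card I = DIM('a)"
  shows "v = (\<Sum>i\<in>I. G v (e i) *\<^sub>R e i)"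
proof (rule orthonormal_span[OF e(1,2)])
  have "UNIV \<subseteq> span (e ` I)"
    by (rule card_ge_dim_independent) (use e orthonormal_independent[OF e(1,2)] in \<open>auto simp: card_image\<close>)
  then show "v \<in> span (e ` I)" by blast
qed

lemma orthonormal_parseval:
  assumes e: "orthonormal_wrt G I e" "finite I" "card I = DIM('a)"
  shows "G u v = (\<Sum>i\<in>I. G u (e i) * G v (e i))"
proof -
  have "G u v = G u (\<Sum>i\<in>I. G v (e i) *\<^sub>R e i)" using orthonormal_expand[OF e, of v] by simp
  then show ?thesis by (simp add: form_sum form_simps mult.commute)
qed

text \<open>Gram-Schmidt that keeps prescribed vectors: later the unit vector X at which Ric is
  evaluated, and the normalised H.\<close>

lemma orthonormal_extend:
  assumes W: "subspace W" and e: "orthonormal_wrt G {1..m} e" "\<And>i. i \<in> {1..m} \<Longrightarrow> e i \<in> W"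
    and n: "m \<le> n" "n \<le> dim W"
  shows "\<exists>e'. orthonormal_wrt G {1..n} e' \<and> (\<forall>i\<in>{1..n}. e' i \<in> W) \<and> (\<forall>i\<in>{1..m}. e' i = e i)"
  using n
proof (induction n rule: dec_induct)
  case base
  then show ?case using e by blast
next
  case (step n)
  then obtain f where f: "orthonormal_wrt G {1..n} f" "\<forall>i\<in>{1..n}. f i \<in> W" "\<forall>i\<in>{1..m}. f i = e i"
    by auto
  have sub: "span (f ` {1..n}) \<subseteq> W" using f(2) W by (intro span_minimal) auto
  have "dim (span (f ` {1..n})) \<le> n"
    by (metis card_atLeastAtMost card_image_le diff_Suc_1 dim_le_card' dim_span finite_atLeastAtMost finite_imageI le_trans)
  then have "span (f ` {1..n}) \<noteq> W" using step by auto
  then obtain w where w: "w \<in> W" "w \<notin> span (f ` {1..n})" using sub by blast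
  define w' where "w' = w - (\<Sum>i\<in>{1..n}. G w (f i) *\<^sub>R f i)"
  have sp: "(\<Sum>i\<in>{1..n}. G w (f i) *\<^sub>R f i) \<in> span (f ` {1..n})"
    by (intro span_sum span_scale span_base) auto
  have "w' \<noteq> 0" using w sp by (auto simp: w'_def)
  then have pos: "G w' w' > 0" by (rule form_pos)
  have orth: "G w' (f i) = 0" if "i \<in> {1..n}" for i
    using orthonormal_coeff[OF f(1) _ that, of "\<lambda>i. G w (f i)"] by (simp add: w'_def form_simps)
  have wW: "w' \<in> W" unfolding w'_def using w sp sub W by (intro subspace_diff) auto
  define f' where "f' = f(Suc n := (1 / sqrt (G w' w')) *\<^sub>R w')"
  have "G (f' i) (f' j) = (if i = j then 1 else 0)" if "i \<in> {1..Suc n}" "j \<in> {1..Suc n}" for i j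
  proof -
    have u: "G (f' (Suc n)) (f' (Suc n)) = 1"
      using pos by (simp add: f'_def form_simps real_sqrt_mult_self[of "G w' w'", simplified] divide_simps)
    have o: "G (f' (Suc n)) (f i) = 0" if "i \<in> {1..n}" for i
      using orth[OF that] by (simp add: f'_def form_simps)
    consider "i \<in> {1..n}" "j \<in> {1..n}" | "i = Suc n" "j \<in> {1..n}" | "i \<in> {1..n}" "j = Suc n" | "i = Suc n" "j = Suc n"
      using \<open>i \<in> {1..Suc n}\<close> \<open>j \<in> {1..Suc n}\<close> by force
    then show ?thesis
    proof cases
      case 1 then show ?thesis using orthonormal_wrtD[OF f(1)] by (auto simp: f'_def)
    next
      case 2 then show ?thesis using o[of j] by (auto simp: f'_def)
    next
      case 3 then show ?thesis using o[of i] by (auto simp: f'_def form_sym)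
    qed (use u in auto)
  qed
  then have "orthonormal_wrt G {1..Suc n} f'" unfolding orthonormal_wrt_def by blast
  moreover have "\<forall>i\<in>{1..Suc n}. f' i \<in> W"
    using f(2) wW W by (auto simp: f'_def subspace_scale)
  moreover have "\<forall>i\<in>{1..m}. f' i = e i" using f(3) step by (auto simp: f'_def)
  ultimately show ?case by blast
qed

lemma orthonormal_extend_UNIV:
  assumes "orthonormal_wrt G {1..m} e" "m \<le> DIM('a)"
  obtains e' where "orthonormal_wrt G {1..DIM('a)} e'" "\<And>i. i \<in> {1..m} \<Longrightarrow> e' i = e i"
  using orthonormal_extend[of UNIV m e "DIM('a)"] assms by auto

lemma orthonormal_basis_exists:
  assumes "subspace W"
  obtains e where "orthonormal_wrt G {1..dim W} e" "\<And>i. i \<in> {1..dim W} \<Longrightarrow> e i \<in> W"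
  using orthonormal_extend[OF assms, of 0 _ "dim W"] by (auto simp: orthonormal_wrt_def)

lemma orthonormal_card_le:
  assumes "orthonormal_wrt G I e" "finite I" shows "card I \<le> DIM('a)"
  using orthonormal_independent[OF assms] independent_bound[of "e ` I"] by (simp add: card_image)

lemma trace_basis_independent:
  fixes B :: "'a \<Rightarrow> 'a \<Rightarrow> 'c::real_vector"
  assumes B: "bilinear B"
    and e: "orthonormal_wrt G I e" "finite I" "card I = DIM('a)"
    and f: "orthonormal_wrt G J f" "finite J" "card J = DIM('a)"
  shows "(\<Sum>i\<in>I. B (e i) (e i)) = (\<Sum>j\<in>J. B (f j) (f j))"
proof -
  have "(\<Sum>i\<in>I. B (e i) (e i)) = (\<Sum>i\<in>I. B (e i) (\<Sum>j\<in>J. G (e i) (f j) *\<^sub>R f j))"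
    using orthonormal_expand[OF f] by simp
  also have "\<dots> = (\<Sum>i\<in>I. \<Sum>j\<in>J. G (f j) (e i) *\<^sub>R B (e i) (f j))"
    using B by (simp add: bilinear_def linear_sum linear_scale form_sym)
  also have "\<dots> = (\<Sum>j\<in>J. \<Sum>i\<in>I. G (f j) (e i) *\<^sub>R B (e i) (f j))" by (rule sum.swap)
  also have "\<dots> = (\<Sum>j\<in>J. B (\<Sum>i\<in>I. G (f j) (e i) *\<^sub>R e i) (f j))"
    by (simp only: bilinear_sum_left[OF B])
  finally show ?thesis using orthonormal_expand[OF e] by simp
qed

text \<open>The trace without a frame: the dual vectors solve linear equations with coefficients G,
  so they vary differentiably with the metric, which a chosen frame need not do.\<close>

lemma trace_dual_basis:
  fixes B :: "'a \<Rightarrow> 'a \<Rightarrow> 'c::real_vector"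
  assumes B: "bilinear B" and dual: "\<And>b z. b \<in> Basis \<Longrightarrow> G (w b) z = b \<bullet> z"
    and e: "orthonormal_wrt G I e" "finite I" "card I = DIM('a)"
  shows "(\<Sum>b\<in>Basis. B b (w b)) = (\<Sum>i\<in>I. B (e i) (e i))"
proof -
  have "w b = (\<Sum>i\<in>I. (e i \<bullet> b) *\<^sub>R e i)" if "b \<in> Basis" for b
    using orthonormal_expand[OF e, of "w b"] dual[OF that] by (simp add: inner_commute)
  then have "(\<Sum>b\<in>Basis. B b (w b)) = (\<Sum>b\<in>Basis. \<Sum>i\<in>I. (e i \<bullet> b) *\<^sub>R B b (e i))"
    using B by (simp add: bilinear_def linear_sum linear_scale)
  also have "\<dots> = (\<Sum>i\<in>I. \<Sum>b\<in>Basis. (e i \<bullet> b) *\<^sub>R B b (e i))" by (rule sum.swap)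
  also have "\<dots> = (\<Sum>i\<in>I. B (\<Sum>b\<in>Basis. (e i \<bullet> b) *\<^sub>R b) (e i))"
    by (simp only: bilinear_sum_left[OF B])
  finally show ?thesis by (simp add: euclidean_representation)
qed

section \<open>Compactness of the set of frames\<close>

lemma form_continuous: "continuous_on X f \<Longrightarrow> continuous_on X g \<Longrightarrow> continuous_on X (\<lambda>x. G (f x) (g x))"
  using bounded_bilinear.continuous_on bilinear_form bilinear_conv_bounded_bilinear by blast

lemma unit_bounded:
  obtains r where "\<And>u. G u u = 1 \<Longrightarrow> norm u \<le> r"
proof -
  obtain e where e: "orthonormal_wrt G {1..DIM('a)} e"
    using orthonormal_basis_exists[OF subspace_UNIV] by auto
  have "norm u \<le> (\<Sum>i=1..DIM('a). norm (e i))" if u: "G u u = 1" for u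
  proof -
    have c: "\<bar>G u (e i)\<bar> \<le> 1" if "i \<in> {1..DIM('a)}" for i
    proof -
      have "(G u (e i))\<^sup>2 \<le> (\<Sum>i=1..DIM('a). (G u (e i))\<^sup>2)"
        using that by (intro member_le_sum) auto
      also have "\<dots> = 1" using orthonormal_parseval[OF e, of u u] u by (simp add: power2_eq_square)
      finally show ?thesis by (simp add: abs_square_le_1)
    qed
    have "norm u = norm (\<Sum>i=1..DIM('a). G u (e i) *\<^sub>R e i)"
      using orthonormal_expand[OF e, of u] by simp
    also have "\<dots> \<le> (\<Sum>i=1..DIM('a). \<bar>G u (e i)\<bar> * norm (e i))"
      by (rule norm_sum[THEN order_trans]) simp
    also have "\<dots> \<le> (\<Sum>i=1..DIM('a). 1 * norm (e i))"
      by (intro sum_mono mult_right_mono c) auto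
    finally show ?thesis by simp
  qed
  then show ?thesis using that by blast
qed

text \<open>A frame is a function on all natural numbers; the value 0 outside {1..n} makes the set a
  closed subset of a product of balls and points, compact by Tychonoff.\<close>

lemma compact_frames: "compact {e. orthonormal_wrt G {1..n} e \<and> (\<forall>i. i \<notin> {1..n} \<longrightarrow> e i = 0)}"
proof -
  obtain r where r: "\<And>u. G u u = 1 \<Longrightarrow> norm u \<le> r" using unit_bounded by blast
  define P where "P = (\<Pi>\<^sub>E i\<in>UNIV. if i \<in> {1..n} then cball (0::'a) r else {0})"
  have "compactin (product_topology (\<lambda>i::nat. euclidean) UNIV) P"
    unfolding P_def by (subst compactin_PiE) auto
  then have "compact P" by (simp add: euclidean_product_topology)
  moreover have "{e. orthonormal_wrt G {1..n} e \<and> (\<forall>i. i \<notin> {1..n} \<longrightarrow> e i = 0)}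
      = P \<inter> (\<Inter>i\<in>{1..n}. \<Inter>j\<in>{1..n}. {e. G (e i) (e j) = (if i = j then 1 else 0)})"
  proof (intro set_eqI iffI)
    fix e assume e: "e \<in> {e. orthonormal_wrt G {1..n} e \<and> (\<forall>i. i \<notin> {1..n} \<longrightarrow> e i = 0)}"
    then have "norm (e i) \<le> r" if "i \<in> {1..n}" for i
      using that orthonormal_wrtD[of G "{1..n}" e i i] by (intro r) auto
    then show "e \<in> P \<inter> (\<Inter>i\<in>{1..n}. \<Inter>j\<in>{1..n}. {e. G (e i) (e j) = (if i = j then 1 else 0)})"
      using e by (auto simp: P_def orthonormal_wrt_def)
  next
    fix e assume "e \<in> P \<inter> (\<Inter>i\<in>{1..n}. \<Inter>j\<in>{1..n}. {e. G (e i) (e j) = (if i = j then 1 else 0)})"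
    then show "e \<in> {e. orthonormal_wrt G {1..n} e \<and> (\<forall>i. i \<notin> {1..n} \<longrightarrow> e i = 0)}"
      unfolding P_def orthonormal_wrt_def PiE_iff by (auto split: if_splits)
  qed
  moreover have "closed {e. G (e i) (e j) = (if i = j then 1 else 0)}" for i j :: nat
    by (intro closed_Collect_eq form_continuous continuous_on_product_coordinates continuous_on_const)
  ultimately show ?thesis by (auto intro!: compact_Int_closed closed_INT)
qed

text \<open>A change of orthonormal basis multiplies R(u,v,v,u) by the squared determinant, which is
  1 by Lagrange's identity.\<close>

lemma sectional_well_defined:
  assumes R: "curvature_like R" and uv: "G u u = 1" "G v v = 1" "G u v = 0"
    and uv': "G u' u' = 1" "G v' v' = 1" "G u' v' = 0" and sp: "span {u, v} = span {u', v'}"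
  shows "R u' v' v' u' = R u v v u"
proof -
  interpret curvature_like R by fact
  have in_span: "\<exists>a b. x = a *\<^sub>R u + b *\<^sub>R v" if "x \<in> span {u, v}" for x
    using that unfolding span_insert span_empty by (auto simp: algebra_simps)
  have "u' \<in> span {u, v}" "v' \<in> span {u, v}" using sp by (auto intro: span_base)
  then obtain a b c d where u': "u' = a *\<^sub>R u + b *\<^sub>R v" and v': "v' = c *\<^sub>R u + d *\<^sub>R v"
    using in_span by meson
  have 1: "a * a + b * b = 1" "c * c + d * d = 1" "a * c + b * d = 0"
    using uv uv' form_sym[of v u] by (simp_all add: u' v' form_simps algebra_simps)
  have "(a * d - b * c)\<^sup>2 = (a * a + b * b) * (c * c + d * d) - (a * c + b * d)\<^sup>2"
    by (simp add: power2_eq_square algebra_simps)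
  then have 2: "(a * d - b * c)\<^sup>2 = 1" by (simp add: 1)
  have "R u' v' v' u' = (a * d - b * c)\<^sup>2 * R u v v u"
    unfolding u' v' using skew12[of v u v u] skew34[of u v u v] skew12[of v u u v]
    by (simp add: R_linear R_zero power2_eq_square algebra_simps)
  then show ?thesis using 2 by simp
qed

end


subsection \<open>Constant holomorphic sectional curvature\<close>

context curvature_like
begin

text \<open>Polarising in x and then in y makes R skew in all its arguments; the Bianchi identity
  then says 3 R = 0.\<close>

lemma zero_if_sectional_zero:
  assumes "\<And>x y. R x y x y = 0" shows "R x y z w = 0"
proof -
  have 1: "R x y z y = 0" for x y z
    using assms[of "x + z" y] assms[of x y] assms[of z y] pair_sym[of z y x y] by (simp add: R_linear)
  have 2: "R x y z w = - R x w z y" for x y z w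
    using 1[of x "y + w" z] 1[of x y z] 1[of x w z] by (simp add: R_linear)
  have 3: "R x y z w = - R z y x w" for x y z w
    using 2[of y x w z] skew12[of x y z w] skew34[of y x z w] skew12[of z y x w] skew34[of y z x w] by linarith
  show ?thesis
    using bianchi[of x y z w] skew12[of y z x w] 3[of x y z w] skew12[of z x y w] 3[of y z x w] 3[of x z y w] by linarith
qed

end

locale kaehler_curvature = curvature_like R for R :: "'a::real_vector \<Rightarrow> 'a \<Rightarrow> 'a \<Rightarrow> 'a \<Rightarrow> real" +
  fixes J :: "'a \<Rightarrow> 'a"
  assumes J_linear: "linear J" and J_J: "J (J u) = - u" and R_J: "R u v (J w) (J z) = R u v w z"
begin

text \<open>The form \<open>R x (J y) z (J w)\<close> is symmetric in \<open>x, y\<close> and in \<open>z, w\<close>; polarising its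
  diagonal and combining with the Bianchi identity leaves the sectional curvatures.\<close>

lemma zero_if_holomorphic_zero:
  assumes hol: "\<And>x. R x (J x) (J x) x = 0" shows "R x y z w = 0"
proof (rule zero_if_sectional_zero)
  have neg: "R (- u) v w z = - R u v w z" "R u (- v) w z = - R u v w z"
    "R u v (- w) z = - R u v w z" "R u v w (- z) = - R u v w z" for u v w z
    using R_linear(8)[of "-1"] R_linear(6)[of _ "-1"] R_linear(4)[of _ _ "-1"] R_linear(2)[of _ _ _ "-1"] by simp_all
  have J12: "R (J u) (J v) w z = R u v w z" for u v w z using R_J pair_sym by metis
  have J1: "R (J u) v w z = - R u (J v) w z" for u v w z
    using J12[of u "J v" w z] by (simp add: J_J neg)
  have J4: "R u v w (J z) = - R u v (J w) z" for u v w z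
    using R_J[of u v "J w" z] by (simp add: J_J neg)
  have key: "3 * R x (J y) x (J y) + R x y x y = 0" for x y
  proof -
    define T where "T a b c d = R a (J b) c (J d)" for a b c d
    have T_sym: "T a b c d = T b a c d" "T a b c d = T a b d c" "T a b c d = T c d a b" for a b c d
    proof -
      show "T a b c d = T b a c d" unfolding T_def using J1[of a b c "J d"] skew12[of "J a" b c "J d"] by linarith
      show "T a b c d = T a b d c" unfolding T_def using J4[of a "J b" c d] skew34[of a "J b" "J c" d] by linarith
      show "T a b c d = T c d a b" unfolding T_def by (rule pair_sym)
    qed
    have T_lin: "T (a + a') b c d = T a b c d + T a' b c d" "T (a - a') b c d = T a b c d - T a' b c d"
      "T a (b + b') c d = T a b c d + T a b' c d" "T a (b - b') c d = T a b c d - T a b' c d"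
      "T a b (c + c') d = T a b c d + T a b c' d" "T a b (c - c') d = T a b c d - T a b c' d"
      "T a b c (d + d') = T a b c d + T a b c d'" "T a b c (d - d') = T a b c d - T a b c d'" for a a' b b' c c' d d'
      using R_linear(7)[of a "- a'"] R_linear(5)[of _ "J b" "- J b'"] R_linear(3)[of _ _ c "- c'"] R_linear(1)[of _ _ _ "J d" "- J d'"]
      by (simp_all add: T_def linear_add[OF J_linear] linear_diff[OF J_linear] R_linear neg)
    have T0: "T x x x x = 0" for x using hol[of x] skew34[of x "J x" x "J x"] by (simp add: T_def)
    \<comment> \<open>The even part of the quartic T(x,x,x,x), which vanishes at x + y, x - y, x and
      y.\<close>
    have "2 * T x x y y + 4 * T x y x y = 0"
      using T0[of "x + y"] T0[of "x - y"] T0[of x] T0[of y]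
        T_sym(1)[of y x x y] T_sym(1)[of y x y x] T_sym(2)[of x y y x] T_sym(3)[of y y x x]
      unfolding T_lin by linarith
    moreover have "T x x y y = R x (J y) x (J y) + R x y x y"
      using bianchi[of x "J x" y "J y"] J1[of x y x "J y"] R_J[of y x x y] skew12[of y x x y]
      unfolding T_def by linarith
    ultimately show ?thesis by (simp add: T_def)
  qed
  \<comment> \<open>Replacing y by J y exchanges the two unknowns of \<open>key\<close>, and the
    resulting pair of linear equations has only the zero solution.\<close>
  show "R x y x y = 0" for x y using key[of x y] key[of x "J y"] by (simp add: J_J neg)
qed

end

locale hermitian_form = inner_form G for G :: "'b::euclidean_space \<Rightarrow> 'b \<Rightarrow> real" +
  fixes J :: "'b \<Rightarrow> 'b"
  assumes lin_J: "linear J" and JJ: "J (J u) = - u" and G_JJ: "G (J u) (J v) = G u v"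
begin

lemma G_J: "G u (J v) = - G (J u) v"
  using G_JJ[of u "J v"] by (simp add: JJ form_simps)

lemma G_J_self: "G u (J u) = 0"
  using G_J[of u u] form_sym[of u "J u"] by simp

text \<open>The right-hand side is itself a Kaehler curvature tensor with the same holomorphic
  sectional curvatures, so the difference vanishes by
  \<open>zero_if_holomorphic_zero\<close>.\<close>

lemma space_form_curvature:
  assumes R: "kaehler_curvature R J" and hol: "\<And>x. R x (J x) (J x) x = 4 * c * (G x x)\<^sup>2"
  shows "R u v w z = c * (G v w * G u z - G u w * G v z + G (J v) w * G (J u) z
    - G (J u) w * G (J v) z + 2 * G u (J v) * G (J w) z)"
proof -
  interpret R: kaehler_curvature R J by fact
  define R0 where "R0 u v w z = c * (G v w * G u z - G u w * G v z + G (J v) w * G (J u) z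
    - G (J u) w * G (J v) z + 2 * G u (J v) * G (J w) z)" for u v w z
  have Jflip: "G (J a) b = - G (J b) a" for a b using G_J[of b a] form_sym[of "J a" b] by simp
  interpret Q: kaehler_curvature "\<lambda>u v w z. R u v w z - R0 u v w z" J
  proof
    fix u v w z x
    have e: "G u (J v) = - G (J u) v" "G v (J u) = G (J u) v" "G w (J u) = G (J u) w" "G v (J w) = - G (J v) w"
      using G_J[of u v] G_J[of v w] form_sym[of v "J u"] form_sym[of w "J u"] by simp_all
    show "R u v w z - R0 u v w z = - (R v u w z - R0 v u w z)"
      using R.skew12[of u v w z] Jflip[of v u] unfolding R0_def e by (simp add: algebra_simps)
    show "R u v w z - R0 u v w z = - (R u v z w - R0 u v z w)"
      using R.skew34[of u v w z] unfolding R0_def Jflip[of w z] by (simp add: algebra_simps)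
    show "R u v w z - R0 u v w z + (R v w u z - R0 v w u z) + (R w u v z - R0 w u v z) = 0"
      using R.bianchi[of u v w z] unfolding R0_def e Jflip[of v u] Jflip[of w u] Jflip[of w v]
        form_sym[of v u] form_sym[of w u] form_sym[of w v] by (simp add: algebra_simps)
    show "R u v w (x + z) - R0 u v w (x + z) = R u v w x - R0 u v w x + (R u v w z - R0 u v w z)"
      by (simp add: R0_def form_simps R.R_linear algebra_simps)
    show "R u v w (a *\<^sub>R z) - R0 u v w (a *\<^sub>R z) = a *\<^sub>R (R u v w z - R0 u v w z)" for a
      by (simp add: R0_def form_simps R.R_linear algebra_simps)
    have "R0 u v (J w) (J z) = R0 u v w z"
      unfolding R0_def G_JJ JJ by (simp add: G_J form_simps linear_neg[OF lin_J] algebra_simps)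
    then show "R u v (J w) (J z) - R0 u v (J w) (J z) = R u v w z - R0 u v w z"
      using R.R_J[of u v w z] by simp
  qed (simp_all add: linear_add[OF lin_J] linear_scale[OF lin_J] JJ)
  have "R x (J x) (J x) x - R0 x (J x) (J x) x = 0" for x
    using G_J_self[of x] form_sym[of x "J x"]
    by (simp add: hol R0_def JJ form_simps G_JJ power2_eq_square)
  then have "R u v w z - R0 u v w z = 0" by (rule Q.zero_if_holomorphic_zero)
  then show ?thesis by (simp add: R0_def)
qed

end


subsection \<open>The second fundamental form at a point\<close>

lemma sum_pairs:
  fixes f :: "nat \<Rightarrow> 'a::comm_monoid_add"
  shows "(\<Sum>a=1..2*k. f a) = (\<Sum>i=1..k. f (2*i-1) + f (2*i))"
proof (induction k)
  case (Suc k)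
  have "(\<Sum>a=1..2 * Suc k. f a) = (\<Sum>a=1..2*k. f a) + f (Suc (2*k)) + f (Suc (Suc (2*k)))" by simp
  then show ?case using Suc by (simp add: add.assoc)
qed simp

lemma block_cases: "x = 2 * ((x + 1) div 2) - 1 \<or> x = 2 * ((x + 1) div 2)" for x :: nat
  by presburger

text \<open>The data of an isometric immersion at one point: d stands for its differential and h for
  its second fundamental form, so that the inequality becomes linear algebra.\<close>

locale second_form = src: inner_form G + tgt: inner_form G'
  for G :: "'a::euclidean_space \<Rightarrow> 'a \<Rightarrow> real" and G' :: "'b::euclidean_space \<Rightarrow> 'b \<Rightarrow> real" +
  fixes d :: "'a \<Rightarrow> 'b" and h :: "'a \<Rightarrow> 'a \<Rightarrow> 'b" and c :: real and k :: nat
  assumes d_linear: "linear d" and d_iso: "G u v = G' (d u) (d v)"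
    and h_bilinear: "bilinear h" and h_sym: "h u v = h v u" and h_normal: "G' (h u v) (d w) = 0"
    and dim_a: "DIM('a) = 2 * k" and k_ge_2: "k \<ge> 2"
begin

abbreviation frame :: "(nat \<Rightarrow> 'a) \<Rightarrow> bool" where "frame e \<equiv> orthonormal_wrt G {1..2*k} e"

text \<open>The right-hand side of the Gauss equation for \<open>\<langle>R(u,v)v, u\<rangle>\<close>.\<close>

definition gauss :: "'a \<Rightarrow> 'a \<Rightarrow> real"
  where "gauss u v = c * (G u u * G v v - (G u v)\<^sup>2) + G' (h u u) (h v v) - G' (h u v) (h u v)"

text \<open>Every frame gives the same vector, by \<open>frame_trace\<close>.\<close>

definition H :: 'b
  where "H = (1 / (2 * real k)) *\<^sub>R (\<Sum>a=1..2*k. h ((SOME e. frame e) a) ((SOME e. frame e) a))"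

definition blocktr :: "(nat \<Rightarrow> 'a) \<Rightarrow> nat \<Rightarrow> 'b"
  where "blocktr e i = h (e (2*i-1)) (e (2*i-1)) + h (e (2*i)) (e (2*i))"

definition off :: "(nat \<Rightarrow> 'a) \<Rightarrow> nat \<Rightarrow> nat \<Rightarrow> real"
  where "off e i j =
    G' (h (e (2*i-1)) (e (2*j-1))) (h (e (2*i-1)) (e (2*j-1))) + G' (h (e (2*i-1)) (e (2*j))) (h (e (2*i-1)) (e (2*j)))
    + G' (h (e (2*i)) (e (2*j-1))) (h (e (2*i)) (e (2*j-1))) + G' (h (e (2*i)) (e (2*j))) (h (e (2*i)) (e (2*j)))"

definition defect :: "(nat \<Rightarrow> 'a) \<Rightarrow> real"
  where "defect e = (\<Sum>i=1..k. G' (blocktr e i - 2 *\<^sub>R H) (blocktr e i - 2 *\<^sub>R H))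
    + (\<Sum>i=1..k. \<Sum>j\<in>{1..k} - {i}. off e i j)"

text \<open>The configuration of equality, shown below to be the zero set of \<open>defect\<close>.
  For indices from 1, (a + 1) div 2 is the number of the plane containing
  \<open>e a\<close>.\<close>

definition good :: "(nat \<Rightarrow> 'a) \<Rightarrow> bool"
  where "good e \<longleftrightarrow> (\<forall>i\<in>{1..k}. blocktr e i = 2 *\<^sub>R H) \<and>
    (\<forall>a\<in>{1..2*k}. \<forall>b\<in>{1..2*k}. (a + 1) div 2 \<noteq> (b + 1) div 2 \<longrightarrow> h (e a) (e b) = 0)"

lemma d_simps: "d (u + v) = d u + d v" "d (a *\<^sub>R v) = a *\<^sub>R d v"
  using d_linear by (simp_all add: linear_add linear_scale)

lemmas h_simps = bilinear_ladd[OF h_bilinear] bilinear_radd[OF h_bilinear] bilinear_lsub[OF h_bilinear]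
  bilinear_rsub[OF h_bilinear] bilinear_lmul[OF h_bilinear] bilinear_rmul[OF h_bilinear]

lemma frame_exists: "\<exists>e. frame e"
  using src.orthonormal_basis_exists[OF subspace_UNIV] dim_a by (metis dim_UNIV)

lemma frame_expand: "frame e \<Longrightarrow> v = (\<Sum>a=1..2*k. G v (e a) *\<^sub>R e a)"
  by (rule src.orthonormal_expand) (auto simp: dim_a)

lemma frame_trace:
  assumes "bilinear B" "frame e" "frame f"
  shows "(\<Sum>a=1..2*k. B (e a) (e a)) = (\<Sum>a=1..2*k. B (f a) (f a))"
  by (rule src.trace_basis_independent[OF assms(1)]) (use assms dim_a in simp_all)

lemma sum_h:
  assumes "frame e" shows "(\<Sum>a=1..2*k. h (e a) (e a)) = (2 * real k) *\<^sub>R H"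
  using frame_trace[OF h_bilinear assms someI_ex[OF frame_exists]] k_ge_2 by (simp add: H_def)

lemma sum_blocktr: "frame e \<Longrightarrow> (\<Sum>i=1..k. blocktr e i) = (2 * real k) *\<^sub>R H"
  using sum_h[of e] unfolding sum_pairs blocktr_def .

lemma H_normal: "G' H (d w) = 0"
  unfolding H_def by (simp add: tgt.form_simps tgt.form_sum h_normal)

section \<open>Ricci and scalar curvature through the Gauss equation\<close>

lemma gauss_self: "gauss u u = 0"
  by (simp add: gauss_def power2_eq_square)

lemma gauss_sym: "gauss u v = gauss v u"
  unfolding gauss_def by (simp add: src.form_sym[of v u] h_sym[of v u] tgt.form_sym[of "h v v"] mult.commute)

text \<open>For fixed X, \<open>gauss X\<close> is the quadratic form of a bilinear B, and the sum
  is its trace. The sum may run over a whole frame, even one containing X, since the Gauss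
  expression of X with itself is 0.\<close>

lemma ricci_frame_independent:
  assumes "frame e" "frame f" shows "(\<Sum>a=1..2*k. gauss X (e a)) = (\<Sum>a=1..2*k. gauss X (f a))"
proof -
  define B where "B u v = c * (G X X * G u v - G X u * G X v) + G' (h X X) (h u v) - G' (h X u) (h X v)" for u v
  have "bilinear B" unfolding bilinear_def
    by (auto intro!: linearI simp: B_def src.form_simps tgt.form_simps h_simps algebra_simps)
  from frame_trace[OF this assms] show ?thesis
    by (simp add: B_def gauss_def power2_eq_square)
qed

lemma ricci_eq:
  assumes e: "frame e"
  shows "(\<Sum>a=1..2*k. gauss X (e a)) = c * (2 * real k - 1) * G X X + 2 * real k * G' (h X X) H
    - (\<Sum>a=1..2*k. G' (h X (e a)) (h X (e a)))"
proof -
  have "G X X = (\<Sum>a=1..2*k. G X (e a) * G X (e a))"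
    by (rule src.orthonormal_parseval) (use e dim_a in auto)
  moreover have "(\<Sum>a=1..2*k. G' (h X X) (h (e a) (e a))) = 2 * real k * G' (h X X) H"
    using sum_h[OF e] by (simp add: tgt.form_sum[symmetric] tgt.form_simps)
  moreover have "(\<Sum>a=1..2*k. G X X * G (e a) (e a)) = 2 * real k * G X X"
    using orthonormal_wrtD[OF e] by simp
  ultimately show ?thesis
    unfolding gauss_def power2_eq_square
    by (simp add: sum.distrib sum_subtractf sum_distrib_left[symmetric] algebra_simps)
qed

lemma gauss_pair_sum:
  assumes e: "frame e" and ij: "i \<in> {1..k}" "j \<in> {1..k}" "i \<noteq> j"
  shows "gauss (e (2*i-1)) (e (2*j-1)) + gauss (e (2*i-1)) (e (2*j)) + gauss (e (2*i)) (e (2*j-1))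
    + gauss (e (2*i)) (e (2*j)) = 4 * c + G' (blocktr e i) (blocktr e j) - off e i j"
proof -
  have "1 \<le> i" "i \<le> k" "1 \<le> j" "j \<le> k" using ij by auto
  then have "2*i-1 \<in> {1..2*k}" "2*i \<in> {1..2*k}" "2*j-1 \<in> {1..2*k}" "2*j \<in> {1..2*k}"
    "2*i-1 \<noteq> 2*j-1" "2*i-1 \<noteq> 2*j" "2*i \<noteq> 2*j-1" "2*i \<noteq> 2*j"
    using ij(3) unfolding atLeastAtMost_iff by presburger+
  then show ?thesis
    using orthonormal_wrtD[OF e] by (simp add: gauss_def off_def blocktr_def tgt.form_simps algebra_simps)
qed

lemma scalar_identity:
  assumes e: "frame e"
  shows "(\<Sum>a=1..2*k. \<Sum>b=1..2*k. gauss (e a) (e b)) = 2 * (\<Sum>i=1..k. gauss (e (2*i-1)) (e (2*i)))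
    + 4 * real k * (real k - 1) * (c + G' H H) - defect e"
proof -
  define q where "q i j = gauss (e (2*i-1)) (e (2*j-1)) + gauss (e (2*i-1)) (e (2*j))
    + gauss (e (2*i)) (e (2*j-1)) + gauss (e (2*i)) (e (2*j))" for i j
  define t where "t = blocktr e"
  have split: "(\<Sum>j=1..k. f j) = f i + (\<Sum>j\<in>{1..k}-{i}. f j)" if "i \<in> {1..k}" for f :: "nat \<Rightarrow> real" and i
    using that by (simp add: sum.remove)
  have "(\<Sum>a=1..2*k. \<Sum>b=1..2*k. gauss (e a) (e b)) = (\<Sum>i=1..k. \<Sum>j=1..k. q i j)"
    unfolding sum_pairs by (simp add: q_def sum.distrib[symmetric] add.assoc)
  \<comment> \<open>Inside one plane the two self-terms vanish and the other two agree, giving twice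
    the Gauss expression of the plane.\<close>
  also have "\<dots> = (\<Sum>i=1..k. 2 * gauss (e (2*i-1)) (e (2*i)) + (\<Sum>j\<in>{1..k}-{i}. 4 * c + G' (t i) (t j) - off e i j))"
  proof (rule sum.cong[OF refl])
    fix i assume i: "i \<in> {1..k}"
    have "q i i = 2 * gauss (e (2*i-1)) (e (2*i))"
      by (simp add: q_def gauss_self gauss_sym[of "e (2*i)"])
    moreover have "(\<Sum>j\<in>{1..k}-{i}. q i j) = (\<Sum>j\<in>{1..k}-{i}. 4 * c + G' (t i) (t j) - off e i j)"
      using gauss_pair_sum[OF e i] by (intro sum.cong) (auto simp: q_def t_def)
    ultimately show "(\<Sum>j=1..k. q i j) = 2 * gauss (e (2*i-1)) (e (2*i)) + (\<Sum>j\<in>{1..k}-{i}. 4 * c + G' (t i) (t j) - off e i j)"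
      using split[OF i, of "q i"] by simp
  qed
  also have "\<dots> = 2 * (\<Sum>i=1..k. gauss (e (2*i-1)) (e (2*i))) + 4 * c * (real k * (real k - 1))
      + (\<Sum>i=1..k. \<Sum>j\<in>{1..k}-{i}. G' (t i) (t j)) - (\<Sum>i=1..k. \<Sum>j\<in>{1..k}-{i}. off e i j)"
    using k_ge_2 by (simp add: sum.distrib sum_subtractf sum_distrib_left of_nat_diff)
  also have "(\<Sum>i=1..k. \<Sum>j\<in>{1..k}-{i}. G' (t i) (t j)) = (2 * real k)\<^sup>2 * G' H H - (\<Sum>i=1..k. G' (t i) (t i))"
  proof -
    have "(\<Sum>i=1..k. \<Sum>j\<in>{1..k}-{i}. G' (t i) (t j)) = (\<Sum>i=1..k. (\<Sum>j=1..k. G' (t i) (t j)) - G' (t i) (t i))"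
      using split by (intro sum.cong refl) (simp add: algebra_simps)
    also have "\<dots> = G' (\<Sum>i=1..k. t i) (\<Sum>i=1..k. t i) - (\<Sum>i=1..k. G' (t i) (t i))"
      by (simp only: sum_subtractf tgt.form_sum) (subst sum.swap, rule refl)
    finally show ?thesis using sum_blocktr[OF e] by (simp add: t_def tgt.form_simps power2_eq_square)
  qed
  \<comment> \<open>Completing the square around 2H, the average of the \<open>t i\<close>: their
    sum is 2k H, so the constant is 8k - 4k.\<close>
  also have "(\<Sum>i=1..k. G' (t i) (t i)) = (\<Sum>i=1..k. G' (t i - 2 *\<^sub>R H) (t i - 2 *\<^sub>R H)) + 4 * real k * G' H H"
  proof -
    have "(\<Sum>i=1..k. G' (t i - 2 *\<^sub>R H) (t i - 2 *\<^sub>R H)) = (\<Sum>i=1..k. G' (t i) (t i) - 4 * G' (t i) H + 4 * G' H H)"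
      by (intro sum.cong refl) (simp add: tgt.form_simps tgt.form_sym[of H "t i" for i])
    also have "\<dots> = (\<Sum>i=1..k. G' (t i) (t i)) - 4 * G' (\<Sum>i=1..k. t i) H + real k * (4 * G' H H)"
      by (simp add: sum.distrib sum_subtractf sum_distrib_left tgt.form_sum)
    finally show ?thesis using sum_blocktr[OF e] by (simp add: t_def tgt.form_simps)
  qed
  finally show ?thesis unfolding defect_def t_def by (simp add: power2_eq_square algebra_simps)
qed

lemma defect_nonneg: "defect e \<ge> 0"
  unfolding defect_def off_def by (intro add_nonneg_nonneg sum_nonneg tgt.form_nonneg)

text \<open>Both sums consist of squares of a positive definite form; the rest translates between
  pairs of planes i, j and pairs of indices a, b.\<close>

lemma defect_zero_iff: "defect e = 0 \<longleftrightarrow> good e"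
proof -
  have off0: "off e i j \<ge> 0" for i j unfolding off_def by (intro add_nonneg_nonneg tgt.form_nonneg)
  have offz: "off e i j = 0 \<longleftrightarrow> h (e (2*i-1)) (e (2*j-1)) = 0 \<and> h (e (2*i-1)) (e (2*j)) = 0 \<and>
      h (e (2*i)) (e (2*j-1)) = 0 \<and> h (e (2*i)) (e (2*j)) = 0" for i j
    unfolding off_def by (simp add: add_nonneg_eq_0_iff tgt.form_nonneg tgt.form_zero_iff)
  have s0: "(\<Sum>i=1..k. G' (blocktr e i - 2 *\<^sub>R H) (blocktr e i - 2 *\<^sub>R H)) \<ge> 0"
    "(\<Sum>i=1..k. \<Sum>j\<in>{1..k} - {i}. off e i j) \<ge> 0"
    by (intro sum_nonneg tgt.form_nonneg off0)+
  have s1: "(\<Sum>i=1..k. G' (blocktr e i - 2 *\<^sub>R H) (blocktr e i - 2 *\<^sub>R H)) = 0 \<longleftrightarrow> (\<forall>i\<in>{1..k}. blocktr e i = 2 *\<^sub>R H)"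
    by (subst sum_nonneg_eq_0_iff) (auto simp: tgt.form_nonneg tgt.form_zero_iff)
  have s2: "(\<Sum>i=1..k. \<Sum>j\<in>{1..k} - {i}. off e i j) = 0 \<longleftrightarrow> (\<forall>i\<in>{1..k}. \<forall>j\<in>{1..k} - {i}. off e i j = 0)"
    by (simp add: sum_nonneg_eq_0_iff sum_nonneg off0)
  also have "\<dots> \<longleftrightarrow> (\<forall>a\<in>{1..2*k}. \<forall>b\<in>{1..2*k}. (a + 1) div 2 \<noteq> (b + 1) div 2 \<longrightarrow> h (e a) (e b) = 0)"
  proof (intro iffI ballI impI)
    fix a b assume all: "\<forall>i\<in>{1..k}. \<forall>j\<in>{1..k} - {i}. off e i j = 0"
      and ab: "a \<in> {1..2*k}" "b \<in> {1..2*k}" "(a + 1) div 2 \<noteq> (b + 1) div 2"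
    let ?i = "(a + 1) div 2" and ?j = "(b + 1) div 2"
    have "(x + 1) div 2 \<in> {1..k}" if "x \<in> {1..2*k}" for x using that by auto
    then have "?i \<in> {1..k}" "?j \<in> {1..k} - {?i}" using ab by auto
    with all have "off e ?i ?j = 0" by blast
    moreover have "a = 2 * ?i - 1 \<or> a = 2 * ?i" "b = 2 * ?j - 1 \<or> b = 2 * ?j"
      by (rule block_cases)+
    ultimately show "h (e a) (e b) = 0" unfolding offz by metis
  next
    fix i j assume all: "\<forall>a\<in>{1..2*k}. \<forall>b\<in>{1..2*k}. (a + 1) div 2 \<noteq> (b + 1) div 2 \<longrightarrow> h (e a) (e b) = 0"
      and ij: "i \<in> {1..k}" "j \<in> {1..k} - {i}"
    have "2*i-1 \<in> {1..2*k}" "2*i \<in> {1..2*k}" "2*j-1 \<in> {1..2*k}" "2*j \<in> {1..2*k}" using ij by auto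
    moreover have "(2*i-1+1) div 2 \<noteq> (2*j-1+1) div 2" "(2*i-1+1) div 2 \<noteq> (2*j+1) div 2"
      "(2*i+1) div 2 \<noteq> (2*j-1+1) div 2" "(2*i+1) div 2 \<noteq> (2*j+1) div 2" using ij by auto
    ultimately show "off e i j = 0" unfolding offz using all by blast
  qed
  finally show ?thesis unfolding defect_def good_def s1[symmetric] using s0 by (simp add: add_nonneg_eq_0_iff)
qed

lemma h_continuous: "continuous_on X f \<Longrightarrow> continuous_on X g \<Longrightarrow> continuous_on X (\<lambda>x. h (f x) (g x))"
  using bounded_bilinear.continuous_on h_bilinear bilinear_conv_bounded_bilinear by blast

lemma frame_min_defect: "\<exists>e. frame e \<and> (\<forall>f. frame f \<longrightarrow> defect e \<le> defect f)"
proof -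
  let ?K = "{e. frame e \<and> (\<forall>i. i \<notin> {1..2*k} \<longrightarrow> e i = 0)}"
  \<comment> \<open>Truncation to the indices that \<open>defect\<close> sees, so that the minimum
    over the compact set is a minimum over all frames.\<close>
  define cut where "cut e = (\<lambda>i. if i \<in> {1..2*k} then e i else 0)" for e :: "nat \<Rightarrow> 'a"
  have cut: "cut e \<in> ?K" if "frame e" for e using that by (auto simp: cut_def orthonormal_wrt_def)
  have defect_cut: "defect (cut e) = defect e" for e
  proof -
    have "cut e (2*i-1) = e (2*i-1)" "cut e (2*i) = e (2*i)" if "i \<in> {1..k}" for i
      using that by (auto simp: cut_def)
    then show ?thesis unfolding defect_def off_def blocktr_def by simp
  qed
  have coord: "continuous_on ?K (\<lambda>e. e i)" for i
    by (rule continuous_on_subset[OF continuous_on_product_coordinates]) auto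
  have "continuous_on ?K defect"
    unfolding defect_def off_def blocktr_def
    by (intro continuous_on_add continuous_on_sum continuous_on_diff continuous_on_const tgt.form_continuous
        h_continuous coord)
  moreover have "?K \<noteq> {}" using frame_exists cut by blast
  ultimately obtain e where "e \<in> ?K" "\<forall>f\<in>?K. defect e \<le> defect f"
    using continuous_attains_inf[OF src.compact_frames] by blast
  then show ?thesis using cut defect_cut by (metis (no_types, lifting) mem_Collect_eq)
qed

text \<open>On a \<open>2 \<times> 2\<close> block with trace \<open>2H\<close>, Cayley--Hamilton turns the Ricci tensor into
  \<open>(2k - 2) A\<^sub>H\<close> plus a multiple of the identity.\<close>

lemma good_umbilical:
  assumes e: "frame e" and g: "good e"
    and einstein: "\<And>X. G X X = 1 \<Longrightarrow> (\<Sum>a=1..2*k. gauss X (e a)) = \<rho>"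
  shows "G' (h u v) H = G' H H * G u v"
proof -
  define ric where "ric X = c * (2 * real k - 1) * G X X + 2 * real k * G' (h X X) H
    - (\<Sum>a=1..2*k. G' (h X (e a)) (h X (e a)))" for X
  \<comment> \<open>The Einstein condition speaks of unit vectors; both sides are quadratic in X, so
    scaling extends it to the sum of two frame vectors used below.\<close>
  have ric: "ric X = \<rho> * G X X" if "X \<noteq> 0" for X
  proof -
    define s where "s = 1 / sqrt (G X X)"
    have pos: "G X X > 0" using src.form_pos[OF that] .
    have s: "s * s * G X X = 1" using pos by (simp add: s_def divide_simps)
    have "ric (s *\<^sub>R X) = s * s * ric X"
      unfolding ric_def by (simp add: src.form_simps tgt.form_simps h_simps sum_distrib_left algebra_simps)
    moreover have "G (s *\<^sub>R X) (s *\<^sub>R X) = 1" using s by (simp add: src.form_simps mult.assoc)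
    then have "ric (s *\<^sub>R X) = \<rho>"
      using einstein unfolding ricci_eq[OF e] ric_def by blast
    ultimately have "s * s * ric X = s * s * (\<rho> * G X X)" using s by (simp add: algebra_simps)
    moreover have "s * s \<noteq> 0" using s by auto
    ultimately show ?thesis by simp
  qed
  have block: "G' (h (e (2*i-1)) (e (2*i-1))) H = G' H H" "G' (h (e (2*i)) (e (2*i))) H = G' H H"
    "G' (h (e (2*i-1)) (e (2*i))) H = 0" if i: "i \<in> {1..k}" for i
  proof -
    let ?u = "e (2*i-1)" and ?v = "e (2*i)"
    have idx: "2*i-1 \<in> {1..2*k}" "2*i \<in> {1..2*k}" "2*i-1 \<noteq> 2*i" using i by auto
    have on: "G ?u ?u = 1" "G ?v ?v = 1" "G ?u ?v = 0" "G ?v ?u = 0"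
      using orthonormal_wrtD[OF e] idx by auto
    have tr: "h ?u ?u + h ?v ?v = 2 *\<^sub>R H" using g i unfolding good_def blocktr_def by blast
    have sums: "(\<Sum>a=1..2*k. G' (h X (e a)) (h X (e a))) = G' (h X ?u) (h X ?u) + G' (h X ?v) (h X ?v)"
      if X: "X = ?u \<or> X = ?v \<or> X = ?u + ?v" for X
    proof -
      have z: "h X (e a) = 0" if "a \<in> {1..2*k} - {2*i-1, 2*i}" for a
      proof -
        have "1 \<le> a" "1 \<le> i" "a \<noteq> 2*i-1" "a \<noteq> 2*i" using that i by auto
        then have "(2*i-1+1) div 2 \<noteq> (a + 1) div 2" "(2*i+1) div 2 \<noteq> (a + 1) div 2" by presburger+
        then have "h ?u (e a) = 0" "h ?v (e a) = 0" using g idx that unfolding good_def by blast+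
        then show ?thesis using X by (auto simp: h_simps)
      qed
      have "(\<Sum>a=1..2*k. G' (h X (e a)) (h X (e a))) = (\<Sum>a\<in>{2*i-1, 2*i}. G' (h X (e a)) (h X (e a)))"
        using idx z by (intro sum.mono_neutral_right) (auto simp: tgt.form_simps)
      then show ?thesis using idx(3) by simp
    qed
    have nz: "?u \<noteq> 0" "?v \<noteq> 0" "?u + ?v \<noteq> 0"
      using on src.form_simps(9)[of ?u] src.form_simps(9)[of ?v] src.form_simps(1)[of ?u ?v ?u] by auto
    define A B D where "A = h ?u ?u" and "B = h ?u ?v" and "D = h ?v ?v"
    have hv: "h ?v ?u = B" using h_sym by (simp add: B_def)
    have DH: "D = 2 *\<^sub>R H - A" using tr unfolding A_def D_def by (simp add: algebra_simps)
    have ru: "c * (2 * real k - 1) + 2 * real k * G' A H - (G' A A + G' B B) = \<rho>"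
      using ric[OF nz(1)] unfolding ric_def sums[OF disjI1[OF refl]] on
        A_def[symmetric] B_def[symmetric] by simp
    have rv: "c * (2 * real k - 1) + 2 * real k * G' D H - (G' B B + G' D D) = \<rho>"
      using ric[OF nz(2)] unfolding ric_def sums[OF disjI2[OF disjI1[OF refl]]] on hv
        D_def[symmetric] by simp
    have ruv: "c * (2 * real k - 1) * 2 + 2 * real k * (G' A H + 2 * G' B H + G' D H)
        - (G' (A + B) (A + B) + G' (B + D) (B + D)) = \<rho> * 2"
      using ric[OF nz(3)] unfolding ric_def sums[OF disjI2[OF disjI2[OF refl]]]
      unfolding h_simps src.form_simps on hv A_def[symmetric] B_def[symmetric] D_def[symmetric]
      by (simp add: tgt.form_simps algebra_simps)
    \<comment> \<open>Half of \<open>ru\<close> minus \<open>rv\<close>: as D = 2H - A, |A|^2 -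
      |D|^2 = 4<A,H> - 4|H|^2. The factor 2k - 2 is nonzero because k \<ge> 2.\<close>
    have "(2 * real k - 2) * (G' A H - G' H H) = 0"
      using ru rv unfolding DH by (simp add: tgt.form_simps tgt.form_sym[of H A] algebra_simps)
    then have AH: "G' A H = G' H H" using k_ge_2 by simp
    \<comment> \<open>\<open>ruv\<close> minus \<open>ru\<close> and \<open>rv\<close>, halved: the
      quadratic terms left over are 2<A + D, B> = 4<H,B>.\<close>
    have "(2 * real k - 2) * G' B H = 0"
      using ruv ru rv
      unfolding DH tgt.form_simps tgt.form_sym[of H A] tgt.form_sym[of H B] tgt.form_sym[of A B]
      by (simp only: algebra_simps)
    then have BH: "G' B H = 0" using k_ge_2 by simp
    show "G' (h ?u ?u) H = G' H H" "G' (h ?v ?v) H = G' H H" "G' (h ?u ?v) H = 0"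
      using AH BH DH unfolding A_def[symmetric] B_def[symmetric] D_def[symmetric] by (simp_all add: tgt.form_simps)
  qed
  have on_frame: "G' (h (e a) (e b)) H = G' H H * G (e a) (e b)" if ab: "a \<in> {1..2*k}" "b \<in> {1..2*k}" for a b
  proof (cases "(a + 1) div 2 = (b + 1) div 2")
    case False
    then have "h (e a) (e b) = 0" "a \<noteq> b" using g ab unfolding good_def by auto
    then show ?thesis using orthonormal_wrtD[OF e ab] by (simp add: tgt.form_simps)
  next
    case True
    define i where "i = (a + 1) div 2"
    have i: "i \<in> {1..k}" using ab by (auto simp: i_def)
    have "a = 2*i-1 \<or> a = 2*i" "b = 2*i-1 \<or> b = 2*i" using block_cases[of a] block_cases[of b] True by (simp_all only: i_def)
    moreover have "2*i-1 \<noteq> 2*i" "2*i \<noteq> 2*i-1" using i by auto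
    moreover have "G' (h (e (2*i)) (e (2*i-1))) H = 0" using block(3)[OF i] h_sym by metis
    ultimately show ?thesis
      using block[OF i] orthonormal_wrtD[OF e ab] by (elim disjE) (simp_all only: simp_thms if_True if_False mult_1_right mult_zero_right)
  qed
  have bil: "bilinear (\<lambda>u v. G' (h u v) H)" "bilinear (\<lambda>u v. G' H H * G u v)"
    unfolding bilinear_def by (auto intro!: linearI simp: h_simps src.form_simps tgt.form_simps algebra_simps)
  have sp: "UNIV \<subseteq> span (e ` {1..2*k})"
  proof
    fix v show "v \<in> span (e ` {1..2*k})"
      by (subst frame_expand[OF e]) (intro span_sum span_scale span_base, auto)
  qed
  show ?thesis
    by (rule bilinear_eq[OF bil sp sp]) (use on_frame in blast)+
qed

section \<open>Adapted normal frames and block-diagonal shape operators\<close>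

definition adapted :: "(nat \<Rightarrow> 'b) \<Rightarrow> bool"
  where "adapted \<xi> \<longleftrightarrow> orthonormal_wrt G' {2*k+1..DIM('b)} \<xi> \<and> (\<forall>r\<in>{2*k+1..DIM('b)}. \<forall>u. G' (\<xi> r) (d u) = 0)"

lemma adapted_union:
  assumes e: "frame e" and \<xi>: "orthonormal_wrt G' {2*k+1..n} \<xi>" "\<And>r u. r \<in> {2*k+1..n} \<Longrightarrow> G' (\<xi> r) (d u) = 0"
  shows "orthonormal_wrt G' {1..n} (\<lambda>i. if i \<le> 2*k then d (e i) else \<xi> i)"
proof -
  have "G' (d u) (\<xi> r) = 0" if "r \<in> {2*k+1..n}" for r u using \<xi>(2)[OF that] tgt.form_sym by metis
  then show ?thesis
    using \<xi> orthonormal_wrtD[OF e] orthonormal_wrtD[OF \<xi>(1)]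
    unfolding orthonormal_wrt_def by (auto simp: d_iso[symmetric])
qed

lemma dim_le: "2 * k \<le> DIM('b)"
proof -
  obtain e where "frame e" using frame_exists by blast
  from adapted_union[OF this, of "2*k"] have "orthonormal_wrt G' {1..2*k} (\<lambda>i. if i \<le> 2*k then d (e i) else 0)"
    by (auto simp: orthonormal_wrt_def)
  then show ?thesis using tgt.orthonormal_card_le by fastforce
qed

lemma normal_expand:
  assumes \<xi>: "adapted \<xi>" and \<eta>: "\<And>u. G' \<eta> (d u) = 0"
  shows "\<eta> = (\<Sum>r=2*k+1..DIM('b). G' \<eta> (\<xi> r) *\<^sub>R \<xi> r)"
proof -
  obtain e where e: "frame e" using frame_exists by blast
  let ?f = "\<lambda>i. if i \<le> 2*k then d (e i) else \<xi> i"
  have "orthonormal_wrt G' {1..DIM('b)} ?f" using \<xi> unfolding adapted_def by (intro adapted_union[OF e]) auto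
  from tgt.orthonormal_expand[OF this] have "\<eta> = (\<Sum>i=1..DIM('b). G' \<eta> (?f i) *\<^sub>R ?f i)" by simp
  also have "\<dots> = (\<Sum>r=2*k+1..DIM('b). G' \<eta> (?f r) *\<^sub>R ?f r)"
    using \<eta> by (intro sum.mono_neutral_right) auto
  also have "\<dots> = (\<Sum>r=2*k+1..DIM('b). G' \<eta> (\<xi> r) *\<^sub>R \<xi> r)" by (intro sum.cong) auto
  finally show ?thesis .
qed

lemma normal_zero:
  assumes "adapted \<xi>" "\<And>u. G' \<eta> (d u) = 0" "\<And>r. r \<in> {2*k+1..DIM('b)} \<Longrightarrow> G' \<eta> (\<xi> r) = 0"
  shows "\<eta> = 0"
  using normal_expand[OF assms(1,2)] assms(3) by simp

text \<open>The first normal vector is chosen along \<open>H\<close> when \<open>H \<noteq> 0\<close>.\<close>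

lemma adapted_exists: "\<exists>\<xi>. adapted \<xi> \<and> (\<forall>r\<in>{2*k+2..DIM('b)}. G' H (\<xi> r) = 0)"
proof -
  obtain e where e: "frame e" using frame_exists by blast
  \<comment> \<open>Prescribed normal vectors are appended to the image of a tangent frame before
    extending; the new vectors are then orthogonal to that image, hence normal.\<close>
  have extend: "\<exists>\<xi>. adapted \<xi> \<and> (\<forall>r\<in>{2*k+1..m}. \<xi> r = \<xi>0 r)"
    if \<xi>0: "orthonormal_wrt G' {2*k+1..m} \<xi>0" "\<And>r u. r \<in> {2*k+1..m} \<Longrightarrow> G' (\<xi>0 r) (d u) = 0" and m: "2*k \<le> m"
    for \<xi>0 m
  proof -
    let ?f = "\<lambda>i. if i \<le> 2*k then d (e i) else \<xi>0 i"
    have f: "orthonormal_wrt G' {1..m} ?f" by (rule adapted_union[OF e \<xi>0])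
    have "m \<le> DIM('b)" using tgt.orthonormal_card_le[OF f] by simp
    then obtain f' where f': "orthonormal_wrt G' {1..DIM('b)} f'" "\<And>i. i \<in> {1..m} \<Longrightarrow> f' i = ?f i"
      using tgt.orthonormal_extend_UNIV[OF f] by blast
    have "G' (f' r) (d u) = 0" if r: "r \<in> {2*k+1..DIM('b)}" for r u
    proof -
      have "G' (f' r) (d (e a)) = 0" if "a \<in> {1..2*k}" for a
        using orthonormal_wrtD[OF f'(1), of r a] f'(2)[of a] that r m dim_le by auto
      moreover have "d u = (\<Sum>a=1..2*k. G u (e a) *\<^sub>R d (e a))"
        by (subst frame_expand[OF e, of u]) (simp add: linear_sum[OF d_linear] d_simps)
      ultimately show ?thesis by (simp add: tgt.form_sum tgt.form_simps)
    qed
    then have "adapted f'" using f'(1) unfolding adapted_def orthonormal_wrt_def by auto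
    then show ?thesis using f'(2) m by auto
  qed
  show ?thesis
  proof (cases "H = 0")
    case True
    \<comment> \<open>No vector is prescribed: the index range {2k+1..2k} is empty.\<close>
    then show ?thesis using extend[of "2*k"] by (auto simp: orthonormal_wrt_def tgt.form_simps)
  next
    case False
    then have pos: "G' H H > 0" by (rule tgt.form_pos)
    define \<xi>0 where "\<xi>0 r = (1 / sqrt (G' H H)) *\<^sub>R H" for r :: nat
    have "G' (\<xi>0 r) (\<xi>0 r) = 1" for r using pos by (simp add: \<xi>0_def tgt.form_simps divide_simps)
    then have "orthonormal_wrt G' {2*k+1..2*k+1} \<xi>0" by (auto simp: orthonormal_wrt_def)
    moreover have "G' (\<xi>0 r) (d u) = 0" for r u using H_normal by (simp add: \<xi>0_def tgt.form_simps)
    ultimately obtain \<xi> where \<xi>: "adapted \<xi>" "\<xi> (2*k+1) = \<xi>0 (2*k+1)" using extend[of "2*k+1" \<xi>0] by auto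
    have "G' H (\<xi> r) = 0" if "r \<in> {2*k+2..DIM('b)}" for r
    proof -
      have "G' (\<xi> (2*k+1)) (\<xi> r) = 0" using \<xi>(1) that unfolding adapted_def orthonormal_wrt_def by auto
      then show ?thesis using pos unfolding \<xi>(2) \<xi>0_def by (simp add: tgt.form_simps)
    qed
    then show ?thesis using \<xi>(1) by blast
  qed
qed

text \<open>The counterpart of \<open>traceless_blocks\<close> for the shape operator of \<xi>,
  written with h instead of matrices.\<close>

definition traceless_along :: "(nat \<Rightarrow> 'a) \<Rightarrow> 'b \<Rightarrow> bool"
  where "traceless_along e \<xi> \<longleftrightarrow> (\<forall>i\<in>{1..k}. G' (blocktr e i) \<xi> = 0) \<and>
    (\<forall>a\<in>{1..2*k}. \<forall>b\<in>{1..2*k}. (a + 1) div 2 \<noteq> (b + 1) div 2 \<longrightarrow> G' (h (e a) (e b)) \<xi> = 0)"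

text \<open>The entry (a, b) of the matrix of A is h(e a, e b) paired with \<xi>, so the block form
  is a statement on h, and the blocks are symmetric because h is.\<close>

lemma traceless_blocks_iff:
  assumes e: "frame e" and A: "\<And>X Y. G (A X) Y = G' (h X Y) \<xi>"
  shows "traceless_blocks k e A \<longleftrightarrow> traceless_along e \<xi>"
proof
  assume "traceless_blocks k e A"
  then obtain B :: "nat \<Rightarrow> real^2^2" where B: "\<And>i. i \<in> {1..k} \<Longrightarrow> trace (B i) = 0"
    "\<And>b. b \<in> {1..2*k} \<Longrightarrow> A (e b) = (\<Sum>a=1..2*k. block_diag B a b *\<^sub>R e a)"
    unfolding traceless_blocks_def by blast
  have hB: "G' (h (e a) (e b)) \<xi> = block_diag B a b" if "a \<in> {1..2*k}" "b \<in> {1..2*k}" for a b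
    using src.orthonormal_coeff[OF e _ that(1), of "\<lambda>a. block_diag B a b"] A[of "e b" "e a"] B(2)[OF that(2)] h_sym by simp
  have "G' (blocktr e i) \<xi> = 0" if i: "i \<in> {1..k}" for i
  proof -
    have "2*i-1 \<in> {1..2*k}" "2*i \<in> {1..2*k}" using i by auto
    then have "G' (blocktr e i) \<xi> = block_diag B (2*i-1) (2*i-1) + block_diag B (2*i) (2*i)"
      by (simp only: blocktr_def tgt.form_simps hB)
    also have "\<dots> = B i $ 1 $ 1 + B i $ 2 $ 2" using i by (simp add: block_diag_def)
    also have "\<dots> = 0" using B(1)[OF i] by (simp add: trace_def sum_2)
    finally show ?thesis .
  qed
  then show "traceless_along e \<xi>" unfolding traceless_along_def by (auto simp: hB block_diag_def)
next
  assume t: "traceless_along e \<xi>"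
  \<comment> \<open>Inverse of the parity convention of \<open>block_diag\<close>: row 1 of block i
    is the index 2i - 1, row 2 is 2i.\<close>
  define pos :: "nat \<Rightarrow> 2 \<Rightarrow> nat" where "pos i p = (if p = 1 then 2*i-1 else 2*i)" for i p
  define B :: "nat \<Rightarrow> real^2^2" where "B i = (\<chi> p q. G' (h (e (pos i p)) (e (pos i q))) \<xi>)" for i
  have "transpose (B i) = B i" for i
    by (simp add: transpose_def B_def vec_eq_iff h_sym)
  moreover have "trace (B i) = 0" if "i \<in> {1..k}" for i
    using t that unfolding traceless_along_def by (simp add: trace_def sum_2 B_def pos_def blocktr_def tgt.form_simps)
  moreover have "A (e b) = (\<Sum>a=1..2*k. block_diag B a b *\<^sub>R e a)" if b: "b \<in> {1..2*k}" for b
  proof -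
    have "block_diag B a b = G (A (e b)) (e a)" if a: "a \<in> {1..2*k}" for a
    proof (cases "(a + 1) div 2 = (b + 1) div 2")
      case True
      have pa: "pos ((x + 1) div 2) (if odd x then 1 else 2) = x" if "x \<ge> 1" for x
        using that by (auto simp: pos_def)
      have "block_diag B a b = G' (h (e a) (e b)) \<xi>"
        using pa[of a] pa[of b] a b True by (simp add: block_diag_def B_def)
      then show ?thesis using A h_sym by simp
    next
      case False
      then have "G' (h (e a) (e b)) \<xi> = 0" using t a b unfolding traceless_along_def by blast
      then show ?thesis using False A h_sym by (simp add: block_diag_def)
    qed
    then show ?thesis using frame_expand[OF e, of "A (e b)"] by simp
  qed
  ultimately show "traceless_blocks k e A" unfolding traceless_blocks_def by blast
qed

lemma good_traceless: "good e \<Longrightarrow> G' H \<xi> = 0 \<Longrightarrow> traceless_along e \<xi>"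
  unfolding good_def traceless_along_def by (auto simp: tgt.form_simps)

text \<open>A normal vector vanishes once all its components along \<xi> do, and the block trace to
  be reached is 2H = 0.\<close>

lemma good_if_minimal:
  assumes \<xi>: "adapted \<xi>" and "H = 0" and t: "\<And>r. r \<in> {2*k+1..DIM('b)} \<Longrightarrow> traceless_along e (\<xi> r)"
  shows "good e"
  using assms unfolding good_def
  by (auto intro!: normal_zero[OF \<xi>] simp: traceless_along_def blocktr_def h_normal tgt.form_simps)

text \<open>The vectors \<open>\<xi>\<^sub>r\<close> with \<open>r \<ge> 2k + 2\<close> are orthogonal to \<open>H\<close>, so the remaining one spans the line of \<open>H\<close>.\<close>

lemma good_if_umbilical:
  assumes e: "frame e" and \<xi>: "adapted \<xi>" and "H \<noteq> 0" and umb: "\<And>u v. G' (h u v) H = \<mu> * G u v"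
    and t: "\<And>r. r \<in> {2*k+2..DIM('b)} \<Longrightarrow> traceless_along e (\<xi> r)"
  shows "good e"
proof -
  \<comment> \<open>The components of the block traces along \<open>\<xi> r\<close> vanish, and they
    add up to that of 2k H.\<close>
  have "G' H (\<xi> r) = 0" if r: "r \<in> {2*k+2..DIM('b)}" for r
  proof -
    have "2 * real k * G' H (\<xi> r) = G' (\<Sum>i=1..k. blocktr e i) (\<xi> r)" unfolding sum_blocktr[OF e] by (simp add: tgt.form_simps)
    also have "\<dots> = 0" using t[OF r] by (simp add: traceless_along_def tgt.form_sum)
    finally show ?thesis using k_ge_2 by simp
  qed
  then have HN: "G' H (\<xi> r) = 0" if "r \<in> {2*k+1..DIM('b)}" "r \<noteq> 2*k+1" for r using that by auto
  define lam where "lam = G' H (\<xi> (2*k+1))"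
  have "lam \<noteq> 0" using normal_zero[OF \<xi> H_normal] HN \<open>H \<noteq> 0\<close> unfolding lam_def by metis
  have Hexp: "H = lam *\<^sub>R \<xi> (2*k+1)"
  proof -
    \<comment> \<open>Without any normal direction H would be 0.\<close>
    have "2*k+1 \<in> {2*k+1..DIM('b)}"
    proof (rule ccontr)
      assume "2*k+1 \<notin> {2*k+1..DIM('b)}"
      then have "{2*k+1..DIM('b)} = {}" by auto
      then show False using normal_zero[OF \<xi> H_normal] \<open>H \<noteq> 0\<close> by blast
    qed
    moreover have "(\<Sum>r=2*k+1..DIM('b). G' H (\<xi> r) *\<^sub>R \<xi> r) = (\<Sum>r=2*k+1..DIM('b). if r = 2*k+1 then lam *\<^sub>R \<xi> r else 0)"
      using HN by (intro sum.cong) (auto simp: lam_def)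
    ultimately show ?thesis using normal_expand[OF \<xi> H_normal] by simp
  qed
  have h1: "G' (h u v) (\<xi> (2*k+1)) = \<mu> / lam * G u v" for u v
    using umb[of u v] \<open>lam \<noteq> 0\<close> unfolding Hexp by (simp add: tgt.form_simps field_simps)
  have comp: "G' (h (e a) (e b)) (\<xi> r) = 0"
    if "a \<in> {1..2*k}" "b \<in> {1..2*k}" "(a + 1) div 2 \<noteq> (b + 1) div 2" "r \<in> {2*k+1..DIM('b)}" for a b r
  proof (cases "r = 2*k+1")
    case True
    have "a \<noteq> b" using that by auto
    then show ?thesis using orthonormal_wrtD[OF e that(1,2)] unfolding True h1 by simp
  next
    case False
    then have "traceless_along e (\<xi> r)" using that by (intro t) auto
    then show ?thesis using that unfolding traceless_along_def by blast
  qed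
  have tr: "G' (blocktr e i - (2 * \<mu> / lam) *\<^sub>R \<xi> (2*k+1)) (\<xi> r) = 0" if i: "i \<in> {1..k}" and r: "r \<in> {2*k+1..DIM('b)}" for i r
  proof (cases "r = 2*k+1")
    case True
    have "2*i-1 \<in> {1..2*k}" "2*i \<in> {1..2*k}" using i by auto
    moreover have "G' (\<xi> (2*k+1)) (\<xi> (2*k+1)) = 1"
      using \<xi> r True unfolding adapted_def orthonormal_wrt_def by auto
    ultimately show ?thesis using orthonormal_wrtD[OF e]
      unfolding True blocktr_def tgt.form_simps h1 by simp
  next
    case False
    then have "traceless_along e (\<xi> r)" using r by (intro t) auto
    moreover have "G' (\<xi> (2*k+1)) (\<xi> r) = 0"
      using \<xi> r False unfolding adapted_def orthonormal_wrt_def by auto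
    ultimately show ?thesis using i by (simp add: traceless_along_def tgt.form_simps)
  qed
  have "G' (\<xi> (2*k+1)) (d u) = 0" for u
    using H_normal[of u] \<open>lam \<noteq> 0\<close> by (subst (asm) Hexp) (simp add: tgt.form_simps)
  then have bt: "blocktr e i = (2 * \<mu> / lam) *\<^sub>R \<xi> (2*k+1)" if "i \<in> {1..k}" for i
    using normal_zero[OF \<xi>, of "blocktr e i - (2 * \<mu> / lam) *\<^sub>R \<xi> (2*k+1)"] tr[OF that]
    by (simp add: blocktr_def tgt.form_simps h_normal)
  \<comment> \<open>All block traces equal one vector and sum to 2k H, so this vector is 2H,
    whatever \<mu> is.\<close>
  have "(2 * real k) *\<^sub>R H = real k *\<^sub>R ((2 * \<mu> / lam) *\<^sub>R \<xi> (2*k+1))"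
    unfolding sum_blocktr[OF e, symmetric] by (simp add: bt sum_constant_scaleR)
  then have "real k *\<^sub>R (2 *\<^sub>R H - (2 * \<mu> / lam) *\<^sub>R \<xi> (2*k+1)) = 0" by (simp add: scaleR_diff_right mult.commute)
  then have "2 *\<^sub>R H = (2 * \<mu> / lam) *\<^sub>R \<xi> (2*k+1)" using k_ge_2 by simp
  then show ?thesis
    unfolding good_def using bt comp by (auto intro!: normal_zero[OF \<xi> h_normal])
qed

end


subsection \<open>Charts\<close>

lemma smooth_on_subset:
  assumes "smooth_on S F" "T \<subseteq> S" shows "smooth_on T F"
proof -
  have "Ck_on r S F \<Longrightarrow> Ck_on r T F" for r and F :: "'a \<Rightarrow> 'b"
    using assms(2) by (induction r arbitrary: F) (auto intro: continuous_on_subset)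
  then show ?thesis using assms(1) unfolding smooth_on_def by blast
qed

lemma isometric_map_subset:
  assumes "isometric_map S g T g' U F" "open V" "V \<subseteq> U"
  shows "isometric_map S g T g' V F"
  using assms unfolding isometric_map_def isometric_map_axioms_def
  by (auto intro: smooth_on_subset)

lemma cinv_cmap:
  assumes "is_chart C" "p \<in> cdom C" shows "cinv C (cmap C p) = p"
  using assms unfolding is_chart_def homeomorphism_def by auto

lemma open_chart_image:
  assumes "is_chart C" "open W" "W \<subseteq> cdom C" shows "open (cmap C ` W)"
proof -
  have h: "homeomorphism (cdom C) (cran C) (cmap C) (cinv C)" and o: "open (cran C)"
    using assms(1) unfolding is_chart_def by auto
  have "openin (top_of_set (cdom C)) W" using assms(2,3) by (simp add: open_subset)
  then have "openin (top_of_set (cran C)) (cmap C ` W)" by (rule homeomorphism_imp_open_map[OF h])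
  then show ?thesis using o openin_open_trans by blast
qed

lemma open_chart_preimage:
  assumes "is_chart C" "open B" "B \<subseteq> cran C" shows "open (cinv C ` B)"
proof -
  have h: "homeomorphism (cran C) (cdom C) (cinv C) (cmap C)" and o: "open (cdom C)"
    using assms(1) homeomorphism_symD unfolding is_chart_def by auto
  have "openin (top_of_set (cran C)) B" using assms(2,3) by (simp add: open_subset)
  then have "openin (top_of_set (cdom C)) (cinv C ` B)" by (rule homeomorphism_imp_open_map[OF h])
  then show ?thesis using o openin_open_trans by blast
qed

context
  fixes M :: "('p::{t2_space,second_countable_topology}, 'a::euclidean_space) mfd"
  assumes M: "riemannian_manifold M"
begin

lemma atlas_smooth: "smooth_atlas (atlas M)"
  using M unfolding riemannian_manifold_def by (rule conjunct1)

lemma atlas_chart: "C \<in> atlas M \<Longrightarrow> is_chart C"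
  using atlas_smooth unfolding smooth_atlas_def by simp

lemma chart_at_atlas: "chart_at M p \<in> atlas M" and chart_at_mem: "p \<in> cdom (chart_at M p)"
proof -
  have "(\<Union>C\<in>atlas M. cdom C) = UNIV" using atlas_smooth unfolding smooth_atlas_def by simp
  then have "\<exists>C. C \<in> atlas M \<and> p \<in> cdom C" by blast
  from someI_ex[OF this] show "chart_at M p \<in> atlas M" "p \<in> cdom (chart_at M p)"
    unfolding chart_at_def by auto
qed

lemma riem_chart:
  assumes "C \<in> atlas M" shows "riem (cran C) (metric M C)"
proof -
  have "open (cran C)" using atlas_chart[OF assms] unfolding is_chart_def by blast
  moreover have "\<forall>C\<in>atlas M.
      (\<forall>x\<in>cran C. bilinear (metric M C x) \<and> (\<forall>u v. metric M C x u v = metric M C x v u) \<and>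
        (\<forall>u. u \<noteq> 0 \<longrightarrow> metric M C x u u > 0)) \<and> (\<forall>u v. smooth_on (cran C) (\<lambda>x. metric M C x u v))"
    using M unfolding riemannian_manifold_def by (elim conjE)
  from bspec[OF this assms] have "\<And>x. x \<in> cran C \<Longrightarrow> bilinear (metric M C x)"
    "\<And>x u v. x \<in> cran C \<Longrightarrow> metric M C x u v = metric M C x v u"
    "\<And>x u. x \<in> cran C \<Longrightarrow> u \<noteq> 0 \<Longrightarrow> metric M C x u u > 0" "\<And>u v. smooth_on (cran C) (\<lambda>x. metric M C x u v)"
    by blast+
  ultimately show ?thesis by (rule riem.intro)
qed

lemma inner_form_ip: "inner_form (ip M p)"
  unfolding ip_def using chart_at_mem by (intro riem.inner_form_g[OF riem_chart[OF chart_at_atlas]]) auto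

lemma curvature_like_ip: "curvature_like (\<lambda>u v w z. ip M p (curv M p u v w) z)"
  unfolding ip_def curv_def curv_loc_rcurv using chart_at_mem
  by (intro riem.curvature_like_rcurv[OF riem_chart[OF chart_at_atlas]]) auto

lemma metric_transition:
  assumes "C \<in> atlas M" "C' \<in> atlas M" "p \<in> cdom C \<inter> cdom C'"
  shows "metric M C (cmap C p) u v =
    metric M C' (cmap C' p) (Dv (transition C C') (cmap C p) u) (Dv (transition C C') (cmap C p) v)"
proof -
  have "\<forall>C\<in>atlas M. \<forall>C'\<in>atlas M. \<forall>p\<in>cdom C \<inter> cdom C'. \<forall>u v. metric M C (cmap C p) u v =
      metric M C' (cmap C' p) (Dv (transition C C') (cmap C p) u) (Dv (transition C C') (cmap C p) v)"
    using M unfolding riemannian_manifold_def by (elim conjE)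
  then show ?thesis using assms by blast
qed

lemma transition_isometry:
  assumes C: "C \<in> atlas M" "C' \<in> atlas M"
  shows "local_isometry (cran C) (metric M C) (cran C') (metric M C') (cmap C ` (cdom C \<inter> cdom C')) (transition C C')"
proof -
  have "smooth_on (cmap C ` (cdom C \<inter> cdom C')) (transition C C')"
    using atlas_smooth C unfolding smooth_atlas_def by simp
  moreover have "metric M C x u v = metric M C' (transition C C' x) (Dv (transition C C') x u) (Dv (transition C C') x v)"
    if x: "x \<in> cmap C ` (cdom C \<inter> cdom C')" for x u v
  proof -
    obtain p where p: "p \<in> cdom C \<inter> cdom C'" "x = cmap C p" using x by blast
    then have "transition C C' x = cmap C' p" using cinv_cmap[OF atlas_chart[OF C(1)]] by (simp add: transition_def)
    then show ?thesis using metric_transition[OF C p(1)] by (simp only: p(2))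
  qed
  moreover have "open (cmap C ` (cdom C \<inter> cdom C'))"
    using atlas_chart[OF C(1)] atlas_chart[OF C(2)] unfolding is_chart_def
    by (intro open_chart_image[OF atlas_chart[OF C(1)]]) auto
  moreover have "transition C C' ` (cmap C ` (cdom C \<inter> cdom C')) \<subseteq> cran C'"
    using cinv_cmap[OF atlas_chart[OF C(1)]] by (auto simp: transition_def)
  ultimately show ?thesis
    unfolding local_isometry_def isometric_map_def isometric_map_axioms_def
    using riem_chart[OF C(1)] riem_chart[OF C(2)] by (simp add: image_mono)
qed

lemma sectional_curvature_eq:
  assumes "ip M p u u = 1" "ip M p v v = 1" "ip M p u v = 0"
  shows "sectional_curvature M p (span {u, v}) = ip M p (curv M p u v v) u"
  unfolding sectional_curvature_def
proof (rule some_equality)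
  show "\<exists>u' v'. ip M p u' u' = 1 \<and> ip M p v' v' = 1 \<and> ip M p u' v' = 0 \<and> span {u', v'} = span {u, v}
    \<and> ip M p (curv M p u v v) u = ip M p (curv M p u' v' v') u'" using assms by blast
next
  fix \<kappa> assume "\<exists>u' v'. ip M p u' u' = 1 \<and> ip M p v' v' = 1 \<and> ip M p u' v' = 0 \<and> span {u', v'} = span {u, v}
    \<and> \<kappa> = ip M p (curv M p u' v' v') u'"
  then show "\<kappa> = ip M p (curv M p u v v) u"
    using inner_form.sectional_well_defined[OF inner_form_ip curvature_like_ip, of p u v] assms by metis
qed

end

lemma orthonormal_on_wrt: "orthonormal_on M p I e = orthonormal_wrt (ip M p) I e"
  unfolding orthonormal_on_def orthonormal_wrt_def ..


subsection \<open>The curvature of a complex space form\<close>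

lemma linear_Jc: "linear Jc"
  by (rule linearI) (simp_all add: Jc_def vec_eq_iff algebra_simps)

lemma Jc_Jc: "Jc (Jc v) = - v"
  by (simp add: Jc_def vec_eq_iff)

text \<open>J has constant coordinates and commutes with the Christoffel symbols, so it commutes
  with the curvature; the value on holomorphic planes then fixes the whole tensor.\<close>

lemma space_form_curv:
  fixes N :: "('q::{t2_space,second_countable_topology}, complex^'m) mfd"
  assumes N: "complex_space_form N c"
  shows "ip N q (curv N q u v w) z = c * (ip N q v w * ip N q u z - ip N q u w * ip N q v z
    + ip N q (Jc v) w * ip N q (Jc u) z - ip N q (Jc u) w * ip N q (Jc v) z
    + 2 * ip N q u (Jc v) * ip N q (Jc w) z)"
proof -
  have kN: "kaehler_manifold N" and rN: "riemannian_manifold N"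
    using N unfolding complex_space_form_def kaehler_manifold_def by auto
  define C where "C = chart_at N q"
  define y where "y = coord N q"
  have C: "C \<in> atlas N" and y: "y \<in> cran C"
    using chart_at_atlas[OF rN] chart_at_mem[OF rN] by (auto simp: C_def y_def)
  interpret riem "cran C" "metric N C" by (rule riem_chart[OF rN C])
  have ipN: "ip N q = metric N C y" by (simp add: ip_def C_def y_def)
  have cN: "curv N q = rcurv (metric N C) y" by (simp add: curv_def curv_loc_rcurv C_def y_def)
  have Jg: "metric N C x (Jc u) (Jc v) = metric N C x u v"
    and J\<Gamma>: "levi (metric N C) x u (Jc v) = Jc (levi (metric N C) x u v)" if "x \<in> cran C" for x u v
    using kN C that unfolding kaehler_manifold_def christoffel_levi by auto
  have herm: "hermitian_form (ip N q) Jc"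
    unfolding ipN by (intro hermitian_form.intro hermitian_form_axioms.intro inner_form_g linear_Jc Jc_Jc Jg y)
  interpret hermitian_form "ip N q" Jc by (rule herm)
  have DJ: "Dv (\<lambda>y. levi (metric N C) y v (Jc w)) y u = Jc (Dv (\<lambda>y. levi (metric N C) y v w) y u)" for u v w
  proof -
    have "Dv (\<lambda>y. levi (metric N C) y v (Jc w)) y = Dv (\<lambda>y. Jc (levi (metric N C) y v w)) y"
      by (rule Dv_cong_open[OF open_S y J\<Gamma>])
    also have "\<dots> = (\<lambda>u. Jc (Dv (\<lambda>y. levi (metric N C) y v w) y u))"
      by (intro Dv_eq bounded_linear.has_derivative[OF linear_conv_bounded_linear[THEN iffD1, OF linear_Jc]]
          Dv_has differentiable_levi y)
    finally show ?thesis by simp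
  qed
  have RJ: "curv N q u v (Jc w) = Jc (curv N q u v w)" for u v w
    unfolding cN rcurv_def J\<Gamma>[OF y] DJ by (simp add: linear_add[OF linear_Jc] linear_diff[OF linear_Jc])
  have R: "kaehler_curvature (\<lambda>u v w z. ip N q (curv N q u v w) z) Jc"
    by (intro kaehler_curvature.intro kaehler_curvature_axioms.intro curvature_like_ip rN linear_Jc Jc_Jc)
      (simp add: RJ G_JJ)
  interpret R: kaehler_curvature "\<lambda>u v w z. ip N q (curv N q u v w) z" Jc by (rule R)
  have "ip N q (curv N q x (Jc x) (Jc x)) x = 4 * c * (ip N q x x)\<^sup>2" for x
  proof (cases "x = 0")
    case True
    then show ?thesis by (simp add: form_simps)
  next
    case False
    \<comment> \<open>The curvature of a plane is evaluated on an orthonormal pair, so x is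
      normalised and the quartic expression rescaled.\<close>
    define s where "s = 1 / sqrt (ip N q x x)"
    have pos: "ip N q x x > 0" using form_pos[OF False] .
    have s: "s * s * ip N q x x = 1" "s \<noteq> 0" using pos by (simp_all add: s_def divide_simps)
    define X where "X = s *\<^sub>R x"
    have JX: "Jc X = s *\<^sub>R Jc x" by (simp add: X_def linear_scale[OF linear_Jc])
    have X1: "ip N q X X = 1" using s by (simp add: X_def form_simps mult.assoc)
    have "X \<noteq> 0" using False s by (simp add: X_def)
    then have "sectional_curvature N q (span {X, Jc X}) = 4 * c"
      using N unfolding complex_space_form_def by blast
    then have "ip N q (curv N q X (Jc X) (Jc X)) X = 4 * c"
      using sectional_curvature_eq[OF rN X1, of "Jc X"] X1 by (simp add: G_JJ G_J_self)
    then have "(s * s) * (s * s) * ip N q (curv N q x (Jc x) (Jc x)) x = 4 * c"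
      unfolding JX by (simp add: X_def R.R_linear mult.assoc)
    also have "\<dots> = 4 * c * ((s * s * ip N q x x) * (s * s * ip N q x x))" using s by simp
    finally have "(s * s) * (s * s) * ip N q (curv N q x (Jc x) (Jc x)) x
        = (s * s) * (s * s) * (4 * c * (ip N q x x)\<^sup>2)" by (simp add: power2_eq_square algebra_simps)
    then show ?thesis using s(2) by simp
  qed
  from space_form_curvature[OF R this] show ?thesis .
qed


subsection \<open>Submanifolds in charts\<close>

context
  fixes M :: "('p::{t2_space,second_countable_topology}, 'a::euclidean_space) mfd"
    and N :: "('q::{t2_space,second_countable_topology}, 'b::euclidean_space) mfd"
    and f :: "'p \<Rightarrow> 'q"
  assumes sub: "submanifold M N f"
begin

lemma sub_riem: "riemannian_manifold M" "riemannian_manifold N"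
  using sub unfolding submanifold_def by auto

lemma submanifold_local_rep:
  assumes "C \<in> atlas M" "C' \<in> atlas N"
  shows "smooth_on (cmap C ` (cdom C \<inter> f -` cdom C')) (local_rep C C' f)"
    and "p \<in> cdom C \<inter> f -` cdom C' \<Longrightarrow> metric M C (cmap C p) u v = metric N C' (cmap C' (f p))
      (Dv (local_rep C C' f) (cmap C p) u) (Dv (local_rep C C' f) (cmap C p) v)"
proof -
  have "\<forall>C\<in>atlas M. \<forall>C'\<in>atlas N.
      smooth_on (cmap C ` (cdom C \<inter> f -` cdom C')) (local_rep C C' f) \<and>
      (\<forall>p\<in>cdom C \<inter> f -` cdom C'. inj (Dv (local_rep C C' f) (cmap C p)) \<and>
        (\<forall>u v. metric M C (cmap C p) u v = metric N C' (cmap C' (f p))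
            (Dv (local_rep C C' f) (cmap C p) u) (Dv (local_rep C C' f) (cmap C p) v)))"
    using sub unfolding submanifold_def by (elim conjE)
  then show "smooth_on (cmap C ` (cdom C \<inter> f -` cdom C')) (local_rep C C' f)"
    "p \<in> cdom C \<inter> f -` cdom C' \<Longrightarrow> metric M C (cmap C p) u v = metric N C' (cmap C' (f p))
      (Dv (local_rep C C' f) (cmap C p) u) (Dv (local_rep C C' f) (cmap C p) v)"
    using assms by blast+
qed

lemma local_rep_isometric:
  assumes C: "C \<in> atlas M" "C' \<in> atlas N"
  shows "isometric_map (cran C) (metric M C) (cran C') (metric N C')
    (cmap C ` (cdom C \<inter> f -` cdom C')) (local_rep C C' f)"
proof -
  note ch = atlas_chart[OF sub_riem(1) C(1)] atlas_chart[OF sub_riem(2) C(2)]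
  have "smooth_on (cmap C ` (cdom C \<inter> f -` cdom C')) (local_rep C C' f)"
    by (rule submanifold_local_rep(1)[OF C])
  moreover have "metric M C x u v = metric N C' (local_rep C C' f x) (Dv (local_rep C C' f) x u) (Dv (local_rep C C' f) x v)"
    if x: "x \<in> cmap C ` (cdom C \<inter> f -` cdom C')" for x u v
  proof -
    obtain p where p: "p \<in> cdom C \<inter> f -` cdom C'" "x = cmap C p" using x by blast
    then have "local_rep C C' f x = cmap C' (f p)" using cinv_cmap[OF ch(1)] by (simp add: local_rep_def)
    then show ?thesis using submanifold_local_rep(2)[OF C p(1)] by (simp only: p(2))
  qed
  moreover have "open (cdom C \<inter> f -` cdom C')"
  proof -
    have "continuous_on UNIV f" using sub unfolding submanifold_def by blast
    then show ?thesis using ch unfolding is_chart_def by (auto intro: open_vimage)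
  qed
  then have "open (cmap C ` (cdom C \<inter> f -` cdom C'))" by (rule open_chart_image[OF ch(1)]) auto
  moreover have "local_rep C C' f ` (cmap C ` (cdom C \<inter> f -` cdom C')) \<subseteq> cran C'"
    using cinv_cmap[OF ch(1)] by (auto simp: local_rep_def)
  ultimately show ?thesis
    unfolding isometric_map_def isometric_map_axioms_def
    using riem_chart[OF sub_riem(1) C(1)] riem_chart[OF sub_riem(2) C(2)] by (simp add: image_mono)
qed

lemma coord_mem: "coord M p \<in> cmap (chart_at M p) ` (cdom (chart_at M p) \<inter> f -` cdom (chart_at N (f p)))"
  using chart_at_mem[OF sub_riem(1)] chart_at_mem[OF sub_riem(2)] by auto

lemma map_at_coord: "map_at M N f p (coord M p) = coord N (f p)"
  using cinv_cmap[OF atlas_chart[OF sub_riem(1) chart_at_atlas[OF sub_riem(1)]] chart_at_mem[OF sub_riem(1)]]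
  by (simp add: local_rep_def)

lemma map_at_isometric:
  "isometric_map (cran (chart_at M p)) (metric M (chart_at M p)) (cran (chart_at N (f p)))
    (metric N (chart_at N (f p))) (cmap (chart_at M p) ` (cdom (chart_at M p) \<inter> f -` cdom (chart_at N (f p))))
    (map_at M N f p)"
  by (rule local_rep_isometric[OF chart_at_atlas[OF sub_riem(1)] chart_at_atlas[OF sub_riem(2)]])

lemma sff_sform: "sff M N f p = sform (metric M (chart_at M p)) (metric N (chart_at N (f p))) (map_at M N f p) (coord M p)"
  unfolding sff_def sform_def differential_def christoffel_levi map_at_coord by (intro ext) simp

lemma ip_at: "ip M p = metric M (chart_at M p) (coord M p)"
  "ip N (f p) = metric N (chart_at N (f p)) (map_at M N f p (coord M p))"
  by (simp_all add: ip_def map_at_coord)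

lemma second_form_at:
  assumes "DIM('a) = 2 * k" "k \<ge> 2"
  shows "second_form (ip M p) (ip N (f p)) (differential M N f p) (sff M N f p) k"
proof -
  interpret isometric_map "cran (chart_at M p)" "metric M (chart_at M p)" "cran (chart_at N (f p))"
    "metric N (chart_at N (f p))" "cmap (chart_at M p) ` (cdom (chart_at M p) \<inter> f -` cdom (chart_at N (f p)))"
    "map_at M N f p" by (rule map_at_isometric)
  note x = coord_mem[of p]
  show ?thesis
  proof (intro second_form.intro second_form_axioms.intro inner_form_ip sub_riem assms)
    show "linear (differential M N f p)" using DF_linear[OF x] by (simp add: differential_def)
    show "ip M p u v = ip N (f p) (differential M N f p u) (differential M N f p v)" for u v
      unfolding ip_at differential_def by (rule isometric[OF x])
    show "bilinear (sff M N f p)" unfolding sff_sform by (rule sform_bilinear[OF x])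
    show "sff M N f p u v = sff M N f p v u" for u v unfolding sff_sform by (rule sform_sym[OF x])
    show "ip N (f p) (sff M N f p u v) (differential M N f p w) = 0" for u v w
      unfolding sff_sform ip_at differential_def by (rule sform_normal[OF x])
  qed
qed

lemma gauss_at:
  "ip N (f p) (curv N (f p) (differential M N f p u) (differential M N f p v) (differential M N f p w))
      (differential M N f p z) =
    ip M p (curv M p u v w) z - ip N (f p) (sff M N f p v w) (sff M N f p u z)
    + ip N (f p) (sff M N f p u w) (sff M N f p v z)"
  using isometric_map.gauss_equation[OF map_at_isometric coord_mem]
  unfolding curv_def curv_loc_rcurv sff_sform ip_at differential_def map_at_coord .

text \<open>\<open>sff\<close> at q lives in the charts chosen at q, while differentiation needs
  fixed charts C and C'. The differentials of the transitions carry one to the other and preserve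
  inner products.\<close>

lemma sff_transition:
  assumes C: "C \<in> atlas M" "C' \<in> atlas N" and q: "q \<in> cdom C" "f q \<in> cdom C'"
  defines "\<phi> \<equiv> transition (chart_at M q) C" and "\<psi> \<equiv> transition (chart_at N (f q)) C'"
  shows "sform (metric M C) (metric N C') (local_rep C C' f) (cmap C q) (Dv \<phi> (coord M q) u) (Dv \<phi> (coord M q) v)
      = Dv \<psi> (coord N (f q)) (sff M N f q u v)"
    and "metric M C (cmap C q) (Dv \<phi> (coord M q) u) (Dv \<phi> (coord M q) v) = ip M q u v"
    and "metric N C' (local_rep C C' f (cmap C q)) (Dv \<psi> (coord N (f q)) a) (Dv \<psi> (coord N (f q)) b) = ip N (f q) a b"
    and "surj (Dv \<phi> (coord M q))" and "linear (Dv \<psi> (coord N (f q)))"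
proof -
  note rM = sub_riem(1) and rN = sub_riem(2)
  let ?C = "chart_at M q" and ?C' = "chart_at N (f q)"
  note CM = chart_at_atlas[OF rM, of q] and CN = chart_at_atlas[OF rN, of "f q"]
  note inv = cinv_cmap[OF atlas_chart[OF rM CM]] cinv_cmap[OF atlas_chart[OF rM C(1)]]
    cinv_cmap[OF atlas_chart[OF rN CN]]
  interpret \<phi>: local_isometry "cran ?C" "metric M ?C" "cran C" "metric M C" "cmap ?C ` (cdom ?C \<inter> cdom C)" \<phi>
    unfolding \<phi>_def by (rule transition_isometry[OF rM CM C(1)])
  interpret \<psi>: local_isometry "cran ?C'" "metric N ?C'" "cran C'" "metric N C'" "cmap ?C' ` (cdom ?C' \<inter> cdom C')" \<psi>
    unfolding \<psi>_def by (rule transition_isometry[OF rN CN C(2)])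
  have qm: "q \<in> cdom ?C" "f q \<in> cdom ?C'" using chart_at_mem[OF rM] chart_at_mem[OF rN] by auto
  have x: "coord M q \<in> cmap ?C ` (cdom ?C \<inter> cdom C)" and z: "coord N (f q) \<in> cmap ?C' ` (cdom ?C' \<inter> cdom C')"
    using qm q by auto
  have \<phi>x: "\<phi> (coord M q) = cmap C q" and \<psi>z: "\<psi> (coord N (f q)) = cmap C' (f q)"
    using inv qm by (auto simp: \<phi>_def \<psi>_def transition_def)
  have Fq: "local_rep C C' f (cmap C q) = cmap C' (f q)" using inv q by (simp add: local_rep_def)
  show "metric M C (cmap C q) (Dv \<phi> (coord M q) u) (Dv \<phi> (coord M q) v) = ip M q u v"
    using \<phi>.isometric[OF x] by (simp add: \<phi>x ip_def)
  show "metric N C' (local_rep C C' f (cmap C q)) (Dv \<psi> (coord N (f q)) a) (Dv \<psi> (coord N (f q)) b) = ip N (f q) a b"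
    using \<psi>.isometric[OF z] by (simp add: \<psi>z Fq ip_def)
  show "surj (Dv \<phi> (coord M q))" by (rule \<phi>.DF_surj[OF x])
  show "linear (Dv \<psi> (coord N (f q)))" by (rule \<psi>.DF_linear[OF z])
  \<comment> \<open>The points common to both charts of M that f maps into both charts of N; there
    both composites make sense and agree.\<close>
  define W where "W = cdom ?C \<inter> cdom C \<inter> (f -` cdom ?C' \<inter> f -` cdom C')"
  have cf: "continuous_on UNIV f" using sub unfolding submanifold_def by blast
  have "open W"
    using atlas_chart[OF rM CM] atlas_chart[OF rM C(1)] atlas_chart[OF rN CN] atlas_chart[OF rN C(2)] cf
    unfolding W_def is_chart_def by (auto intro!: open_Int open_vimage)
  then have oU: "open (cmap ?C ` W)" by (rule open_chart_image[OF atlas_chart[OF rM CM]]) (auto simp: W_def)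
  have qW: "q \<in> W" using qm q by (auto simp: W_def)
  have "sform (metric M C) (metric N C') (local_rep C C' f) (\<phi> (coord M q)) (Dv \<phi> (coord M q) u) (Dv \<phi> (coord M q) v)
      = Dv \<psi> (map_at M N f q (coord M q)) (sform (metric M ?C) (metric N ?C') (map_at M N f q) (coord M q) u v)"
  proof (rule sform_transition)
    show "local_isometry (cran ?C) (metric M ?C) (cran C) (metric M C) (cmap ?C ` W) \<phi>"
      unfolding local_isometry_def
      by (rule isometric_map_subset[OF \<phi>.isometric_map_axioms oU]) (auto simp: W_def)
    show "local_isometry (cran ?C') (metric N ?C') (cran C') (metric N C') (cmap ?C' ` (cdom ?C' \<inter> cdom C')) \<psi>"
      by (rule \<psi>.local_isometry_axioms)
    show "isometric_map (cran ?C) (metric M ?C) (cran ?C') (metric N ?C') (cmap ?C ` W) (map_at M N f q)"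
      by (rule isometric_map_subset[OF map_at_isometric oU]) (auto simp: W_def)
    show "isometric_map (cran C) (metric M C) (cran C') (metric N C') (cmap C ` (cdom C \<inter> f -` cdom C')) (local_rep C C' f)"
      by (rule local_rep_isometric[OF C])
    show "coord M q \<in> cmap ?C ` W" using qW by blast
    show "map_at M N f q ` (cmap ?C ` W) \<subseteq> cmap ?C' ` (cdom ?C' \<inter> cdom C')"
      using inv by (auto simp: local_rep_def W_def)
    show "\<phi> ` (cmap ?C ` W) \<subseteq> cmap C ` (cdom C \<inter> f -` cdom C')"
      using inv by (auto simp: \<phi>_def transition_def W_def)
    show "local_rep C C' f (\<phi> y) = \<psi> (map_at M N f q y)" if "y \<in> cmap ?C ` W" for y
      using that inv by (auto simp: \<phi>_def \<psi>_def transition_def local_rep_def W_def)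
  qed
  then show "sform (metric M C) (metric N C') (local_rep C C' f) (cmap C q) (Dv \<phi> (coord M q) u) (Dv \<phi> (coord M q) v)
      = Dv \<psi> (coord N (f q)) (sff M N f q u v)"
    by (simp only: \<phi>x map_at_coord sff_sform)
qed

end


subsection \<open>Einstein totally real submanifolds\<close>

lemma span_pair: "x \<in> span {u, v} \<Longrightarrow> \<exists>a b. x = a *\<^sub>R u + b *\<^sub>R v"
  unfolding span_insert span_empty by (auto simp: algebra_simps)

locale einstein_totally_real =
  fixes k :: nat and c :: real
    and M :: "('p::{t2_space,second_countable_topology}, 'a::euclidean_space) mfd"
    and N :: "('q::{t2_space,second_countable_topology}, complex^'m) mfd"
    and f :: "'p \<Rightarrow> 'q"
  assumes k_ge_2: "k \<ge> 2" and dim_a: "DIM('a) = 2 * k"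
    and space_form: "complex_space_form N c"
    and sub: "submanifold M N f" and real: "totally_real M N f" and einstein: "einstein M"
begin

lemma riem_M: "riemannian_manifold M" and riem_N: "riemannian_manifold N"
  using sub_riem[OF sub] by auto

sublocale pt: second_form "ip M p" "ip N (f p)" "differential M N f p" "sff M N f p" c k for p
  by (rule second_form_at[OF sub dim_a k_ge_2])

lemma J_orthogonal: "ip N (f p) (Jc (differential M N f p u)) (differential M N f p v) = 0"
  using real unfolding totally_real_def normal_space_def by blast

lemma J_orthogonal': "ip N (f p) (differential M N f p u) (Jc (differential M N f p v)) = 0"
  using J_orthogonal pt.tgt.form_sym by metis

text \<open>Each J-term of the ambient curvature here pairs J of a tangent vector with a tangent
  vector, hence vanishes.\<close>

lemma curv_gauss: "ip M p (curv M p u v v) u = pt.gauss p u v"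
  using gauss_at[OF sub, of p u v v u] pt.h_sym[of p v u]
  unfolding space_form_curv[OF space_form] J_orthogonal J_orthogonal' pt.d_iso[symmetric] pt.gauss_def
  by (simp add: pt.src.form_sym[of p v u] pt.tgt.form_sym[of p "sff M N f p v v"] power2_eq_square algebra_simps)

lemma sectional_gauss:
  assumes "ip M p u u = 1" "ip M p v v = 1" "ip M p u v = 0"
  shows "sectional_curvature M p (span {u, v}) = pt.gauss p u v"
  using sectional_curvature_eq[OF riem_M assms] by (simp add: curv_gauss)

lemma Ric_gauss:
  assumes X: "ip M p X X = 1" and e: "pt.frame p e"
  shows "Ric M p X = (\<Sum>a=1..2*k. pt.gauss p X (e a))"
proof -
  have val: "(\<Sum>j=2..DIM('a). sectional_curvature M p (span {X, e' j})) = (\<Sum>a=1..2*k. pt.gauss p X (e a))"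
    if e': "orthonormal_on M p {1..DIM('a)} e'" "e' 1 = X" for e'
  proof -
    have fr: "pt.frame p e'" using e' by (simp add: orthonormal_on_wrt dim_a)
    have "(\<Sum>j=2..DIM('a). sectional_curvature M p (span {X, e' j})) = (\<Sum>j=2..2*k. pt.gauss p X (e' j))"
    proof (intro sum.cong)
      fix j assume j: "j \<in> {2..2*k}"
      show "sectional_curvature M p (span {X, e' j}) = pt.gauss p X (e' j)"
        using orthonormal_wrtD[OF fr, of j j] orthonormal_wrtD[OF fr, of 1 j] j X e'(2)
        by (intro sectional_gauss) auto
    qed (simp add: dim_a)
    \<comment> \<open>The sum may start at 1: the added term is the Gauss expression of X with
      itself, which is 0.\<close>
    also have "\<dots> = (\<Sum>j=1..2*k. pt.gauss p X (e' j))"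
    proof -
      have "{1..2*k} = insert 1 {2..2*k}" using k_ge_2 by auto
      then have "(\<Sum>j=1..2*k. pt.gauss p X (e' j)) = pt.gauss p X (e' 1) + (\<Sum>j=2..2*k. pt.gauss p X (e' j))"
        by (simp only:) (subst sum.insert, auto)
      then show ?thesis unfolding e'(2) pt.gauss_self by simp
    qed
    also have "\<dots> = (\<Sum>a=1..2*k. pt.gauss p X (e a))" by (rule pt.ricci_frame_independent[OF fr e])
    finally show ?thesis .
  qed
  have "orthonormal_wrt (ip M p) {1..1} (\<lambda>_. X)" using X by (auto simp: orthonormal_wrt_def)
  moreover have "1 \<le> DIM('a)" using k_ge_2 dim_a by simp
  ultimately obtain e' where "orthonormal_wrt (ip M p) {1..DIM('a)} e'" "\<And>i. i \<in> {1..1} \<Longrightarrow> e' i = X"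
    by (rule pt.src.orthonormal_extend_UNIV) blast
  then have e': "orthonormal_on M p {1..DIM('a)} e'" "e' 1 = X" by (simp_all add: orthonormal_on_wrt)
  show ?thesis unfolding Ric_def
  proof (rule some_equality)
    show "\<exists>e'. orthonormal_on M p {1..DIM('a)} e' \<and> e' 1 = X \<and> (\<Sum>a=1..2*k. pt.gauss p X (e a))
        = (\<Sum>j=2..DIM('a). sectional_curvature M p (span {X, e' j}))"
      using e' val[OF e'] by (intro exI[of _ e']) (simp only: simp_thms)
  next
    fix \<rho> assume "\<exists>e'. orthonormal_on M p {1..DIM('a)} e' \<and> e' 1 = X \<and>
        \<rho> = (\<Sum>j=2..DIM('a). sectional_curvature M p (span {X, e' j}))"
    then show "\<rho> = (\<Sum>a=1..2*k. pt.gauss p X (e a))" using val by (elim exE conjE) (simp only:)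
  qed
qed

lemma einstein_constant: "\<exists>\<rho>. \<forall>X. ip M p X X = 1 \<longrightarrow> Ric M p X = \<rho>"
  using einstein unfolding einstein_def by blast

section \<open>Orthogonal planes and frames\<close>

lemma frame_of_planes:
  assumes \<pi>: "orthogonal_planes M p k \<pi>"
  shows "\<exists>e. pt.frame p e \<and> (\<forall>i\<in>{1..k}. \<pi> i = span {e (2*i-1), e (2*i)})"
proof -
  have "\<exists>b. orthonormal_wrt (ip M p) {1..2} b \<and> (\<forall>j\<in>{1..2}. b j \<in> \<pi> i)" if "i \<in> {1..k}" for i
    using pt.src.orthonormal_basis_exists[of "\<pi> i" p] \<pi> that unfolding orthogonal_planes_def by metis
  then obtain b where b: "\<And>i. i \<in> {1..k} \<Longrightarrow> orthonormal_wrt (ip M p) {1..2} (b i)"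
    "\<And>i j. i \<in> {1..k} \<Longrightarrow> j \<in> {1..2} \<Longrightarrow> b i j \<in> \<pi> i"
    by metis
  \<comment> \<open>The basis of the i-th plane occupies the indices 2i - 1 and 2i; the k planes
    fill all 2k dimensions.\<close>
  define e where "e a = b ((a + 1) div 2) (if odd a then 1 else 2)" for a
  have "pt.frame p e" unfolding orthonormal_wrt_def
  proof (intro ballI)
    fix x y assume xy: "x \<in> {1..2*k}" "y \<in> {1..2*k}"
    then have i: "(x + 1) div 2 \<in> {1..k}" "(y + 1) div 2 \<in> {1..k}" by auto
    show "ip M p (e x) (e y) = (if x = y then 1 else 0)"
    proof (cases "(x + 1) div 2 = (y + 1) div 2")
      case True
      have "(if odd x then 1 else 2) = (if odd y then 1 else (2::nat)) \<longleftrightarrow> x = y" using True by presburger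
      then show ?thesis
        using orthonormal_wrtD[OF b(1)[OF i(1)], of "if odd x then 1 else 2" "if odd y then 1 else 2"] True
        by (simp add: e_def)
    next
      case False
      have "e x \<in> \<pi> ((x + 1) div 2)" "e y \<in> \<pi> ((y + 1) div 2)" using b(2) i by (auto simp: e_def)
      then have "ip M p (e x) (e y) = 0" using \<pi> i False unfolding orthogonal_planes_def by blast
      then show ?thesis using False by auto
    qed
  qed
  moreover have "\<pi> i = span {e (2*i-1), e (2*i)}" if i: "i \<in> {1..k}" for i
  proof -
    have e2: "e (2*i-1) = b i 1" "e (2*i) = b i 2" using i by (auto simp: e_def)
    have im: "b i ` {1..2} = {b i 1, b i 2}"
      by (auto simp: numeral_2_eq_2 atLeastAtMostSuc_conv)
    have S: "subspace (\<pi> i)" "dim (\<pi> i) = 2" using \<pi> i unfolding orthogonal_planes_def by auto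
    have "span {b i 1, b i 2} \<subseteq> \<pi> i" using b(2)[OF i] S by (intro span_minimal) auto
    moreover have "\<pi> i \<subseteq> span {b i 1, b i 2}"
      using pt.src.orthonormal_independent[OF b(1)[OF i]] S b(2)[OF i]
      unfolding im[symmetric] by (intro card_ge_dim_independent) (auto simp: card_image)
    ultimately have "\<pi> i = span {b i 1, b i 2}" by blast
    then show ?thesis unfolding e2 .
  qed
  ultimately show ?thesis by blast
qed

lemma planes_of_frame:
  assumes e: "pt.frame p e"
  shows "orthogonal_planes M p k (\<lambda>i. span {e (2*i-1), e (2*i)})"
  unfolding orthogonal_planes_def
proof (intro conjI ballI impI)
  fix i assume i: "i \<in> {1..k}"
  then have idx: "2*i-1 \<in> {1..2*k}" "2*i \<in> {1..2*k}" "2*i-1 \<noteq> 2*i" by auto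
  have "orthonormal_wrt (ip M p) {2*i-1, 2*i} e"
    using e idx unfolding orthonormal_wrt_def by blast
  from pt.src.orthonormal_independent[OF this]
  show "dim (span {e (2*i-1), e (2*i)}) = 2"
    using idx(3) by (simp add: dim_span dim_eq_card_independent card_image inj_on_def)
next
  fix i j x y assume ij: "i \<in> {1..k}" "j \<in> {1..k}" "i \<noteq> j"
    and "x \<in> span {e (2*i-1), e (2*i)}" "y \<in> span {e (2*j-1), e (2*j)}"
  then obtain a b a' b' where "x = a *\<^sub>R e (2*i-1) + b *\<^sub>R e (2*i)" "y = a' *\<^sub>R e (2*j-1) + b' *\<^sub>R e (2*j)"
    using span_pair by meson
  moreover have "1 \<le> i" "i \<le> k" "1 \<le> j" "j \<le> k" using ij by auto
  then have "2*i-1 \<in> {1..2*k}" "2*i \<in> {1..2*k}" "2*j-1 \<in> {1..2*k}" "2*j \<in> {1..2*k}"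
    "2*i-1 \<noteq> 2*j-1" "2*i-1 \<noteq> 2*j" "2*i \<noteq> 2*j-1" "2*i \<noteq> 2*j"
    using ij(3) unfolding atLeastAtMost_iff by presburger+
  ultimately show "ip M p x y = 0"
    using orthonormal_wrtD[OF e] by (simp add: pt.src.form_simps)
qed (rule subspace_span)

lemma plane_sum:
  assumes e: "pt.frame p e" and \<pi>: "\<And>i. i \<in> {1..k} \<Longrightarrow> \<pi> i = span {e (2*i-1), e (2*i)}"
  shows "(\<Sum>i=1..k. sectional_curvature M p (\<pi> i)) = (\<Sum>i=1..k. pt.gauss p (e (2*i-1)) (e (2*i)))"
proof (rule sum.cong[OF refl])
  fix i assume i: "i \<in> {1..k}"
  then have idx: "2*i-1 \<in> {1..2*k}" "2*i \<in> {1..2*k}" "2*i-1 \<noteq> 2*i" by auto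
  show "sectional_curvature M p (\<pi> i) = pt.gauss p (e (2*i-1)) (e (2*i))"
    unfolding \<pi>[OF i] using orthonormal_wrtD[OF e] idx by (intro sectional_gauss) auto
qed

text \<open>By \<open>scalar_identity\<close> the mean of the plane curvatures of a frame is an
  affine function of its defect with positive slope, so \<open>K_inf\<close> is attained at a frame
  of least defect.\<close>

lemma delta_defect:
  "\<exists>e. pt.frame p e \<and> (\<forall>e'. pt.frame p e' \<longrightarrow> pt.defect p e \<le> pt.defect p e') \<and>
    delta_Ric M k p = 2 * (real k - 1) * (c + ip N (f p) (pt.H p) (pt.H p)) - pt.defect p e / (2 * real k)"
proof -
  obtain \<rho> where \<rho>: "\<And>X. ip M p X X = 1 \<Longrightarrow> Ric M p X = \<rho>" using einstein_constant by blast
  obtain e where e: "pt.frame p e" and min: "\<And>e'. pt.frame p e' \<Longrightarrow> pt.defect p e \<le> pt.defect p e'"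
    using pt.frame_min_defect[of p] by blast
  let ?B = "2 * (real k - 1) * (c + ip N (f p) (pt.H p) (pt.H p))"
  have k0: "real k > 0" using k_ge_2 by simp
  have plane: "(\<Sum>i=1..k. pt.gauss p (e' (2*i-1)) (e' (2*i))) / real k = \<rho> - ?B + pt.defect p e' / (2 * real k)"
    if e': "pt.frame p e'" for e'
  proof -
    have "(\<Sum>a=1..2*k. \<Sum>b=1..2*k. pt.gauss p (e' a) (e' b)) = (\<Sum>a=1..2*k. \<rho>)"
    proof (rule sum.cong[OF refl])
      fix a assume "a \<in> {1..2*k}"
      then have "ip M p (e' a) (e' a) = 1" using orthonormal_wrtD[OF e'] by simp
      then show "(\<Sum>b=1..2*k. pt.gauss p (e' a) (e' b)) = \<rho>" using Ric_gauss[OF _ e'] \<rho> by simp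
    qed
    then have "2 * real k * \<rho> = 2 * (\<Sum>i=1..k. pt.gauss p (e' (2*i-1)) (e' (2*i)))
      + 4 * real k * (real k - 1) * (c + ip N (f p) (pt.H p) (pt.H p)) - pt.defect p e'"
      unfolding pt.scalar_identity[OF e'] by simp
    then show ?thesis using k0 by (simp add: field_simps)
  qed
  let ?P = "{\<pi>. orthogonal_planes M p k \<pi>}"
  have "K_inf M k p = \<rho> - ?B + pt.defect p e / (2 * real k)"
    unfolding K_inf_def
  proof (rule cInf_eq_minimum)
    show "\<rho> - ?B + pt.defect p e / (2 * real k) \<in> (\<lambda>\<pi>. (\<Sum>i=1..k. sectional_curvature M p (\<pi> i)) / real k) ` ?P"
      using planes_of_frame[OF e] plane_sum[OF e, of "\<lambda>i. span {e (2*i-1), e (2*i)}"] plane[OF e]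
      by (intro image_eqI[of _ _ "\<lambda>i. span {e (2*i-1), e (2*i)}"]) auto
  next
    fix x assume "x \<in> (\<lambda>\<pi>. (\<Sum>i=1..k. sectional_curvature M p (\<pi> i)) / real k) ` ?P"
    then obtain \<pi> where \<pi>: "orthogonal_planes M p k \<pi>" "x = (\<Sum>i=1..k. sectional_curvature M p (\<pi> i)) / real k"
      by blast
    obtain e' where e': "pt.frame p e'" "\<And>i. i \<in> {1..k} \<Longrightarrow> \<pi> i = span {e' (2*i-1), e' (2*i)}"
      using frame_of_planes[OF \<pi>(1)] by blast
    have "x = \<rho> - ?B + pt.defect p e' / (2 * real k)"
      using \<pi>(2) plane_sum[OF e'] plane[OF e'(1)] by simp
    then show "\<rho> - ?B + pt.defect p e / (2 * real k) \<le> x"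
      using min[OF e'(1)] k0 by (simp add: divide_right_mono)
  qed
  \<comment> \<open>A frame vector shows that the unit sphere is nonempty, so the supremum of the
    constant Ric is its value.\<close>
  moreover have "(SUP X\<in>{X. ip M p X X = 1}. Ric M p X) = \<rho>"
  proof -
    have "1 \<in> {1..2*k}" using k_ge_2 by simp
    then have "e 1 \<in> {X. ip M p X X = 1}" using orthonormal_wrtD[OF e] by simp
    then have "(\<lambda>X. Ric M p X) ` {X. ip M p X X = 1} = {\<rho>}" using \<rho> by blast
    then show ?thesis by simp
  qed
  moreover have "2 * real k / real DIM('a) = 1" using k0 by (simp add: dim_a)
  ultimately have "delta_Ric M k p = ?B - pt.defect p e / (2 * real k)"
    unfolding delta_Ric_def by (simp only:) simp
  then show ?thesis using e min by blast
qed

lemma mean_curvature_vector_H: "mean_curvature_vector M N f p = pt.H p"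
  unfolding mean_curvature_vector_def
proof (rule some_equality)
  have k0: "real k \<noteq> 0" using k_ge_2 by simp
  have v: "(1 / real DIM('a)) *\<^sub>R (\<Sum>i=1..DIM('a). sff M N f p (e i) (e i)) = pt.H p"
    if "pt.frame p e" for e
    using pt.sum_h[OF that] k0 by (simp add: dim_a)
  show "\<exists>e. orthonormal_on M p {1..DIM('a)} e \<and>
      pt.H p = (1 / real DIM('a)) *\<^sub>R (\<Sum>i=1..DIM('a). sff M N f p (e i) (e i))"
  proof -
    obtain e where e: "pt.frame p e" using pt.frame_exists[of p] by blast
    then have "orthonormal_on M p {1..DIM('a)} e" unfolding orthonormal_on_wrt dim_a .
    then show ?thesis using v[OF e, symmetric] by blast
  qed
  show "\<eta> = pt.H p" if \<eta>: "\<exists>e. orthonormal_on M p {1..DIM('a)} e \<and>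
      \<eta> = (1 / real DIM('a)) *\<^sub>R (\<Sum>i=1..DIM('a). sff M N f p (e i) (e i))" for \<eta>
  proof -
    obtain e where e: "orthonormal_on M p {1..DIM('a)} e"
      "\<eta> = (1 / real DIM('a)) *\<^sub>R (\<Sum>i=1..DIM('a). sff M N f p (e i) (e i))" using \<eta> by blast
    from e(1) have "pt.frame p e" unfolding orthonormal_on_wrt dim_a .
    then show ?thesis using v e(2) by simp
  qed
qed

lemma mean_curvature_square: "(mean_curvature M N f p)\<^sup>2 = ip N (f p) (pt.H p) (pt.H p)"
  unfolding mean_curvature_def mean_curvature_vector_H using pt.tgt.form_nonneg by simp

lemma delta_le: "delta_Ric M k p \<le> 2 * (real k - 1) * (c + (mean_curvature M N f p)\<^sup>2)"
proof -
  obtain e where "delta_Ric M k p = 2 * (real k - 1) * (c + ip N (f p) (pt.H p) (pt.H p)) - pt.defect p e / (2 * real k)"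
    using delta_defect by blast
  moreover have "pt.defect p e / (2 * real k) \<ge> 0" using pt.defect_nonneg by simp
  ultimately show ?thesis by (simp add: mean_curvature_square)
qed

text \<open>Defects are nonnegative, so the least one is 0 exactly if some frame has defect
  0.\<close>

lemma delta_eq_iff: "delta_Ric M k p = 2 * (real k - 1) * (c + (mean_curvature M N f p)\<^sup>2)
    \<longleftrightarrow> (\<exists>e. pt.frame p e \<and> pt.good p e)"
proof -
  obtain e where e: "pt.frame p e" "\<And>e'. pt.frame p e' \<Longrightarrow> pt.defect p e \<le> pt.defect p e'"
    "delta_Ric M k p = 2 * (real k - 1) * (c + ip N (f p) (pt.H p) (pt.H p)) - pt.defect p e / (2 * real k)"
    using delta_defect by blast
  have "delta_Ric M k p = 2 * (real k - 1) * (c + (mean_curvature M N f p)\<^sup>2) \<longleftrightarrow> pt.defect p e = 0"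
    using e(3) k_ge_2 by (simp add: mean_curvature_square)
  also have "\<dots> \<longleftrightarrow> (\<exists>e. pt.frame p e \<and> pt.good p e)"
    unfolding pt.defect_zero_iff[symmetric] using e(1,2) pt.defect_nonneg by (metis order_antisym)
  finally show ?thesis .
qed

lemma umbilical_if_good:
  assumes "pt.frame p e" "pt.good p e"
  shows "ip N (f p) (sff M N f p u v) (pt.H p) = ip N (f p) (pt.H p) (pt.H p) * ip M p u v"
proof -
  obtain \<rho> where "\<And>X. ip M p X X = 1 \<Longrightarrow> Ric M p X = \<rho>" using einstein_constant by blast
  then show ?thesis using Ric_gauss[OF _ assms(1)] by (intro pt.good_umbilical[OF assms]) auto
qed

lemma shape_operator_eq: "ip M p (shape_operator M N f p \<xi> X) Y = ip N (f p) (sff M N f p X Y) \<xi>"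
proof -
  have "linear (\<lambda>Y. ip N (f p) (sff M N f p X Y) \<xi>)"
    by (rule linearI) (simp_all add: pt.h_simps pt.tgt.form_simps)
  from theI'[OF pt.src.form_represents[OF this]] show ?thesis unfolding shape_operator_def by blast
qed

lemma pseudo_umbilical_iff: "pseudo_umbilical M N f \<longleftrightarrow> (\<forall>p. pt.H p \<noteq> 0 \<and>
    (\<exists>\<mu>. \<forall>u v. ip N (f p) (sff M N f p u v) (pt.H p) = \<mu> * ip M p u v))"
proof -
  have "(\<forall>X. shape_operator M N f p (pt.H p) X = \<mu> *\<^sub>R X) \<longleftrightarrow>
      (\<forall>u v. ip N (f p) (sff M N f p u v) (pt.H p) = \<mu> * ip M p u v)" for p \<mu>
    unfolding shape_operator_eq[symmetric]
    by (auto simp: pt.src.form_simps intro!: pt.src.form_ext[of p])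
  then show ?thesis unfolding pseudo_umbilical_def mean_curvature_vector_H by simp
qed

lemma adapted_frame_iff: "adapted_frame M N f p e \<xi> \<longleftrightarrow> pt.frame p e \<and> pt.adapted p \<xi>"
  unfolding adapted_frame_def pt.adapted_def orthonormal_on_wrt normal_space_def dim_a by simp

lemma traceless_iff:
  "pt.frame p e \<Longrightarrow> traceless_blocks k e (shape_operator M N f p \<xi>) \<longleftrightarrow> pt.traceless_along p e \<xi>"
  by (rule pt.traceless_blocks_iff[OF _ shape_operator_eq])


subsection \<open>Constancy of the mean curvature\<close>

text \<open>Take \<open>e\<^sub>a\<close> in one block and \<open>v\<close> in another one. Codazzi's equation along \<open>H\<close> for
  \<open>e\<^sub>a, v, v\<close> reads \<open>d\<bar>H\<bar>\<^sup>2(e\<^sub>a) = \<langle>h(v,v), \<nabla>\<^bsub>e\<^sub>a\<^esub> H\<rangle>\<close> since \<open>h(e\<^sub>a,v) = 0\<close>; summing over the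
  block of \<open>v\<close>, whose trace is \<open>2H\<close>, gives \<open>2 d\<bar>H\<bar>\<^sup>2(e\<^sub>a) = d\<bar>H\<bar>\<^sup>2(e\<^sub>a)\<close>.\<close>

lemma mean_curvature_critical:
  assumes all: "\<And>p. \<exists>e. pt.frame p e \<and> pt.good p e"
  shows "((\<lambda>y. ip N (f (cinv (chart_at M p) y)) (pt.H (cinv (chart_at M p) y)) (pt.H (cinv (chart_at M p) y)))
    has_derivative (\<lambda>_. 0)) (at (coord M p))"
proof -
  define C C' F x where "C = chart_at M p" and "C' = chart_at N (f p)"
    and "F = local_rep C C' f" and "x = coord M p"
  define g g' U where "g = metric M C" and "g' = metric N C'" and "U = cmap C ` (cdom C \<inter> f -` cdom C')"
  have CM: "C \<in> atlas M" and CN: "C' \<in> atlas N"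
    using chart_at_atlas[OF riem_M] chart_at_atlas[OF riem_N] by (auto simp: C_def C'_def)
  have x: "x \<in> U" using coord_mem[OF sub] by (simp add: x_def U_def C_def C'_def)
  interpret I: isometric_map "cran C" g "cran C'" g' U F
    unfolding g_def g'_def U_def F_def by (rule local_rep_isometric[OF sub CM CN])
  have gx: "ip M p = g x" and g'x: "ip N (f p) = g' (F x)"
    using ip_at[OF sub] by (simp_all add: g_def g'_def F_def C_def C'_def x_def)
  have hx: "sff M N f p = sform g g' F x"
    using sff_sform[OF sub] by (simp add: g_def g'_def F_def C_def C'_def x_def)
  have dx: "differential M N f p = Dv F x" by (simp add: differential_def F_def C_def C'_def x_def)
  have k0: "real k \<noteq> 0" using k_ge_2 by simp
  define dual where "dual y b = (THE w. \<forall>z. g y w z = b \<bullet> z)" for y b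
  have dual: "g y (dual y b) z = b \<bullet> z" if "y \<in> cran C" for y b z
  proof -
    have "linear (\<lambda>z. b \<bullet> z)" by (simp add: linearI inner_add_right)
    from theI'[OF inner_form.form_represents[OF I.src.inner_form_g[OF that] this]]
    show ?thesis unfolding dual_def by blast
  qed
  \<comment> \<open>The mean curvature vector in the fixed charts C and C', as a trace against the
    dual basis so that it is visibly differentiable.\<close>
  define \<eta> where "\<eta> y = (1 / (2 * real k)) *\<^sub>R (\<Sum>b\<in>Basis. sform g g' F y b (dual y b))" for y
  define m where "m y = ip N (f (cinv C y)) (pt.H (cinv C y)) (pt.H (cinv C y))" for y
  have \<eta>_frame: "\<eta> y = (1 / (2 * real k)) *\<^sub>R (\<Sum>a=1..2*k. sform g g' F y (e a) (e a))"
    if "y \<in> U" "orthonormal_wrt (g y) {1..2*k} e" for y e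
    unfolding \<eta>_def
    using inner_form.trace_dual_basis[OF I.src.inner_form_g I.sform_bilinear dual that(2)] that(1) dim_a by auto
  have \<eta>_diff: "\<eta> differentiable at x"
  proof -
    have "(\<lambda>y. dual y b) differentiable at x" for b
      by (rule I.src.differentiable_represented[OF I.in_S[OF x] dual]) auto
    then show ?thesis unfolding \<eta>_def
      by (intro differentiable_scaleR differentiable_const differentiable_sum ballI I.sform_field_differentiable[OF x]) auto
  qed
  \<comment> \<open>Each point uses its own charts and its own good frame, with no continuity
    between them; what is transported to C and C' is free of frames.\<close>
  have at_y: "g' (F y) (sform g g' F y u v) (\<eta> y) = m y * g y u v" "g' (F y) (\<eta> y) (\<eta> y) = m y"
    if y: "y \<in> U" for y u v
  proof -
    obtain q where q: "q \<in> cdom C" "f q \<in> cdom C'" "y = cmap C q" using y unfolding U_def by auto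
    have inv: "cinv C y = q" using cinv_cmap[OF atlas_chart[OF riem_M CM] q(1)] q(3) by simp
    define \<phi> \<psi> where "\<phi> = Dv (transition (chart_at M q) C) (coord M q)"
      and "\<psi> = Dv (transition (chart_at N (f q)) C') (coord N (f q))"
    have tr: "sform g g' F y (\<phi> u) (\<phi> v) = \<psi> (sff M N f q u v)" "g y (\<phi> u) (\<phi> v) = ip M q u v"
      "g' (F y) (\<psi> a) (\<psi> b) = ip N (f q) a b" "surj \<phi>" "linear \<psi>" for u v a b
      using sff_transition[OF sub CM CN q(1,2)]
      unfolding \<phi>_def \<psi>_def g_def g'_def F_def q(3) by auto
    obtain e where e: "pt.frame q e" "pt.good q e" using all by blast
    have "orthonormal_wrt (g y) {1..2*k} (\<lambda>a. \<phi> (e a))" using e(1) by (simp add: orthonormal_wrt_def tr(2))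
    from \<eta>_frame[OF y this]
    have \<eta>y: "\<eta> y = \<psi> (pt.H q)"
      using pt.sum_h[OF e(1)] k0 by (simp add: tr(1) linear_sum[OF tr(5), symmetric] linear_scale[OF tr(5)])
    show "g' (F y) (\<eta> y) (\<eta> y) = m y" unfolding \<eta>y tr(3) m_def inv ..
    obtain u0 v0 where "u = \<phi> u0" "v = \<phi> v0" using surjD[OF tr(4)] by metis
    then show "g' (F y) (sform g g' F y u v) (\<eta> y) = m y * g y u v"
      using umbilical_if_good[OF e] by (simp add: tr(1-3) \<eta>y m_def inv)
  qed
  obtain e where e: "pt.frame p e" "pt.good p e" using all by blast
  have \<eta>x: "\<eta> x = pt.H p"
    using \<eta>_frame[OF x, of e] e(1) pt.sum_h[OF e(1)] k0 by (simp add: gx hx)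
  have dm: "(m has_derivative (\<lambda>u. 2 * g' (F x) (\<eta> x) (covd g' F x u \<eta>))) (at x)"
  proof -
    have "((\<lambda>y. g' (F y) (\<eta> y) (\<eta> y)) has_derivative (\<lambda>u. 2 * g' (F x) (\<eta> x) (covd g' F x u \<eta>))) (at x)"
      using I.has_derivative_along[OF x \<eta>_diff \<eta>_diff] I.tgt.g_sym[OF I.in_T[OF x]] by simp
    then show ?thesis
      by (rule has_derivative_transform_within_open[OF _ I.open_U x]) (rule at_y(2))
  qed
  note Dm = Dv_eq[OF dm]
  have cod: "g x v w * Dv m x u - g x u w * Dv m x v =
      g' (F x) (sff M N f p v w) (covd g' F x u \<eta>) - g' (F x) (sff M N f p u w) (covd g' F x v \<eta>)" for u v w
    unfolding hx
  proof (rule I.codazzi_umbilical[OF x \<eta>_diff differentiableI[OF dm] I.open_U x order_refl at_y(1)])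
    show "g' (F x) (Dv F x z) (\<eta> x) = 0" for z
      using pt.H_normal[of p z] pt.tgt.form_sym[of p] unfolding \<eta>x g'x dx by metis
    \<comment> \<open>J of \<open>Dv F x w\<close> may have a component along H, but in the
      curvature it is multiplied by <dF u, J dF v> = 0.\<close>
    have "ip N (f p) (curv N (f p) (Dv F x u) (Dv F x v) (Dv F x w)) (pt.H p) = 0"
      using J_orthogonal[of p] J_orthogonal'[of p] pt.H_normal[of p] pt.tgt.form_sym[of p "pt.H p"]
      unfolding space_form_curv[OF space_form] dx by simp
    then show "g' (F x) (rcurv g' (F x) (Dv F x u) (Dv F x v) (Dv F x w)) (\<eta> x) = 0"
      using map_at_coord[OF sub, of p] unfolding g'x \<eta>x curv_def curv_loc_rcurv
      by (simp add: g'_def F_def C_def C'_def x_def)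
  qed
  have Dm_frame: "Dv m x (e a) = 0" if a: "a \<in> {1..2*k}" for a
  proof -
    \<comment> \<open>A block other than that of a; it exists because k \<ge> 2.\<close>
    define j where "j = (if (a + 1) div 2 = 1 then 2 else 1 :: nat)"
    have j: "j \<in> {1..k}" "(a + 1) div 2 \<noteq> j" using k_ge_2 by (auto simp: j_def)
    have idx: "2*j-1 \<in> {1..2*k}" "2*j \<in> {1..2*k}" "(a + 1) div 2 \<noteq> (2*j-1+1) div 2" "(a + 1) div 2 \<noteq> (2*j+1) div 2"
      using j by auto
    have "Dv m x (e a) = g' (F x) (sff M N f p (e b) (e b)) (covd g' F x (e a) \<eta>)"
      if b: "b \<in> {1..2*k}" "(a + 1) div 2 \<noteq> (b + 1) div 2" for b
    proof -
      have "sff M N f p (e a) (e b) = 0" using e(2) a b unfolding pt.good_def by blast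
      moreover have "a \<noteq> b" using b by auto
      ultimately show ?thesis
        using cod[of "e b" "e b" "e a"] orthonormal_wrtD[OF e(1) a b(1)] orthonormal_wrtD[OF e(1) b(1) b(1)]
          pt.tgt.form_simps(9)[of p] by (simp add: gx g'x)
    qed
    from this[OF idx(1,3)] this[OF idx(2,4)]
    have "2 * Dv m x (e a) = g' (F x) (pt.blocktr p e j) (covd g' F x (e a) \<eta>)"
      unfolding pt.blocktr_def by (simp add: g'x[symmetric] pt.tgt.form_simps)
    also have "pt.blocktr p e j = 2 *\<^sub>R \<eta> x" using e(2) j unfolding pt.good_def \<eta>x by blast
    also have "g' (F x) (2 *\<^sub>R \<eta> x) (covd g' F x (e a) \<eta>) = Dv m x (e a)"
      unfolding Dm g'x[symmetric] by (simp add: pt.tgt.form_simps)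
    finally show ?thesis by simp
  qed
  have "Dv m x u = 0" for u
  proof -
    have "linear (Dv m x)" using dm by (simp add: Dm has_derivative_linear)
    then have "Dv m x u = (\<Sum>a=1..2*k. ip M p u (e a) * Dv m x (e a))"
      by (subst pt.frame_expand[OF e(1), of u]) (simp add: linear_sum linear_scale)
    then show ?thesis using Dm_frame by simp
  qed
  then have "(\<lambda>u. 2 * g' (F x) (\<eta> x) (covd g' F x u \<eta>)) = (\<lambda>_. 0)" unfolding Dm by (rule ext)
  then show ?thesis using dm unfolding m_def C_def x_def by simp
qed

text \<open>A function whose derivative vanishes in charts is locally constant, hence constant on a
  connected space.\<close>

lemma mean_curvature_constant:
  assumes conn: "connected (UNIV :: 'p set)" and all: "\<And>p. \<exists>e. pt.frame p e \<and> pt.good p e"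
  shows "ip N (f p) (pt.H p) (pt.H p) = ip N (f q) (pt.H q) (pt.H q)"
proof -
  define m where "m p = ip N (f p) (pt.H p) (pt.H p)" for p
  have crit: "((\<lambda>y. m (cinv (chart_at M q) y)) has_derivative (\<lambda>_. 0)) (at (coord M q))" for q
    using mean_curvature_critical[OF all] unfolding m_def .
  have "\<forall>\<^sub>F q in at p within UNIV. m p = m q" for p
  proof -
    define C where "C = chart_at M p"
    have CM: "C \<in> atlas M" and pC: "p \<in> cdom C"
      using chart_at_atlas[OF riem_M] chart_at_mem[OF riem_M] by (auto simp: C_def)
    note ch = atlas_chart[OF riem_M CM]
    have "open (cran C)" using ch unfolding is_chart_def by blast
    then obtain r where r: "r > 0" "ball (cmap C p) r \<subseteq> cran C"
      using pC open_contains_ball by blast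
    let ?B = "ball (cmap C p) r"
    \<comment> \<open>\<open>crit\<close> concerns the chart chosen at a point, and only at that
      point; the transition from C to this chart moves the statement into C, at every point of the
      ball.\<close>
    have zero: "((\<lambda>y. m (cinv C y)) has_derivative (\<lambda>_. 0)) (at y)" if y: "y \<in> ?B" for y
    proof -
      obtain q where q: "q \<in> cdom C" "y = cmap C q" using y r(2) by blast
      define D where "D = chart_at M q"
      have DM: "D \<in> atlas M" and qD: "q \<in> cdom D"
        using chart_at_atlas[OF riem_M] chart_at_mem[OF riem_M] by (auto simp: D_def)
      interpret \<tau>: local_isometry "cran C" "metric M C" "cran D" "metric M D" "cmap C ` (cdom C \<inter> cdom D)" "transition C D"
        by (rule transition_isometry[OF riem_M CM DM])
      have yU: "y \<in> cmap C ` (cdom C \<inter> cdom D)" using q qD by blast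
      have \<tau>y: "transition C D y = coord M q" using q cinv_cmap[OF ch] by (simp add: transition_def D_def)
      have "((\<lambda>y. m (cinv D y)) has_derivative (\<lambda>_. 0)) (at (transition C D y))"
        unfolding \<tau>y unfolding D_def by (rule crit)
      from has_derivative_compose[OF Dv_has[OF \<tau>.F_differentiable[OF yU]] this]
      have "((\<lambda>y. m (cinv D (transition C D y))) has_derivative (\<lambda>_. 0)) (at y)" .
      then show ?thesis
        by (rule has_derivative_transform_within_open[OF _ \<tau>.open_U yU])
          (auto simp: transition_def cinv_cmap[OF ch] cinv_cmap[OF atlas_chart[OF riem_M DM]])
    qed
    have "\<exists>v. \<forall>y\<in>?B. m (cinv C y) = v"
      by (rule has_derivative_zero_constant[OF convex_ball]) (rule has_derivative_at_withinI[OF zero])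
    then obtain v where v: "\<And>y. y \<in> ?B \<Longrightarrow> m (cinv C y) = v" by blast
    have "p \<in> cinv C ` ?B"
      using r(1) cinv_cmap[OF ch pC] by (intro image_eqI[of _ _ "cmap C p"]) auto
    moreover have "open (cinv C ` ?B)" using r(2) by (intro open_chart_preimage[OF ch]) auto
    moreover have "m q = v" if "q \<in> cinv C ` ?B" for q using that v by blast
    ultimately show ?thesis unfolding eventually_at_topological by metis
  qed
  then show ?thesis using connected_local_const[OF conn, of p q m] by (simp add: m_def)
qed

end

theorem theorem3p1:
  fixes k :: nat and c :: real
    and M :: "('p::{t2_space,second_countable_topology}, 'a::euclidean_space) mfd"
    and N :: "('q::{t2_space,second_countable_topology}, complex^'m) mfd"
    and f :: "'p \<Rightarrow> 'q"
  assumes "k \<ge> 2" and "DIM('a) = 2 * k"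
    and "connected (UNIV :: 'p set)"
    and "complex_space_form N c"
    and "submanifold M N f" and "totally_real M N f" and "einstein M"
  shows "(\<forall>p. delta_Ric M k p \<le> 2 * (real k - 1) * (c + (mean_curvature M N f p)\<^sup>2)) \<and>
    ((\<forall>p. delta_Ric M k p = 2 * (real k - 1) * (c + (mean_curvature M N f p)\<^sup>2)) \<longleftrightarrow>
      (minimal M N f \<and> einstein M \<and> totally_real M N f \<and>
        (\<forall>p. \<exists>e \<xi>. adapted_frame M N f p e \<xi> \<and>
          (\<forall>r\<in>{2*k+1..2*CARD('m)}. traceless_blocks k e (shape_operator M N f p (\<xi> r))))) \<or>
      (pseudo_umbilical M N f \<and> einstein M \<and> totally_real M N f \<and>
        (\<forall>p. \<exists>e \<xi>. adapted_frame M N f p e \<xi> \<and>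
          (\<forall>r\<in>{2*k+2..2*CARD('m)}. traceless_blocks k e (shape_operator M N f p (\<xi> r))))))"
proof -
  interpret einstein_totally_real k c M N f
    by (intro einstein_totally_real.intro assms)
  have dim: "DIM(complex^'m) = 2 * CARD('m)" by simp
  have min: "minimal M N f \<longleftrightarrow> (\<forall>p. pt.H p = 0)"
    unfolding minimal_def mean_curvature_vector_H ..
  show ?thesis
  proof (intro conjI allI delta_le iffI)
    assume "\<forall>p. delta_Ric M k p = 2 * (real k - 1) * (c + (mean_curvature M N f p)\<^sup>2)"
    then have all: "\<exists>e. pt.frame p e \<and> pt.good p e" for p unfolding delta_eq_iff by blast
    have const: "pt.H p = 0 \<longleftrightarrow> pt.H q = 0" for p q
      using mean_curvature_constant[OF assms(3) all, of p q] pt.tgt.form_zero_iff by metis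
    \<comment> \<open>One statement for both cases: for r = 2k + 1 the traceless form is claimed
      only where H = 0, since otherwise that normal vector points along H.\<close>
    have frames: "\<exists>e \<xi>. adapted_frame M N f p e \<xi> \<and>
        (\<forall>r\<in>{2*k+1..2*CARD('m)}. pt.H p = 0 \<or> r \<noteq> 2*k+1 \<longrightarrow> traceless_blocks k e (shape_operator M N f p (\<xi> r)))" for p
    proof -
      obtain e where e: "pt.frame p e" "pt.good p e" using all by blast
      obtain \<xi> where \<xi>: "pt.adapted p \<xi>" "\<And>r. r \<in> {2*k+2..2*CARD('m)} \<Longrightarrow> ip N (f p) (pt.H p) (\<xi> r) = 0"
        using pt.adapted_exists[of p] unfolding dim by blast
      have "traceless_blocks k e (shape_operator M N f p (\<xi> r))"
        if "r \<in> {2*k+1..2*CARD('m)}" "pt.H p = 0 \<or> r \<noteq> 2*k+1" for r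
      proof -
        have "ip N (f p) (pt.H p) (\<xi> r) = 0"
        proof (cases "pt.H p = 0")
          case True then show ?thesis by (simp add: pt.tgt.form_simps)
        next
          case False then show ?thesis using that by (intro \<xi>(2)) auto
        qed
        then show ?thesis unfolding traceless_iff[OF e(1)] by (rule pt.good_traceless[OF e(2)])
      qed
      then show ?thesis using e \<xi> adapted_frame_iff by blast
    qed
    show "(minimal M N f \<and> einstein M \<and> totally_real M N f \<and>
        (\<forall>p. \<exists>e \<xi>. adapted_frame M N f p e \<xi> \<and>
          (\<forall>r\<in>{2*k+1..2*CARD('m)}. traceless_blocks k e (shape_operator M N f p (\<xi> r))))) \<or>
      (pseudo_umbilical M N f \<and> einstein M \<and> totally_real M N f \<and>
        (\<forall>p. \<exists>e \<xi>. adapted_frame M N f p e \<xi> \<and>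
          (\<forall>r\<in>{2*k+2..2*CARD('m)}. traceless_blocks k e (shape_operator M N f p (\<xi> r)))))"
    proof (cases "\<exists>p. pt.H p = 0")
      case True
      then have H0: "pt.H p = 0" for p using const by blast
      then have "minimal M N f" using min by blast
      moreover have "\<forall>p. \<exists>e \<xi>. adapted_frame M N f p e \<xi> \<and>
          (\<forall>r\<in>{2*k+1..2*CARD('m)}. traceless_blocks k e (shape_operator M N f p (\<xi> r)))"
        using frames H0 by meson
      ultimately show ?thesis using assms(6,7) by blast
    next
      case False
      then have "pseudo_umbilical M N f"
        unfolding pseudo_umbilical_iff using umbilical_if_good all by meson
      moreover have "\<forall>p. \<exists>e \<xi>. adapted_frame M N f p e \<xi> \<and>
          (\<forall>r\<in>{2*k+2..2*CARD('m)}. traceless_blocks k e (shape_operator M N f p (\<xi> r)))"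
      proof
        fix p
        obtain e \<xi> where "adapted_frame M N f p e \<xi>"
          "\<forall>r\<in>{2*k+1..2*CARD('m)}. pt.H p = 0 \<or> r \<noteq> 2*k+1 \<longrightarrow> traceless_blocks k e (shape_operator M N f p (\<xi> r))"
          using frames by blast
        then show "\<exists>e \<xi>. adapted_frame M N f p e \<xi> \<and>
          (\<forall>r\<in>{2*k+2..2*CARD('m)}. traceless_blocks k e (shape_operator M N f p (\<xi> r)))"
          by (intro exI[of _ e] exI[of _ \<xi>]) auto
      qed
      ultimately show ?thesis using assms(6,7) by blast
    qed
  next
    fix p
    assume "(minimal M N f \<and> einstein M \<and> totally_real M N f \<and>
        (\<forall>p. \<exists>e \<xi>. adapted_frame M N f p e \<xi> \<and>
          (\<forall>r\<in>{2*k+1..2*CARD('m)}. traceless_blocks k e (shape_operator M N f p (\<xi> r))))) \<or>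
      (pseudo_umbilical M N f \<and> einstein M \<and> totally_real M N f \<and>
        (\<forall>p. \<exists>e \<xi>. adapted_frame M N f p e \<xi> \<and>
          (\<forall>r\<in>{2*k+2..2*CARD('m)}. traceless_blocks k e (shape_operator M N f p (\<xi> r)))))"
    then have "\<exists>e. pt.frame p e \<and> pt.good p e"
    proof (elim disjE conjE)
      assume "minimal M N f" and fr: "\<forall>p. \<exists>e \<xi>. adapted_frame M N f p e \<xi> \<and>
          (\<forall>r\<in>{2*k+1..2*CARD('m)}. traceless_blocks k e (shape_operator M N f p (\<xi> r)))"
      then have H0: "pt.H p = 0" using min by blast
      obtain e \<xi> where e: "pt.frame p e" "pt.adapted p \<xi>"
        "\<And>r. r \<in> {2*k+1..2*CARD('m)} \<Longrightarrow> traceless_blocks k e (shape_operator M N f p (\<xi> r))"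
        using fr unfolding adapted_frame_iff by meson
      have "pt.good p e"
        by (rule pt.good_if_minimal[OF e(2) H0]) (use e(3) traceless_iff[OF e(1)] dim in auto)
      then show ?thesis using e(1) by blast
    next
      assume "pseudo_umbilical M N f" and fr: "\<forall>p. \<exists>e \<xi>. adapted_frame M N f p e \<xi> \<and>
          (\<forall>r\<in>{2*k+2..2*CARD('m)}. traceless_blocks k e (shape_operator M N f p (\<xi> r)))"
      then obtain \<mu> where H: "pt.H p \<noteq> 0" "\<And>u v. ip N (f p) (sff M N f p u v) (pt.H p) = \<mu> * ip M p u v"
        unfolding pseudo_umbilical_iff by meson
      obtain e \<xi> where e: "pt.frame p e" "pt.adapted p \<xi>"
        "\<And>r. r \<in> {2*k+2..2*CARD('m)} \<Longrightarrow> traceless_blocks k e (shape_operator M N f p (\<xi> r))"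
        using fr unfolding adapted_frame_iff by meson
      have "pt.good p e"
        by (rule pt.good_if_umbilical[OF e(1,2) H]) (use e(3) traceless_iff[OF e(1)] dim in auto)
      then show ?thesis using e(1) by blast
    qed
    then show "delta_Ric M k p = 2 * (real k - 1) * (c + (mean_curvature M N f p)\<^sup>2)"
      unfolding delta_eq_iff .
  qed
qed

end
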